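(* Let $(M,g)$ be a smooth $n$-dimensional Riemannian manifold of constant sectional curvature $c$. Let $A$ be a real constant and let $\lambda,\mu:[0,\infty)\to\mathbb{R}$ be smooth functions fulfilling the conditions $$\lambda>0,\qquad \frac{A^2-2ct\lambda^2}{\lambda+2t\lambda'}>0,\qquad \lambda+2t\mu>0\qquad\text{for all } t\ge0,\qquad A>0.$$ Let $J$ be the complex structure on $T^*M$ given by $$J\frac{\delta}{\delta q^i}=J^{(1)}_{ij}\frac{\partial}{\partial p_j},\qquad J\frac{\partial}{\partial p_i}=-J_{(2)}^{ij}\frac{\delta}{\delta q^j},$$ $$J^{(1)}_{ij}=\frac{A}{\lambda}g_{ij}-\frac{c\lambda^3+A^2\lambda'}{A\lambda(\lambda+2t\lambda')}p_ip_j,\qquad J_{(2)}^{ij}=\frac{\lambda}{A}g^{ij}+\frac{c\lambda^3+A^2\lambda'}{A(A^2-2ct\lambda^2)}g^{0i}g^{0j},$$ and let $G$ be the Riemannian metric on $T^*M$ given by $$G\Big(\frac{\delta}{\delta q^i},\frac{\delta}{\delta q^j}\Big)=c_1g_{ij}+d_1p_ip_j,\qquad G\Big(\frac{\partial}{\partial p_i},\frac{\partial}{\partial p_j}\Big)=c_2g^{ij}+d_2g^{0i}g^{0j},\qquad G\Big(\frac{\partial}{\partial p_i},\frac{\delta}{\delta q^j}\Big)=0,$$ where $$c_1=A,\quad c_2=\frac{\lambda^2}{A},\quad d_1=\frac{-(c\lambda^3+A^2\lambda')+\mu(A^2-2ct\lambda^2)}{A(\lambda+2t\lambda')},\quad d_2=\frac{\lambda(c\lambda^3+A^2\lambda')+\mu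 A^2(\lambda+2t\lambda')}{A(A^2-2ct\lambda^2)}.$$ Then $(G,J)$ is a Hermitian structure on $T^*M$ (so one obtains a class of Hermitian structures depending on the two parameters $\lambda$ and $\mu$).
   Context: Let $\pi:T^*M\to M$ be the cotangent bundle of $M$. A local chart $(U,x^1,\dots,x^n)$ on $M$ induces the local chart $(\pi^{-1}(U),q^1,\dots,q^n,p_1,\dots,p_n)$ on $T^*M$ with $q^i=x^i\circ\pi$ and $p=p_i\,dx^i_{\pi(p)}$. The summation convention is used and all indices run over $1,\dots,n$. $g_{ij}$ are the components of $g$, $(g^{ij})$ is the inverse matrix (both evaluated at $\pi(p)$), and $g^{0i}=p_hg^{hi}$. With $\Gamma^k_{ih}$ the Christoffel symbols of $g$, put $\frac{\delta}{\delta q^i}=\frac{\partial}{\partial q^i}+p_k\Gamma^k_{ih}\frac{\partial}{\partial p_h}$; the fields $\frac{\delta}{\delta q^1},\dots,\frac{\delta}{\delta q^n},\frac{\partial}{\partial p_1},\dots,\frac{\partial}{\partial p_n}$ form a local frame on $T^*M$ (the adapted local frame). The energy density is $t=\frac12 g^{ik}(\pi(p))p_ip_k\in[0,\infty)$; functions of $t$ such as $\lambda,\mu$ and $\lambda'=d\lambda/dt$ are viewed as functions on $T^*M$ by evaluating them at the energy density. $(G,J)$ is a Hermitian structure if $J$ is an integrable almost complex structure, $G$ is a Riemannian metric, and $G(JX,JY)=G(X,Y)$ for all vector fields $X,Y$ on $T^*M$. *)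

theory Defs
  imports "HOL-Analysis.Analysis"
begin

section \<open>Smooth maps on subsets of Euclidean spaces\<close>

text \<open>
  The set S is always either open or the half-line {0..}; in both cases the derivative
  within S is unique (on the half-line it is one-sided at the boundary point 0).
\<close>

primrec Ck_on :: "nat \<Rightarrow> 'a::euclidean_space set \<Rightarrow> ('a \<Rightarrow> 'b::real_normed_vector) \<Rightarrow> bool" where
  "Ck_on 0 = (\<lambda>S f. continuous_on S f)"
| "Ck_on (Suc k) = (\<lambda>S f. f differentiable_on S \<and>
     (\<forall>v. Ck_on k S (\<lambda>x. frechet_derivative f (at x within S) v)))"

definition smooth_on :: "'a::euclidean_space set \<Rightarrow> ('a \<Rightarrow> 'b::real_normed_vector) \<Rightarrow> bool" where
  "smooth_on S f \<longleftrightarrow> (\<forall>k. Ck_on k S f)"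

definition partial_deriv :: "'n::finite \<Rightarrow> (real^'n \<Rightarrow> real) \<Rightarrow> real^'n \<Rightarrow> real" where
  "partial_deriv i f y = frechet_derivative f (at y) (axis i 1)"

definition halfline_deriv :: "(real \<Rightarrow> real) \<Rightarrow> real \<Rightarrow> real" where
  "halfline_deriv f t = vector_derivative f (at t within {0..})"


section \<open>Smooth manifolds\<close>

text \<open>
  A chart is a domain together with a coordinate map; the values of the coordinate map outside
  the domain are irrelevant. A manifold is given by an atlas; its underlying set is the union of
  the chart domains and its topology is the one for which the charts are homeomorphisms onto
  open sets. The atlas need not be maximal.
\<close>

type_synonym ('m, 'e) chart = "'m set \<times> ('m \<Rightarrow> 'e)"

abbreviation chart_dom :: "('m, 'e) chart \<Rightarrow> 'm set" where
  "chart_dom \<kappa> \<equiv> fst \<kappa>"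

abbreviation chart_map :: "('m, 'e) chart \<Rightarrow> 'm \<Rightarrow> 'e" where
  "chart_map \<kappa> \<equiv> snd \<kappa>"

definition chart_img :: "('m, 'e) chart \<Rightarrow> 'e set" where
  "chart_img \<kappa> = chart_map \<kappa> ` chart_dom \<kappa>"

definition chart_inv :: "('m, 'e) chart \<Rightarrow> 'e \<Rightarrow> 'm" where
  "chart_inv \<kappa> = inv_into (chart_dom \<kappa>) (chart_map \<kappa>)"

definition transition :: "('m, 'e) chart \<Rightarrow> ('m, 'e) chart \<Rightarrow> 'e \<Rightarrow> 'e" where
  "transition \<kappa> \<kappa>' = chart_map \<kappa>' \<circ> chart_inv \<kappa>"

definition points :: "('m, 'e) chart set \<Rightarrow> 'm set" where
  "points M = (\<Union>\<kappa>\<in>M. chart_dom \<kappa>)"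

definition charts_at :: "('m, 'e) chart set \<Rightarrow> 'm \<Rightarrow> ('m, 'e) chart set" where
  "charts_at M x = {\<kappa> \<in> M. x \<in> chart_dom \<kappa>}"

definition smooth_atlas :: "('m, 'e::euclidean_space) chart set \<Rightarrow> bool" where
  "smooth_atlas M \<longleftrightarrow>
     (\<forall>\<kappa>\<in>M. inj_on (chart_map \<kappa>) (chart_dom \<kappa>)) \<and>
     (\<forall>\<kappa>\<in>M. \<forall>\<kappa>'\<in>M.
        open (chart_map \<kappa> ` (chart_dom \<kappa> \<inter> chart_dom \<kappa>')) \<and>
        smooth_on (chart_map \<kappa> ` (chart_dom \<kappa> \<inter> chart_dom \<kappa>')) (transition \<kappa> \<kappa>'))"

definition manifold_topology :: "('m, 'e::euclidean_space) chart set \<Rightarrow> 'm topology" where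
  "manifold_topology M = topology (\<lambda>W. W \<subseteq> points M \<and>
     (\<forall>\<kappa>\<in>M. open (chart_map \<kappa> ` (W \<inter> chart_dom \<kappa>))))"

definition smooth_manifold :: "('m, 'e::euclidean_space) chart set \<Rightarrow> bool" where
  "smooth_manifold M \<longleftrightarrow> smooth_atlas M \<and>
     Hausdorff_space (manifold_topology M) \<and> second_countable (manifold_topology M)"


section \<open>Tangent vectors and tensor fields\<close>

text \<open>
  A tangent vector at x is the family of its component vectors in all charts around x, subject
  to the transformation law; components in all other charts are set to 0, so that equality of
  tangent vectors is equality of functions and the vector space operations are pointwise.
\<close>

type_synonym ('m, 'e) tvec = "('m, 'e) chart \<Rightarrow> 'e"

definition tangent_space :: "('m, 'e::euclidean_space) chart set \<Rightarrow> 'm \<Rightarrow> ('m, 'e) tvec set" where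
  "tangent_space M x = {v.
     (\<forall>\<kappa>\<in>charts_at M x. \<forall>\<kappa>'\<in>charts_at M x.
        v \<kappa>' = frechet_derivative (transition \<kappa> \<kappa>') (at (chart_map \<kappa> x)) (v \<kappa>)) \<and>
     (\<forall>\<kappa>. \<kappa> \<notin> charts_at M x \<longrightarrow> v \<kappa> = 0)}"

text \<open>The tangent vector at x whose component vector in the chart \<open>\<kappa>\<close> is b.\<close>

definition coord_vec ::
  "('m, 'e::euclidean_space) chart set \<Rightarrow> ('m, 'e) chart \<Rightarrow> 'm \<Rightarrow> 'e \<Rightarrow> ('m, 'e) tvec" where
  "coord_vec M \<kappa> x b = (\<lambda>\<kappa>'. if \<kappa>' \<in> charts_at M x
     then frechet_derivative (transition \<kappa> \<kappa>') (at (chart_map \<kappa> x)) b else 0)"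

definition linear_functional_on_tangent ::
  "('m, 'e::euclidean_space) chart set \<Rightarrow> 'm \<Rightarrow> (('m, 'e) tvec \<Rightarrow> real) \<Rightarrow> bool" where
  "linear_functional_on_tangent M x \<alpha> \<longleftrightarrow>
     (\<forall>u\<in>tangent_space M x. \<forall>v\<in>tangent_space M x. \<forall>a b.
        \<alpha> (\<lambda>\<kappa>. a *\<^sub>R u \<kappa> + b *\<^sub>R v \<kappa>) = a * \<alpha> u + b * \<alpha> v)"

definition vector_field ::
  "('m, 'e::euclidean_space) chart set \<Rightarrow> ('m \<Rightarrow> ('m, 'e) tvec) \<Rightarrow> bool" where
  "vector_field M X \<longleftrightarrow> (\<forall>x\<in>points M. X x \<in> tangent_space M x) \<and>
     (\<forall>\<kappa>\<in>M. smooth_on (chart_img \<kappa>) (\<lambda>y. X (chart_inv \<kappa> y) \<kappa>))"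

definition lie_bracket ::
  "('m, 'e::euclidean_space) chart set \<Rightarrow> ('m \<Rightarrow> ('m, 'e) tvec) \<Rightarrow> ('m \<Rightarrow> ('m, 'e) tvec)
     \<Rightarrow> 'm \<Rightarrow> ('m, 'e) tvec" where
  "lie_bracket M X Y x = (\<lambda>\<kappa>. if \<kappa> \<in> charts_at M x
     then frechet_derivative (\<lambda>y. Y (chart_inv \<kappa> y) \<kappa>) (at (chart_map \<kappa> x)) (X x \<kappa>)
        - frechet_derivative (\<lambda>y. X (chart_inv \<kappa> y) \<kappa>) (at (chart_map \<kappa> x)) (Y x \<kappa>)
     else 0)"

definition endomorphism_field ::
  "('m, 'e::euclidean_space) chart set \<Rightarrow> ('m \<Rightarrow> ('m, 'e) tvec \<Rightarrow> ('m, 'e) tvec) \<Rightarrow> bool" where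
  "endomorphism_field M J \<longleftrightarrow> (\<forall>x\<in>points M.
     (\<forall>v\<in>tangent_space M x. J x v \<in> tangent_space M x) \<and>
     (\<forall>u\<in>tangent_space M x. \<forall>v\<in>tangent_space M x. \<forall>a b.
        J x (\<lambda>\<kappa>. a *\<^sub>R u \<kappa> + b *\<^sub>R v \<kappa>) = (\<lambda>\<kappa>. a *\<^sub>R J x u \<kappa> + b *\<^sub>R J x v \<kappa>)))"

definition symmetric_bilinear_field ::
  "('m, 'e::euclidean_space) chart set \<Rightarrow> ('m \<Rightarrow> ('m, 'e) tvec \<Rightarrow> ('m, 'e) tvec \<Rightarrow> real) \<Rightarrow> bool"
  where
  "symmetric_bilinear_field M g \<longleftrightarrow> (\<forall>x\<in>points M.
     (\<forall>u\<in>tangent_space M x. linear_functional_on_tangent M x (g x u)) \<and>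
     (\<forall>u\<in>tangent_space M x. \<forall>v\<in>tangent_space M x. g x u v = g x v u))"

definition riemannian_metric ::
  "('m, 'e::euclidean_space) chart set \<Rightarrow> ('m \<Rightarrow> ('m, 'e) tvec \<Rightarrow> ('m, 'e) tvec \<Rightarrow> real) \<Rightarrow> bool"
  where
  "riemannian_metric M g \<longleftrightarrow>
     symmetric_bilinear_field M g \<and>
     (\<forall>x\<in>points M. \<forall>u\<in>tangent_space M x. u \<noteq> (\<lambda>_. 0) \<longrightarrow> g x u u > 0) \<and>
     (\<forall>\<kappa>\<in>M. \<forall>a b. smooth_on (chart_img \<kappa>)
        (\<lambda>y. g (chart_inv \<kappa> y)
               (coord_vec M \<kappa> (chart_inv \<kappa> y) a) (coord_vec M \<kappa> (chart_inv \<kappa> y) b)))"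


section \<open>Hermitian structures\<close>

definition almost_complex_structure ::
  "('m, 'e::euclidean_space) chart set \<Rightarrow> ('m \<Rightarrow> ('m, 'e) tvec \<Rightarrow> ('m, 'e) tvec) \<Rightarrow> bool" where
  "almost_complex_structure M J \<longleftrightarrow>
     endomorphism_field M J \<and>
     (\<forall>\<kappa>\<in>M. \<forall>b. smooth_on (chart_img \<kappa>)
        (\<lambda>y. J (chart_inv \<kappa> y) (coord_vec M \<kappa> (chart_inv \<kappa> y) b) \<kappa>)) \<and>
     (\<forall>x\<in>points M. \<forall>v\<in>tangent_space M x. J x (J x v) = (\<lambda>\<kappa>. - v \<kappa>))"

definition nijenhuis ::
  "('m, 'e::euclidean_space) chart set \<Rightarrow> ('m \<Rightarrow> ('m, 'e) tvec \<Rightarrow> ('m, 'e) tvec)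
     \<Rightarrow> ('m \<Rightarrow> ('m, 'e) tvec) \<Rightarrow> ('m \<Rightarrow> ('m, 'e) tvec) \<Rightarrow> 'm \<Rightarrow> ('m, 'e) tvec" where
  "nijenhuis M J X Y x = (\<lambda>\<kappa>.
       lie_bracket M (\<lambda>z. J z (X z)) (\<lambda>z. J z (Y z)) x \<kappa>
     - J x (lie_bracket M (\<lambda>z. J z (X z)) Y x) \<kappa>
     - J x (lie_bracket M X (\<lambda>z. J z (Y z)) x) \<kappa>
     - lie_bracket M X Y x \<kappa>)"

text \<open>
  Integrability is the vanishing of the Nijenhuis tensor; by the Newlander-Nirenberg theorem this
  is the same as J being induced by a complex manifold structure.
\<close>

definition integrable_acs ::
  "('m, 'e::euclidean_space) chart set \<Rightarrow> ('m \<Rightarrow> ('m, 'e) tvec \<Rightarrow> ('m, 'e) tvec) \<Rightarrow> bool" where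
  "integrable_acs M J \<longleftrightarrow> almost_complex_structure M J \<and>
     (\<forall>X Y. vector_field M X \<longrightarrow> vector_field M Y \<longrightarrow>
        (\<forall>x\<in>points M. nijenhuis M J X Y x = (\<lambda>_. 0)))"

definition hermitian_structure ::
  "('m, 'e::euclidean_space) chart set \<Rightarrow> ('m \<Rightarrow> ('m, 'e) tvec \<Rightarrow> ('m, 'e) tvec \<Rightarrow> real)
     \<Rightarrow> ('m \<Rightarrow> ('m, 'e) tvec \<Rightarrow> ('m, 'e) tvec) \<Rightarrow> bool" where
  "hermitian_structure M G J \<longleftrightarrow>
     integrable_acs M J \<and> riemannian_metric M G \<and>
     (\<forall>X Y. vector_field M X \<longrightarrow> vector_field M Y \<longrightarrow>
        (\<forall>x\<in>points M. G x (J x (X x)) (J x (Y x)) = G x (X x) (Y x)))"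


section \<open>Levi-Civita connection and sectional curvature in local coordinates\<close>

context
  fixes M :: "('m, real^'n::finite) chart set"
    and g :: "'m \<Rightarrow> ('m, real^'n) tvec \<Rightarrow> ('m, real^'n) tvec \<Rightarrow> real"
    and \<kappa> :: "('m, real^'n) chart"
begin

definition metric_matrix :: "real^'n \<Rightarrow> real^'n^'n" where
  "metric_matrix y = (\<chi> i j. g (chart_inv \<kappa> y)
     (coord_vec M \<kappa> (chart_inv \<kappa> y) (axis i 1)) (coord_vec M \<kappa> (chart_inv \<kappa> y) (axis j 1)))"

definition inverse_metric_matrix :: "real^'n \<Rightarrow> real^'n^'n" where
  "inverse_metric_matrix y = matrix_inv (metric_matrix y)"

text \<open>\<open>christoffel k i j\<close> is the symbol with upper index k and lower indices i, j.\<close>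

definition christoffel :: "'n \<Rightarrow> 'n \<Rightarrow> 'n \<Rightarrow> real^'n \<Rightarrow> real" where
  "christoffel k i j y = (1/2) * (\<Sum>l\<in>UNIV. inverse_metric_matrix y $ k $ l *
     (partial_deriv i (\<lambda>z. metric_matrix z $ j $ l) y
      + partial_deriv j (\<lambda>z. metric_matrix z $ i $ l) y
      - partial_deriv l (\<lambda>z. metric_matrix z $ i $ j) y))"

text \<open>
  \<open>curvature_coeff l k i j\<close> is the l-th component of \<open>R(\<partial>\<^sub>i, \<partial>\<^sub>j)\<partial>\<^sub>k\<close>, where
  \<open>R(X,Y)Z = \<nabla>\<^sub>X\<nabla>\<^sub>Y Z - \<nabla>\<^sub>Y\<nabla>\<^sub>X Z - \<nabla>\<^bsub>[X,Y]\<^esub> Z\<close>.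
\<close>

definition curvature_coeff :: "'n \<Rightarrow> 'n \<Rightarrow> 'n \<Rightarrow> 'n \<Rightarrow> real^'n \<Rightarrow> real" where
  "curvature_coeff l k i j y =
     partial_deriv i (christoffel l j k) y - partial_deriv j (christoffel l i k) y
     + (\<Sum>h\<in>UNIV. christoffel l i h y * christoffel h j k y
                  - christoffel l j h y * christoffel h i k y)"

definition curvature_op :: "real^'n \<Rightarrow> real^'n \<Rightarrow> real^'n \<Rightarrow> real^'n \<Rightarrow> real^'n" where
  "curvature_op y u v w = (\<chi> l. \<Sum>k\<in>UNIV. \<Sum>i\<in>UNIV. \<Sum>j\<in>UNIV.
     curvature_coeff l k i j y * u $ i * v $ j * w $ k)"

definition metric_form :: "real^'n \<Rightarrow> real^'n \<Rightarrow> real^'n \<Rightarrow> real" where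
  "metric_form y u v = (\<Sum>i\<in>UNIV. \<Sum>j\<in>UNIV. metric_matrix y $ i $ j * u $ i * v $ j)"

definition sectional_curvature :: "real^'n \<Rightarrow> real^'n \<Rightarrow> real^'n \<Rightarrow> real" where
  "sectional_curvature y u v = metric_form y (curvature_op y u v v) u /
     (metric_form y u u * metric_form y v v - (metric_form y u v)\<^sup>2)"

end

text \<open>
  The vectors u, v are the component vectors in the chart \<open>\<kappa>\<close> of two tangent vectors spanning
  a plane. If the dimension is 1 there are no planes and the condition is void.
\<close>

definition constant_sectional_curvature ::
  "('m, real^'n::finite) chart set \<Rightarrow> ('m \<Rightarrow> ('m, real^'n) tvec \<Rightarrow> ('m, real^'n) tvec \<Rightarrow> real)
     \<Rightarrow> real \<Rightarrow> bool" where
  "constant_sectional_curvature M g c \<longleftrightarrow>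
     (\<forall>\<kappa>\<in>M. \<forall>y\<in>chart_img \<kappa>. \<forall>u v. u \<noteq> v \<and> independent {u, v} \<longrightarrow>
        sectional_curvature M g \<kappa> y u v = c)"


section \<open>The cotangent bundle\<close>

text \<open>
  A covector at x is a linear functional on the tangent space at x, set to 0 elsewhere.
\<close>

type_synonym ('m, 'e) covec = "('m, 'e) tvec \<Rightarrow> real"

definition cotangent_space ::
  "('m, 'e::euclidean_space) chart set \<Rightarrow> 'm \<Rightarrow> ('m, 'e) covec set" where
  "cotangent_space M x = {\<alpha>. linear_functional_on_tangent M x \<alpha> \<and>
     (\<forall>v. v \<notin> tangent_space M x \<longrightarrow> \<alpha> v = 0)}"

type_synonym ('m, 'n) cotangent_point = "'m \<times> ('m, real^'n) covec"

text \<open>The coordinates are (q, p), the i-th momentum coordinate being the value on the i-th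
  coordinate vector.\<close>

definition cotangent_chart ::
  "('m, real^'n::finite) chart set \<Rightarrow> ('m, real^'n) chart
     \<Rightarrow> (('m, 'n) cotangent_point, (real^'n) \<times> (real^'n)) chart" where
  "cotangent_chart M \<kappa> =
     ({(x, \<alpha>). x \<in> chart_dom \<kappa> \<and> \<alpha> \<in> cotangent_space M x},
      (\<lambda>(x, \<alpha>). (chart_map \<kappa> x, \<chi> i. \<alpha> (coord_vec M \<kappa> x (axis i 1)))))"

definition cotangent_bundle ::
  "('m, real^'n::finite) chart set
     \<Rightarrow> (('m, 'n) cotangent_point, (real^'n) \<times> (real^'n)) chart set" where
  "cotangent_bundle M = cotangent_chart M ` M"

type_synonym ('m, 'n) cotangent_tvec =
  "(('m, 'n) cotangent_point, (real^'n) \<times> (real^'n)) tvec"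

context
  fixes M :: "('m, real^'n::finite) chart set"
    and g :: "'m \<Rightarrow> ('m, real^'n) tvec \<Rightarrow> ('m, real^'n) tvec \<Rightarrow> real"
    and \<kappa> :: "('m, real^'n) chart"
    and P :: "('m, 'n) cotangent_point"
begin

definition pos :: "real^'n" where
  "pos = fst (chart_map (cotangent_chart M \<kappa>) P)"

definition mom :: "real^'n" where
  "mom = snd (chart_map (cotangent_chart M \<kappa>) P)"

definition g_lower :: "'n \<Rightarrow> 'n \<Rightarrow> real" where
  "g_lower i j = metric_matrix M g \<kappa> pos $ i $ j"

definition g_upper :: "'n \<Rightarrow> 'n \<Rightarrow> real" where
  "g_upper i j = inverse_metric_matrix M g \<kappa> pos $ i $ j"

text \<open>The components of the momentum with raised index (upper indices 0, i).\<close>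

definition g_raised :: "'n \<Rightarrow> real" where
  "g_raised i = (\<Sum>h\<in>UNIV. mom $ h * g_upper h i)"

definition energy_density :: real where
  "energy_density = (1/2) * (\<Sum>i\<in>UNIV. \<Sum>k\<in>UNIV. g_upper i k * mom $ i * mom $ k)"

definition d_dq :: "'n \<Rightarrow> ('m, 'n) cotangent_tvec" where
  "d_dq i = coord_vec (cotangent_bundle M) (cotangent_chart M \<kappa>) P (axis i 1, 0)"

definition d_dp :: "'n \<Rightarrow> ('m, 'n) cotangent_tvec" where
  "d_dp i = coord_vec (cotangent_bundle M) (cotangent_chart M \<kappa>) P (0, axis i 1)"

definition delta_dq :: "'n \<Rightarrow> ('m, 'n) cotangent_tvec" where
  "delta_dq i = (\<lambda>\<eta>. d_dq i \<eta> +
     (\<Sum>h\<in>UNIV. (\<Sum>k\<in>UNIV. mom $ k * christoffel M g \<kappa> k i h pos) *\<^sub>R d_dp h \<eta>))"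

end


section \<open>The coefficients of the natural almost complex structure and metric\<close>

context
  fixes A c :: real and lam mu :: "real \<Rightarrow> real"
begin

definition J1_coeff ::
  "('m, real^'n::finite) chart set \<Rightarrow> ('m \<Rightarrow> ('m, real^'n) tvec \<Rightarrow> ('m, real^'n) tvec \<Rightarrow> real)
     \<Rightarrow> ('m, real^'n) chart \<Rightarrow> ('m, 'n) cotangent_point \<Rightarrow> 'n \<Rightarrow> 'n \<Rightarrow> real" where
  "J1_coeff M g \<kappa> P i j =
     (let t = energy_density M g \<kappa> P; l = lam t; l' = halfline_deriv lam t in
        A / l * g_lower M g \<kappa> P i j
        - (c * l^3 + A\<^sup>2 * l') / (A * l * (l + 2 * t * l')) * mom M \<kappa> P $ i * mom M \<kappa> P $ j)"

definition J2_coeff ::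
  "('m, real^'n::finite) chart set \<Rightarrow> ('m \<Rightarrow> ('m, real^'n) tvec \<Rightarrow> ('m, real^'n) tvec \<Rightarrow> real)
     \<Rightarrow> ('m, real^'n) chart \<Rightarrow> ('m, 'n) cotangent_point \<Rightarrow> 'n \<Rightarrow> 'n \<Rightarrow> real" where
  "J2_coeff M g \<kappa> P i j =
     (let t = energy_density M g \<kappa> P; l = lam t; l' = halfline_deriv lam t in
        l / A * g_upper M g \<kappa> P i j
        + (c * l^3 + A\<^sup>2 * l') / (A * (A\<^sup>2 - 2 * c * t * l\<^sup>2))
          * g_raised M g \<kappa> P i * g_raised M g \<kappa> P j)"

definition c1_coeff :: "real \<Rightarrow> real" where
  "c1_coeff t = A"

definition c2_coeff :: "real \<Rightarrow> real" where
  "c2_coeff t = (lam t)\<^sup>2 / A"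

definition d1_coeff :: "real \<Rightarrow> real" where
  "d1_coeff t =
     (let l = lam t; l' = halfline_deriv lam t; m = mu t in
        (- (c * l^3 + A\<^sup>2 * l') + m * (A\<^sup>2 - 2 * c * t * l\<^sup>2)) / (A * (l + 2 * t * l')))"

definition d2_coeff :: "real \<Rightarrow> real" where
  "d2_coeff t =
     (let l = lam t; l' = halfline_deriv lam t; m = mu t in
        (l * (c * l^3 + A\<^sup>2 * l') + m * A\<^sup>2 * (l + 2 * t * l')) / (A * (A\<^sup>2 - 2 * c * t * l\<^sup>2)))"

end

end

theory Submission
  imports Defs
begin

text \<open>
  On the chart of the cotangent bundle induced by a chart of M, a tangent vector splits
  uniquely into a horizontal lift \<open>hor y u = (u, chr q p u)\<close> at \<open>y = (q, p)\<close>, which is the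
  combination of the \<open>\<delta>/\<delta>q\<close> with components u, and a vertical vector \<open>(0, w)\<close>. In this
  splitting J is \<open>J (hor y u) = (0, B u)\<close>, \<open>J (0, w) = - hor y (C w)\<close> with
  \<open>B = a1 g + b1 p p\<close> and \<open>C = a2 g\<^sup>-\<^sup>1 + b2 r r\<close>, where r is p with raised index, and G is the
  orthogonal sum of \<open>A g + d1 p p\<close> and \<open>c2 g\<^sup>-\<^sup>1 + d2 r r\<close>. Each of these forms is a multiple of
  the metric or its inverse plus a rank one term in the direction of p, so every algebraic claim
  is a computation with two numbers: the factor on the complement of p, and the factor on p itself,
  where \<open>p \<bullet> r = 2 t\<close>. With \<open>N = c \<lambda>\<^sup>3 + A\<^sup>2 \<lambda>'\<close>, \<open>Q = A\<^sup>2 - 2 c t \<lambda>\<^sup>2\<close> and \<open>S = \<lambda> + 2 t \<lambda>'\<close> one has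
  \<open>A\<^sup>2 S - \<lambda> Q = 2 t N\<close>, and this relation gives \<open>B C = 1\<close>, hence \<open>J\<^sup>2 = -1\<close>, and the
  invariance of G under J. The quotient \<open>Q / S\<close> is positive, so Q does not vanish; as it is
  positive at 0, both Q and S are positive everywhere. Then
  \<open>A + 2 t d1 = (\<lambda> + 2 t \<mu>) Q / (A S)\<close> and its analogue for the vertical part are positive, and the
  Cauchy inequality \<open>(p \<bullet> u)\<^sup>2 \<le> 2 t g(u, u)\<close> makes G positive definite.

  Integrability is the vanishing of the Nijenhuis tensor. It is bilinear, complex antilinear
  in each argument, and horizontal vectors generate the tangent space over J, so it is enough
  to evaluate it on two horizontal lifts (\<open>nijenhuis_local_generated\<close>). There it has two parts.
  The horizontal part vanishes for every choice of the coefficients, because the metric is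
  parallel, the connection is torsion free, and the energy density is constant along
  horizontal lifts (\<open>derivative_metric\<close>, \<open>conn_sym\<close>, \<open>energy_derivative\<close>). The vertical part is the
  curvature of the horizontal distribution plus a multiple of the same expression
  \<open>(p \<bullet> u) g v - (p \<bullet> v) g u\<close>, coming from the vertical derivatives of B. For
  constant sectional curvature the first is known (\<open>lowered_curvature\<close>,
  \<open>curvature_horizontal\<close>), and the two cancel when \<open>a1' (a1 + 2 t b1) - a1 b1 = c\<close>; solving this
  equation for b1 is where the coefficients of J come from (\<open>integrability_coefficient\<close>).

  The remaining work is to reduce the global notions to one chart. The Nijenhuis tensor
  applies J to Lie brackets, so the brackets have to be tangent vectors; this is the
  invariance of the bracket under coordinate changes, which rests on the symmetry of second
  derivatives.
\<close>

section \<open>Linear maps in coordinates\<close>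

text \<open>
  Linear maps that depend on a point are handled through their values on a fixed basis,
  so that smoothness and differentiability reduce to those of finitely many functions.
\<close>

lemma linear_expansion:
  fixes L :: "'a::euclidean_space \<Rightarrow> 'b::real_vector"
  assumes "linear L"
  shows "L w = (\<Sum>b\<in>Basis. (w \<bullet> b) *\<^sub>R L b)"
proof -
  have "L w = L (\<Sum>b\<in>Basis. (w \<bullet> b) *\<^sub>R b)" by (simp add: euclidean_representation)
  also have "\<dots> = (\<Sum>b\<in>Basis. (w \<bullet> b) *\<^sub>R L b)"
    using assms by (simp add: linear_sum linear_cmul)
  finally show ?thesis .
qed

lemma linear_axis_expansion:
  fixes f :: "real^'n::finite \<Rightarrow> 'b::real_vector"
  assumes "linear f"
  shows "f v = (\<Sum>i\<in>UNIV. (v $ i) *\<^sub>R f (axis i 1))"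
proof -
  have "v = (\<Sum>i\<in>UNIV. (v $ i) *\<^sub>R axis i 1)"
    using basis_expansion[of v] by (simp add: scalar_mult_eq_scaleR)
  then have "f v = f (\<Sum>i\<in>UNIV. (v $ i) *\<^sub>R axis i 1)" by simp
  also have "\<dots> = (\<Sum>i\<in>UNIV. (v $ i) *\<^sub>R f (axis i 1))"
    using assms by (simp add: linear_sum linear_cmul)
  finally show ?thesis .
qed

lemma linear_eq_on_axes:
  fixes f h :: "real^'n::finite \<Rightarrow> 'b::real_vector"
  assumes "linear f" "linear h" "\<And>i. f (axis i 1) = h (axis i 1)"
  shows "f v = h v"
  by (simp add: linear_axis_expansion[OF assms(1), of v] linear_axis_expansion[OF assms(2), of v] assms(3))

lemma bilinear_eq_on_axes:
  fixes f h :: "real^'n::finite \<Rightarrow> real^'m::finite \<Rightarrow> 'b::real_vector"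
  assumes f: "\<And>u. linear (f u)" "\<And>v. linear (\<lambda>u. f u v)"
    and h: "\<And>u. linear (h u)" "\<And>v. linear (\<lambda>u. h u v)"
    and eq: "\<And>i j. f (axis i 1) (axis j 1) = h (axis i 1) (axis j 1)"
  shows "f u v = h u v"
proof -
  have "f (axis i 1) v = h (axis i 1) v" for i
    by (rule linear_eq_on_axes[OF f(1) h(1) eq])
  then show ?thesis by (rule linear_eq_on_axes[OF f(2) h(2)])
qed

section \<open>Calculus of smooth maps\<close>

lemma frechet_derivative_within_cong:
  assumes "x \<in> S" "\<And>y. y \<in> S \<Longrightarrow> f y = g y"
  shows "frechet_derivative f (at x within S) = frechet_derivative g (at x within S)"
proof -
  have "(f has_derivative D) (at x within S) \<longleftrightarrow> (g has_derivative D) (at x within S)" for D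
    using assms has_derivative_transform[of x S f g D] has_derivative_transform[of x S g f D] by auto
  then show ?thesis
    by (simp add: frechet_derivative_def)
qed

lemma Ck_on_cong:
  assumes "\<And>x. x \<in> S \<Longrightarrow> f x = g x"
  shows "Ck_on k S f \<longleftrightarrow> Ck_on k S g"
  using assms
proof (induction k arbitrary: f g)
  case 0
  then show ?case by (auto intro: continuous_on_cong)
next
  case (Suc k)
  have 1: "f differentiable_on S \<longleftrightarrow> g differentiable_on S"
    unfolding differentiable_on_def differentiable_def
    using has_derivative_transform[of _ S f g] has_derivative_transform[of _ S g f] Suc.prems by metis
  have 2: "Ck_on k S (\<lambda>x. frechet_derivative f (at x within S) v)
      \<longleftrightarrow> Ck_on k S (\<lambda>x. frechet_derivative g (at x within S) v)" for v
    by (rule Suc.IH) (use Suc.prems frechet_derivative_within_cong[of _ S f g] in auto)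
  show ?case using 1 2 by simp
qed

text \<open>
  On an open set any derivative may stand in for the one chosen by \<open>frechet_derivative\<close>. The
  closure properties below are inductions that use this rule with an explicit derivative.
\<close>

lemma Ck_on_SucI:
  assumes "open S" "\<And>x. x \<in> S \<Longrightarrow> (f has_derivative f' x) (at x)"
    and "\<And>v. Ck_on k S (\<lambda>x. f' x v)"
  shows "Ck_on (Suc k) S f"
proof -
  have "f differentiable_on S"
    using assms by (auto simp: differentiable_on_def differentiable_def intro: has_derivative_at_withinI)
  moreover have "frechet_derivative f (at x within S) = f' x" if "x \<in> S" for x
    using assms that frechet_derivative_at at_within_open by metis
  ultimately show ?thesis
    using assms(3) Ck_on_cong[of S "\<lambda>x. frechet_derivative f (at x within S) v" "\<lambda>x. f' x v" for v]
    by simp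
qed

lemma Ck_on_SucD:
  assumes "open S" "Ck_on (Suc k) S f"
  shows "x \<in> S \<Longrightarrow> (f has_derivative frechet_derivative f (at x)) (at x)"
    and "Ck_on k S (\<lambda>x. frechet_derivative f (at x) v)"
proof -
  show "x \<in> S \<Longrightarrow> (f has_derivative frechet_derivative f (at x)) (at x)"
    using assms by (metis Ck_on.simps(2) at_within_open differentiable_on_def frechet_derivative_works)
  have "Ck_on k S (\<lambda>x. frechet_derivative f (at x within S) v)"
    using assms by simp
  then show "Ck_on k S (\<lambda>x. frechet_derivative f (at x) v)"
    using Ck_on_cong[of S "\<lambda>x. frechet_derivative f (at x within S) v" "\<lambda>x. frechet_derivative f (at x) v"]
      at_within_open assms(1) by metis
qed

lemma Ck_on_mono: "Ck_on (Suc k) S f \<Longrightarrow> Ck_on k S f"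
  by (induction k arbitrary: f) (auto intro: differentiable_imp_continuous_on)

lemma Ck_on_const: "open S \<Longrightarrow> Ck_on k S (\<lambda>x. c)"
proof (induction k arbitrary: c)
  case (Suc k)
  then show ?case by (intro Ck_on_SucI[where f'="\<lambda>_ _. 0"]) auto
qed auto

lemma Ck_on_bounded_linear:
  assumes "bounded_linear L" "open S" "Ck_on k S f"
  shows "Ck_on k S (\<lambda>x. L (f x))"
  using assms(3)
proof (induction k arbitrary: f)
  case 0
  then show ?case using assms(1) by (auto intro: bounded_linear.continuous_on)
next
  case (Suc k)
  show ?case
    by (rule Ck_on_SucI[OF assms(2), where f'="\<lambda>x v. L (frechet_derivative f (at x) v)"])
       (rule bounded_linear.has_derivative[OF assms(1) Ck_on_SucD(1)[OF assms(2) Suc.prems]]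
          Suc.IH[OF Ck_on_SucD(2)[OF assms(2) Suc.prems]]; assumption)+
qed

lemma Ck_on_add:
  assumes "open S" "Ck_on k S f" "Ck_on k S g"
  shows "Ck_on k S (\<lambda>x. f x + g x)"
  using assms(2,3)
proof (induction k arbitrary: f g)
  case 0
  then show ?case by (auto intro: continuous_intros)
next
  case (Suc k)
  show ?case
    by (rule Ck_on_SucI[OF assms(1),
          where f'="\<lambda>x v. frechet_derivative f (at x) v + frechet_derivative g (at x) v"])
       (rule has_derivative_add[OF Ck_on_SucD(1)[OF assms(1) Suc.prems(1)] Ck_on_SucD(1)[OF assms(1) Suc.prems(2)]]
          Suc.IH[OF Ck_on_SucD(2)[OF assms(1) Suc.prems(1)] Ck_on_SucD(2)[OF assms(1) Suc.prems(2)]]; assumption)+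
qed

lemma Ck_on_bilinear:
  assumes b: "bounded_bilinear b" and S: "open S" and "Ck_on k S f" "Ck_on k S g"
  shows "Ck_on k S (\<lambda>x. b (f x) (g x))"
  using assms(3,4)
proof (induction k arbitrary: f g)
  case 0
  then show ?case using b by (auto intro: bounded_bilinear.continuous_on)
next
  case (Suc k)
  show ?case
  proof (rule Ck_on_SucI[OF S, where
        f'="\<lambda>x v. b (f x) (frechet_derivative g (at x) v) + b (frechet_derivative f (at x) v) (g x)"])
    show "((\<lambda>x. b (f x) (g x)) has_derivative
        (\<lambda>v. b (f x) (frechet_derivative g (at x) v) + b (frechet_derivative f (at x) v) (g x))) (at x)"
      if "x \<in> S" for x
      by (rule bounded_bilinear.FDERIV[OF b Ck_on_SucD(1)[OF S Suc.prems(1) that]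
            Ck_on_SucD(1)[OF S Suc.prems(2) that]])
    show "Ck_on k S (\<lambda>x. b (f x) (frechet_derivative g (at x) v)
        + b (frechet_derivative f (at x) v) (g x))" for v
      by (intro Ck_on_add[OF S] Suc.IH Ck_on_mono[OF Suc.prems(1)] Ck_on_mono[OF Suc.prems(2)]
          Ck_on_SucD(2)[OF S Suc.prems(1)] Ck_on_SucD(2)[OF S Suc.prems(2)])
  qed
qed

lemma Ck_on_sum:
  assumes "open S" "\<And>i. i \<in> I \<Longrightarrow> Ck_on k S (f i)"
  shows "Ck_on k S (\<lambda>x. \<Sum>i\<in>I. f i x)"
  using assms(2)
  by (induction I rule: infinite_finite_induct) (auto intro: Ck_on_add Ck_on_const assms(1))

lemma Ck_on_inverse:
  fixes f :: "'a::euclidean_space \<Rightarrow> real"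
  assumes S: "open S" and "Ck_on k S f" and nz: "\<And>x. x \<in> S \<Longrightarrow> f x \<noteq> 0"
  shows "Ck_on k S (\<lambda>x. inverse (f x))"
  using assms(2)
proof (induction k)
  case 0
  then show ?case using nz by (auto intro: continuous_on_inverse)
next
  case (Suc k)
  note inv = Suc.IH[OF Ck_on_mono[OF Suc.prems]]
  note mul = Ck_on_bilinear[OF bounded_bilinear_mult S]
  show ?case
  proof (rule Ck_on_SucI[OF S, where
        f'="\<lambda>x v. - 1 * (inverse (f x) * frechet_derivative f (at x) v * inverse (f x))"])
    show "((\<lambda>x. inverse (f x)) has_derivative
       (\<lambda>v. - 1 * (inverse (f x) * frechet_derivative f (at x) v * inverse (f x)))) (at x)"
      if "x \<in> S" for x
      using Deriv.has_derivative_inverse[OF nz[OF that] Ck_on_SucD(1)[OF S Suc.prems that]] by simp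
    show "Ck_on k S (\<lambda>x. - 1 * (inverse (f x) * frechet_derivative f (at x) v * inverse (f x)))" for v
      by (intro mul inv Ck_on_const[OF S] Ck_on_SucD(2)[OF S Suc.prems])
  qed
qed

text \<open>
  The outer function is differentiated within a set that need not be open, because
  \<open>\<lambda>\<close> and \<open>\<mu>\<close> are functions on a closed half-line that are evaluated at the energy
  density, and the energy density attains the boundary value 0 on the zero section.
\<close>

lemma frechet_derivative_within_compose:
  assumes "open S" "x \<in> S" "h ` S \<subseteq> T" "f differentiable (at (h x) within T)" "h differentiable (at x)"
  shows "((\<lambda>y. f (h y)) has_derivative
      (\<lambda>v. frechet_derivative f (at (h x) within T) (frechet_derivative h (at x) v))) (at x)"
proof -
  have "(f has_derivative frechet_derivative f (at (h x) within T)) (at (h x) within T)"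
    using assms(4) frechet_derivative_works by blast
  moreover have "(h has_derivative frechet_derivative h (at x)) (at x within S)"
    using assms frechet_derivative_works has_derivative_at_withinI by blast
  ultimately have "(f \<circ> h has_derivative
      frechet_derivative f (at (h x) within T) \<circ> frechet_derivative h (at x)) (at x within S)"
    using assms(3) by (meson diff_chain_within has_derivative_subset)
  then show ?thesis
    unfolding at_within_open[OF assms(2,1)] o_def .
qed

lemma Ck_on_compose:
  fixes h :: "'a::euclidean_space \<Rightarrow> 'b::euclidean_space" and f :: "'b \<Rightarrow> 'c::real_normed_vector"
  assumes S: "open S" and hS: "h ` S \<subseteq> T" and "Ck_on k T f" "Ck_on k S h"
  shows "Ck_on k S (\<lambda>x. f (h x))"
  using assms(3,4)
proof (induction k arbitrary: f)
  case 0
  then show ?case using hS by (auto intro: continuous_on_compose2)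
next
  case (Suc k)
  let ?D = "\<lambda>y. frechet_derivative f (at y within T)"
  have dif: "f differentiable (at (h x) within T)" if "x \<in> S" for x
    using that Suc.prems(1) hS by (auto simp: differentiable_on_def)
  show ?case
  proof (rule Ck_on_SucI[OF S, where f'="\<lambda>x v. ?D (h x) (frechet_derivative h (at x) v)"])
    show "((\<lambda>x. f (h x)) has_derivative (\<lambda>v. ?D (h x) (frechet_derivative h (at x) v))) (at x)"
      if "x \<in> S" for x
      using frechet_derivative_within_compose[OF S that hS dif[OF that]]
        Ck_on_SucD(1)[OF S Suc.prems(2) that] differentiableI by blast
    fix v
    have "Ck_on k S (\<lambda>x. \<Sum>b\<in>Basis. (frechet_derivative h (at x) v \<bullet> b) *\<^sub>R ?D (h x) b)"
      using Suc.prems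
      by (intro Ck_on_sum S Ck_on_bilinear[OF bounded_bilinear_scaleR]
          Ck_on_bounded_linear[OF bounded_linear_inner_left] Ck_on_SucD(2)[OF S Suc.prems(2)] Suc.IH
          Ck_on_mono[OF Suc.prems(2)]) auto
    moreover have "?D (h x) (frechet_derivative h (at x) v) =
        (\<Sum>b\<in>Basis. (frechet_derivative h (at x) v \<bullet> b) *\<^sub>R ?D (h x) b)" if "x \<in> S" for x
      by (rule linear_expansion) (rule linear_frechet_derivative[OF dif[OF that]])
    ultimately show "Ck_on k S (\<lambda>x. ?D (h x) (frechet_derivative h (at x) v))"
      using Ck_on_cong[of S "\<lambda>x. ?D (h x) (frechet_derivative h (at x) v)"
        "\<lambda>x. \<Sum>b\<in>Basis. (frechet_derivative h (at x) v \<bullet> b) *\<^sub>R ?D (h x) b"] by simp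
  qed
qed

lemma Ck_on_ident: "open S \<Longrightarrow> Ck_on k S (\<lambda>x. x)"
proof (cases k)
  case (Suc n)
  then show "open S \<Longrightarrow> ?thesis"
    by (auto intro!: Ck_on_SucI[where f'="\<lambda>_ v. v"] Ck_on_const simp del: Ck_on.simps)
qed auto

named_theorems smooth_intros

lemma smooth_on_cong:
  "(\<And>x. x \<in> S \<Longrightarrow> f x = g x) \<Longrightarrow> smooth_on S f \<longleftrightarrow> smooth_on S g"
  unfolding smooth_on_def using Ck_on_cong[of S f g] by auto

lemma smooth_on_eqI: "smooth_on S g \<Longrightarrow> (\<And>x. x \<in> S \<Longrightarrow> f x = g x) \<Longrightarrow> smooth_on S f"
  by (simp cong: smooth_on_cong)

lemma smooth_on_const [smooth_intros]: "open S \<Longrightarrow> smooth_on S (\<lambda>x. c)"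
  by (simp add: smooth_on_def Ck_on_const)

lemma smooth_on_ident [smooth_intros]: "open S \<Longrightarrow> smooth_on S (\<lambda>x. x)"
  by (simp add: smooth_on_def Ck_on_ident)

lemma smooth_on_bounded_linear:
  "bounded_linear L \<Longrightarrow> open S \<Longrightarrow> smooth_on S f \<Longrightarrow> smooth_on S (\<lambda>x. L (f x))"
  by (simp add: smooth_on_def Ck_on_bounded_linear)

lemma smooth_on_bilinear:
  "bounded_bilinear b \<Longrightarrow> open S \<Longrightarrow> smooth_on S f \<Longrightarrow> smooth_on S g \<Longrightarrow> smooth_on S (\<lambda>x. b (f x) (g x))"
  by (simp add: smooth_on_def Ck_on_bilinear)

lemma smooth_on_add [smooth_intros]:
  "open S \<Longrightarrow> smooth_on S f \<Longrightarrow> smooth_on S g \<Longrightarrow> smooth_on S (\<lambda>x. f x + g x)"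
  by (simp add: smooth_on_def Ck_on_add)

lemma smooth_on_sum [smooth_intros]:
  "open S \<Longrightarrow> (\<And>i. i \<in> I \<Longrightarrow> smooth_on S (f i)) \<Longrightarrow> smooth_on S (\<lambda>x. \<Sum>i\<in>I. f i x)"
  by (simp add: smooth_on_def Ck_on_sum)

lemma smooth_on_uminus [smooth_intros]:
  "open S \<Longrightarrow> smooth_on S f \<Longrightarrow> smooth_on S (\<lambda>x. - f x)"
  by (rule smooth_on_bounded_linear[OF bounded_linear_minus[OF bounded_linear_ident]])

lemma smooth_on_diff [smooth_intros]:
  "open S \<Longrightarrow> smooth_on S f \<Longrightarrow> smooth_on S g \<Longrightarrow> smooth_on S (\<lambda>x. f x - g x)"
  using smooth_on_add[of S f "\<lambda>x. - g x"] by (simp add: smooth_on_uminus)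

lemmas smooth_on_mult [smooth_intros] = smooth_on_bilinear[OF bounded_bilinear_mult]
lemmas smooth_on_scaleR [smooth_intros] = smooth_on_bilinear[OF bounded_bilinear_scaleR]
lemmas smooth_on_inner [smooth_intros] = smooth_on_bilinear[OF bounded_bilinear_inner]
lemmas smooth_on_fst [smooth_intros] = smooth_on_bounded_linear[OF bounded_linear_fst]
lemmas smooth_on_snd [smooth_intros] = smooth_on_bounded_linear[OF bounded_linear_snd]
lemmas smooth_on_vec_nth [smooth_intros] = smooth_on_bounded_linear[OF bounded_linear_vec_nth]

lemma smooth_on_power [smooth_intros]:
  fixes f :: "'a::euclidean_space \<Rightarrow> real"
  shows "open S \<Longrightarrow> smooth_on S f \<Longrightarrow> smooth_on S (\<lambda>x. f x ^ n)"
  by (induction n) (auto intro: smooth_intros)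

lemma smooth_on_prod [smooth_intros]:
  fixes f :: "'i \<Rightarrow> 'a::euclidean_space \<Rightarrow> real"
  assumes "open S" "\<And>i. i \<in> I \<Longrightarrow> smooth_on S (f i)"
  shows "smooth_on S (\<lambda>x. \<Prod>i\<in>I. f i x)"
  using assms(2)
  by (induction I rule: infinite_finite_induct) (auto intro: smooth_intros assms(1))

lemma smooth_on_divide [smooth_intros]:
  fixes f g :: "'a::euclidean_space \<Rightarrow> real"
  assumes "open S" "smooth_on S f" "smooth_on S g" "\<And>x. x \<in> S \<Longrightarrow> g x \<noteq> 0"
  shows "smooth_on S (\<lambda>x. f x / g x)"
proof -
  have "smooth_on S (\<lambda>x. inverse (g x))"
    unfolding smooth_on_def
    by (intro allI Ck_on_inverse assms(1,4) assms(3)[unfolded smooth_on_def, THEN spec])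
  then show ?thesis
    unfolding divide_inverse using assms by (intro smooth_intros)
qed

lemma smooth_on_Pair [smooth_intros]:
  fixes f :: "'a::euclidean_space \<Rightarrow> 'b::real_normed_vector" and g :: "'a \<Rightarrow> 'c::real_normed_vector"
  assumes "open S" "smooth_on S f" "smooth_on S g"
  shows "smooth_on S (\<lambda>x. (f x, g x))"
proof -
  have "bounded_linear (\<lambda>u::'b. (u, 0::'c))" "bounded_linear (\<lambda>w::'c. (0::'b, w))"
    by (auto intro!: bounded_linear_Pair bounded_linear_ident bounded_linear_zero)
  then have "smooth_on S (\<lambda>x. (f x, 0) + (0, g x))"
    using assms by (intro smooth_on_add smooth_on_bounded_linear[where L="\<lambda>u. (u, 0)"]
        smooth_on_bounded_linear[where L="\<lambda>w. (0, w)"])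
  then show ?thesis by simp
qed

lemma smooth_on_vec_lambda [smooth_intros]:
  fixes f :: "'n::finite \<Rightarrow> 'a::euclidean_space \<Rightarrow> 'b::euclidean_space"
  assumes "open S" "\<And>i. smooth_on S (f i)"
  shows "smooth_on S (\<lambda>x. \<chi> i. f i x)"
proof -
  have "bounded_linear (\<lambda>u::'b. axis i u :: 'b^'n)" for i
    by (rule linear_conv_bounded_linear[THEN iffD1])
       (auto simp: linear_iff vec_eq_iff axis_def)
  then have "smooth_on S (\<lambda>x. \<Sum>i\<in>UNIV. axis i (f i x) :: 'b^'n)"
    using assms by (intro smooth_on_sum smooth_on_bounded_linear[where L="axis i" for i])
  moreover have "(\<Sum>i\<in>UNIV. axis i (f i x)) = (\<chi> i. f i x)" for x
    by (simp add: vec_eq_iff axis_def)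
  ultimately show ?thesis by simp
qed

lemma smooth_on_compose:
  fixes h :: "'a::euclidean_space \<Rightarrow> 'b::euclidean_space" and f :: "'b \<Rightarrow> 'c::real_normed_vector"
  assumes "open S" "smooth_on T f" "smooth_on S h" "\<And>x. x \<in> S \<Longrightarrow> h x \<in> T"
  shows "smooth_on S (\<lambda>x. f (h x))"
  unfolding smooth_on_def
  by (intro allI Ck_on_compose[OF assms(1) _ assms(2)[unfolded smooth_on_def, THEN spec]
        assms(3)[unfolded smooth_on_def, THEN spec]]) (use assms(4) in blast)

lemma smooth_on_has_derivative:
  assumes "open S" "smooth_on S f" "x \<in> S"
  shows "(f has_derivative frechet_derivative f (at x)) (at x)"
  using assms Ck_on_SucD(1)[of S 0 f] unfolding smooth_on_def by blast

lemma smooth_on_differentiable: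
  assumes "open S" "smooth_on S f" "x \<in> S"
  shows "f differentiable (at x)"
  using smooth_on_has_derivative[OF assms] differentiableI by blast

text \<open>
  Smoothness of a family of linear maps \<open>L x\<close> is expressed without a topology on the space of
  linear maps, by the functions \<open>\<lambda>x. L x b\<close> for fixed b.
\<close>

lemma smooth_on_linear_family:
  fixes L :: "'a::euclidean_space \<Rightarrow> 'b::euclidean_space \<Rightarrow> 'c::real_normed_vector"
  assumes "open S" "\<And>x. x \<in> S \<Longrightarrow> linear (L x)" "\<And>b. smooth_on S (\<lambda>x. L x b)" "smooth_on S w"
  shows "smooth_on S (\<lambda>x. L x (w x))"
proof -
  have "smooth_on S (\<lambda>x. \<Sum>b\<in>Basis. (w x \<bullet> b) *\<^sub>R L x b)"
    using assms by (intro smooth_intros)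
  then show ?thesis
    by (rule smooth_on_eqI) (rule linear_expansion[OF assms(2)])
qed

lemma smooth_on_frechet_derivative:
  fixes f :: "'a::euclidean_space \<Rightarrow> 'b::real_normed_vector"
  assumes "open S" "smooth_on S f" "smooth_on S w"
  shows "smooth_on S (\<lambda>x. frechet_derivative f (at x) (w x))"
proof (rule smooth_on_linear_family[OF assms(1) _ _ assms(3)])
  show "linear (frechet_derivative f (at x))" if "x \<in> S" for x
    by (rule linear_frechet_derivative[OF smooth_on_differentiable[OF assms(1,2) that]])
  show "smooth_on S (\<lambda>x. frechet_derivative f (at x) b)" for b
    using assms Ck_on_SucD(2)[of S _ f b] by (auto simp: smooth_on_def simp del: Ck_on.simps)
qed

text \<open>
  The product rule for \<open>L x (X x)\<close>. The derivative of L in direction z, applied to a vector w,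
  is written as the derivative of \<open>\<lambda>x. L x w\<close> in direction z.
\<close>

lemma has_derivative_linear_family:
  fixes L :: "'a::euclidean_space \<Rightarrow> 'b::euclidean_space \<Rightarrow> 'c::real_normed_vector"
  assumes S: "open S" "x0 \<in> S" and lin: "\<And>x. x \<in> S \<Longrightarrow> linear (L x)"
    and dif: "\<And>b. (\<lambda>x. L x b) differentiable (at x0)" and X: "(X has_derivative X') (at x0)"
  shows "((\<lambda>x. L x (X x)) has_derivative
      (\<lambda>z. L x0 (X' z) + frechet_derivative (\<lambda>x. L x (X x0)) (at x0) z)) (at x0)"
proof -
  let ?D = "\<lambda>b. frechet_derivative (\<lambda>x. L x b) (at x0)"
  have D: "((\<lambda>x. L x b) has_derivative ?D b) (at x0)" for b
    using dif frechet_derivative_works by blast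
  have 1: "((\<lambda>x. \<Sum>b\<in>Basis. (w x \<bullet> b) *\<^sub>R L x b) has_derivative
     (\<lambda>z. \<Sum>b\<in>Basis. (w x0 \<bullet> b) *\<^sub>R ?D b z + (w' z \<bullet> b) *\<^sub>R L x0 b)) (at x0)"
    if "(w has_derivative w') (at x0)" for w w'
    by (intro has_derivative_sum has_derivative_scaleR D has_derivative_inner_left that)
  have 2: "((\<lambda>x. L x (w x)) has_derivative
     (\<lambda>z. \<Sum>b\<in>Basis. (w x0 \<bullet> b) *\<^sub>R ?D b z + (w' z \<bullet> b) *\<^sub>R L x0 b)) (at x0)"
    if "(w has_derivative w') (at x0)" for w w'
    by (rule has_derivative_transform_within_open[OF 1[OF that] S])
       (rule linear_expansion[OF lin, symmetric])
  have "?D (X x0) = (\<lambda>z. \<Sum>b\<in>Basis. (X x0 \<bullet> b) *\<^sub>R ?D b z + (0 \<bullet> b) *\<^sub>R L x0 b)"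
    by (rule frechet_derivative_at[OF 2[OF has_derivative_const], symmetric])
  then have D0: "?D (X x0) = (\<lambda>z. \<Sum>b\<in>Basis. (X x0 \<bullet> b) *\<^sub>R ?D b z)"
    by simp
  have "(\<lambda>z. \<Sum>b\<in>Basis. (X x0 \<bullet> b) *\<^sub>R ?D b z + (X' z \<bullet> b) *\<^sub>R L x0 b)
      = (\<lambda>z. L x0 (X' z) + ?D (X x0) z)"
    unfolding D0 sum.distrib
    by (subst linear_expansion[OF lin[OF S(2)], of "X' _"]) (simp add: add.commute)
  then show ?thesis
    using 2[OF X] by simp
qed

lemma frechet_derivative_linear_family:
  fixes L :: "'a::euclidean_space \<Rightarrow> 'b::euclidean_space \<Rightarrow> 'c::real_normed_vector"
  assumes S: "open S" "x0 \<in> S" and lin: "\<And>x. x \<in> S \<Longrightarrow> linear (L x)"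
    and dif: "\<And>b. (\<lambda>x. L x b) differentiable (at x0)"
  shows "linear (\<lambda>w. frechet_derivative (\<lambda>x. L x w) (at x0) z)"
proof -
  have D: "((\<lambda>x. L x b) has_derivative frechet_derivative (\<lambda>x. L x b) (at x0)) (at x0)" for b
    using dif frechet_derivative_works by blast
  have add: "((\<lambda>x. L x (u + v)) has_derivative (\<lambda>z. frechet_derivative (\<lambda>x. L x u) (at x0) z
      + frechet_derivative (\<lambda>x. L x v) (at x0) z)) (at x0)" for u v
    by (rule has_derivative_transform_within_open[OF has_derivative_add[OF D[of u] D[of v]] S])
       (simp add: lin linear_add)
  have scale: "((\<lambda>x. L x (r *\<^sub>R v)) has_derivative (\<lambda>z. r *\<^sub>R frechet_derivative (\<lambda>x. L x v) (at x0) z)) (at x0)" for r v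
    by (rule has_derivative_transform_within_open[OF has_derivative_scaleR_right[OF D[of v]] S])
       (simp add: lin linear_cmul)
  note e1 = fun_cong[OF frechet_derivative_at[OF add], where x=z]
  note e2 = fun_cong[OF frechet_derivative_at[OF scale], where x=z]
  show ?thesis
  proof (rule linearI)
    fix u v
    show "frechet_derivative (\<lambda>x. L x (u + v)) (at x0) z =
        frechet_derivative (\<lambda>x. L x u) (at x0) z + frechet_derivative (\<lambda>x. L x v) (at x0) z"
      by (rule e1[symmetric])
  next
    fix r v
    show "frechet_derivative (\<lambda>x. L x (r *\<^sub>R v)) (at x0) z = r *\<^sub>R frechet_derivative (\<lambda>x. L x v) (at x0) z"
      by (rule e2[symmetric])
  qed
qed

subsection \<open>Functions on the half-line\<close>

text \<open>
  The derivative within the half-line is unique also at the boundary point 0, since 0 is a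
  limit point of the half-line.
\<close>

lemma halfline_has_derivative:
  assumes f: "f differentiable (at t within {0..})" and t: "t \<ge> 0"
  shows "(f has_derivative (\<lambda>h. h * halfline_deriv f t)) (at t within {0..})"
    and "frechet_derivative f (at t within {0..}) 1 = halfline_deriv f t"
proof -
  let ?D = "frechet_derivative f (at t within {0..})"
  have D: "(f has_derivative ?D) (at t within {0..})" using f frechet_derivative_works by blast
  have "?D h = h *\<^sub>R ?D 1" for h
    using linear_cmul[OF has_derivative_linear[OF D], of h 1] by simp
  then have "(f has_vector_derivative ?D 1) (at t within {0..})"
    using D unfolding has_vector_derivative_def by (metis (no_types, lifting) ext)
  moreover have "t islimpt {0..}"
  proof (rule connected_imp_perfect)
    fix x :: real
    show "{0..} \<noteq> {x}"
    proof
      assume "{0..} = {x}"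
      then have "0 \<in> {x}" "1 \<in> {x}" by (metis atLeast_iff order_refl, metis atLeast_iff zero_le_one)
      then show False by simp
    qed
  qed (use t in auto)
  ultimately have 1: "?D 1 = halfline_deriv f t"
    unfolding halfline_deriv_def
    by (intro vector_derivative_within[symmetric]) (auto simp: trivial_limit_within)
  then show "?D 1 = halfline_deriv f t" .
  show "(f has_derivative (\<lambda>h. h * halfline_deriv f t)) (at t within {0..})"
    using D \<open>\<And>h. ?D h = h *\<^sub>R ?D 1\<close> unfolding 1 by (metis (no_types, lifting) ext real_scaleR_def)
qed

lemma smooth_halfline_deriv:
  assumes "smooth_on {0..} f"
  shows "smooth_on {0..} (halfline_deriv f)"
proof (rule smooth_on_eqI)
  show "smooth_on {0..} (\<lambda>t. frechet_derivative f (at t within {0..}) 1)"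
    unfolding smooth_on_def
  proof
    fix k
    have "Ck_on (Suc k) {0..} f" using assms unfolding smooth_on_def by blast
    then show "Ck_on k {0..} (\<lambda>t. frechet_derivative f (at t within {0..}) 1)" by simp
  qed
  have "f differentiable_on {0..}"
    using assms unfolding smooth_on_def by (metis Ck_on.simps(2))
  then show "halfline_deriv f t = frechet_derivative f (at t within {0..}) 1" if "t \<in> {0..}" for t
    using halfline_has_derivative(2)[of f t] that by (simp add: differentiable_on_def)
qed

lemma smooth_halfline_differentiable:
  "smooth_on {0..} f \<Longrightarrow> t \<ge> 0 \<Longrightarrow> f differentiable (at t within {0::real..})"
  unfolding smooth_on_def by (metis Ck_on.simps(2) atLeast_iff differentiable_on_def)

lemma halfline_chain:
  fixes e :: "'a::euclidean_space \<Rightarrow> real"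
  assumes f: "(f has_derivative (\<lambda>h. h * d)) (at (e y) within {0..})"
    and e: "(e has_derivative e') (at y)" and W: "open W" "y \<in> W" and pos: "\<And>z. z \<in> W \<Longrightarrow> e z \<ge> 0"
  shows "((\<lambda>z. f (e z)) has_derivative (\<lambda>w. e' w * d)) (at y)"
proof -
  have "(f \<circ> e has_derivative (\<lambda>h. h * d) \<circ> e') (at y within W)"
    by (rule diff_chain_within[OF has_derivative_at_withinI[OF e] has_derivative_subset[OF f]])
       (use pos in auto)
  then show ?thesis unfolding at_within_open[OF W(2,1)] o_def .
qed

subsection \<open>Symmetry of second derivatives\<close>

text \<open>
  Two applications of the mean value theorem to the second difference, first along u and then
  along v. Exchanging u and v leaves the second difference unchanged, which is why the two mixed
  derivatives agree in the limit.
\<close>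

lemma second_derivative_mean_value:
  fixes f :: "'a::euclidean_space \<Rightarrow> real"
  assumes S: "open S" and f: "Ck_on 2 S f" and s: "s > 0"
    and sub: "\<And>a b. 0 \<le> a \<Longrightarrow> a \<le> s \<Longrightarrow> 0 \<le> b \<Longrightarrow> b \<le> s \<Longrightarrow> x + a *\<^sub>R u + b *\<^sub>R v \<in> S"
  obtains a b where "0 \<le> a" "a \<le> s" "0 \<le> b" "b \<le> s"
    "f (x + s *\<^sub>R u + s *\<^sub>R v) - f (x + s *\<^sub>R u) - f (x + s *\<^sub>R v) + f x =
      s * s * frechet_derivative (\<lambda>y. frechet_derivative f (at y) u) (at (x + a *\<^sub>R u + b *\<^sub>R v)) v"
proof -
  let ?F = "\<lambda>y. frechet_derivative f (at y)"
  have f2: "Ck_on (Suc (Suc 0)) S f" using f by (simp add: numeral_2_eq_2)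
  note D = Ck_on_SucD(1)[OF S f2]
  note D2 = Ck_on_SucD(1)[OF S Ck_on_SucD(2)[OF S f2]]
  have "\<exists>a>0. a < s \<and> (f (x + s *\<^sub>R u + s *\<^sub>R v) - f (x + s *\<^sub>R u + 0 *\<^sub>R v))
      - (f (x + 0 *\<^sub>R u + s *\<^sub>R v) - f (x + 0 *\<^sub>R u + 0 *\<^sub>R v)) =
      (\<lambda>h. h * (?F (x + a *\<^sub>R u + s *\<^sub>R v) u - ?F (x + a *\<^sub>R u + 0 *\<^sub>R v) u)) (s - 0)"
  proof -
    have deriv: "((\<lambda>a. f (x + a *\<^sub>R u + s *\<^sub>R v) - f (x + a *\<^sub>R u + 0 *\<^sub>R v)) has_derivative
      (\<lambda>h. h * (?F (x + a *\<^sub>R u + s *\<^sub>R v) u - ?F (x + a *\<^sub>R u + 0 *\<^sub>R v) u))) (at a)"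
      if "0 \<le> a" "a \<le> s" for a
    proof -
      have *: "((\<lambda>a. f (x + a *\<^sub>R u + b *\<^sub>R v)) has_derivative (\<lambda>h. ?F (x + a *\<^sub>R u + b *\<^sub>R v) (h *\<^sub>R u))) (at a)"
        if "0 \<le> b" "b \<le> s" for b
        by (rule has_derivative_compose[where g=f and f="\<lambda>a. x + a *\<^sub>R u + b *\<^sub>R v",
                OF _ D[OF sub[OF \<open>0 \<le> a\<close> \<open>a \<le> s\<close> that]]])
           (auto intro!: derivative_eq_intros)
      have lin: "?F (x + a *\<^sub>R u + b *\<^sub>R v) (h *\<^sub>R u) = h * ?F (x + a *\<^sub>R u + b *\<^sub>R v) u"
        if "0 \<le> b" "b \<le> s" for b h
        using has_derivative_linear[OF D[OF sub[OF \<open>0 \<le> a\<close> \<open>a \<le> s\<close> that]]] by (simp add: linear_cmul)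
      have s0: "0 \<le> s" "s \<le> s" "(0::real) \<le> 0" using s by auto
      have "(\<lambda>h. ?F (x + a *\<^sub>R u + s *\<^sub>R v) (h *\<^sub>R u) - ?F (x + a *\<^sub>R u + 0 *\<^sub>R v) (h *\<^sub>R u))
          = (\<lambda>h. h * (?F (x + a *\<^sub>R u + s *\<^sub>R v) u - ?F (x + a *\<^sub>R u + 0 *\<^sub>R v) u))"
        by (simp only: lin[OF s0(1,2)] lin[OF s0(3,1)] right_diff_distrib)
      from has_derivative_eq_rhs[OF has_derivative_diff[OF *[OF s0(1,2)] *[OF s0(3,1)]] this]
      show ?thesis .
    qed
    have "continuous_on {0..s} (\<lambda>a. f (x + a *\<^sub>R u + s *\<^sub>R v) - f (x + a *\<^sub>R u + 0 *\<^sub>R v))"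
      by (rule has_derivative_continuous_on[OF has_derivative_at_withinI[OF deriv]]) auto
    then obtain a where "0 < a" "a < s" "(f (x + s *\<^sub>R u + s *\<^sub>R v) - f (x + s *\<^sub>R u + 0 *\<^sub>R v))
      - (f (x + 0 *\<^sub>R u + s *\<^sub>R v) - f (x + 0 *\<^sub>R u + 0 *\<^sub>R v)) =
      (s - 0) * (?F (x + a *\<^sub>R u + s *\<^sub>R v) u - ?F (x + a *\<^sub>R u + 0 *\<^sub>R v) u)"
      by (rule mvt[OF s _ deriv]) auto
    then show ?thesis by auto
  qed
  then obtain a where a: "0 < a" "a < s" and ea: "f (x + s *\<^sub>R u + s *\<^sub>R v) - f (x + s *\<^sub>R u)
      - f (x + s *\<^sub>R v) + f x = s * (?F (x + a *\<^sub>R u + s *\<^sub>R v) u - ?F (x + a *\<^sub>R u) u)"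
    by auto
  let ?H = "\<lambda>b. frechet_derivative (\<lambda>y. ?F y u) (at (x + a *\<^sub>R u + b *\<^sub>R v))"
  have deriv2: "((\<lambda>b. ?F (x + a *\<^sub>R u + b *\<^sub>R v) u) has_derivative (\<lambda>h. ?H b (h *\<^sub>R v))) (at b)"
    if "0 \<le> b" "b \<le> s" for b
    by (rule has_derivative_compose[where g="\<lambda>y. ?F y u" and f="\<lambda>b. x + a *\<^sub>R u + b *\<^sub>R v", OF _ D2[OF sub]])
       (use a that in \<open>auto intro!: derivative_eq_intros\<close>)
  have "continuous_on {0..s} (\<lambda>b. ?F (x + a *\<^sub>R u + b *\<^sub>R v) u)"
    by (rule has_derivative_continuous_on[OF has_derivative_at_withinI[OF deriv2]]) auto
  then obtain b where b: "0 < b" "b < s"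
    and eb: "?F (x + a *\<^sub>R u + s *\<^sub>R v) u - ?F (x + a *\<^sub>R u + 0 *\<^sub>R v) u = ?H b ((s - 0) *\<^sub>R v)"
    by (rule mvt[OF s _ deriv2]) auto
  have "linear (?H b)"
    using has_derivative_linear[OF D2[OF sub]] a b by auto
  then have "?H b (s *\<^sub>R v) = s * ?H b v" by (simp add: linear_cmul)
  then show ?thesis
    using that[of a b] a b ea eb by simp
qed

lemma second_derivative_symmetric_real:
  fixes f :: "'a::euclidean_space \<Rightarrow> real"
  assumes S: "open S" and f: "Ck_on 2 S f" and x: "x \<in> S"
  shows "frechet_derivative (\<lambda>y. frechet_derivative f (at y) u) (at x) v =
         frechet_derivative (\<lambda>y. frechet_derivative f (at y) v) (at x) u"
proof -
  let ?H = "\<lambda>u v y. frechet_derivative (\<lambda>y. frechet_derivative f (at y) u) (at y) v"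
  have f2: "Ck_on (Suc (Suc 0)) S f" using f by (simp add: numeral_2_eq_2)
  have cont: "continuous_on S (?H u v)" for u v
    using Ck_on_SucD(2)[OF S Ck_on_SucD(2)[OF S f2]] by simp
  have "\<bar>?H u v x - ?H v u x\<bar> \<le> e" if "e > 0" for e
  proof -
    have "\<exists>d>0. \<forall>y\<in>S. dist y x < d \<longrightarrow> dist (?H u v y) (?H u v x) < e / 2" for u v
      using cont[of u v] x that unfolding continuous_on_iff by (meson half_gt_zero)
    from this[of u v] this[of v u] obtain d1 d2 where
      d1: "d1 > 0" "\<And>y. y \<in> S \<Longrightarrow> dist y x < d1 \<Longrightarrow> dist (?H u v y) (?H u v x) < e / 2" and
      d2: "d2 > 0" "\<And>y. y \<in> S \<Longrightarrow> dist y x < d2 \<Longrightarrow> dist (?H v u y) (?H v u x) < e / 2" by auto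
    obtain d3 where d3: "d3 > 0" "ball x d3 \<subseteq> S" using S x open_contains_ball by blast
    define d where "d = min d3 (min d1 d2)"
    have d: "d > 0" using d1 d2 d3 by (simp add: d_def)
    (* the parallelogram with sides s u and s v stays inside the ball of radius d *)
    define s where "s = d / (2 * (norm u + norm v + 1))"
    have nz: "norm u + norm v + 1 > 0" by (smt (verit) norm_ge_zero)
    have s: "s > 0" using d nz by (simp add: s_def)
    have sn: "s * (norm u + norm v) < d"
    proof -
      have "s * (norm u + norm v) < s * (2 * (norm u + norm v + 1))"
        using s by (intro mult_strict_left_mono) (auto simp: add_nonneg_pos add.assoc add_strict_increasing2)
      also have "\<dots> = d" using nz by (simp add: s_def)
      finally show ?thesis .
    qed
    have near: "dist (x + a *\<^sub>R u + b *\<^sub>R v) x < d" if "0 \<le> a" "a \<le> s" "0 \<le> b" "b \<le> s" for a b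
    proof -
      have "dist (x + a *\<^sub>R u + b *\<^sub>R v) x = norm (a *\<^sub>R u + b *\<^sub>R v)" by (simp add: dist_norm)
      also have "\<dots> \<le> a * norm u + b * norm v"
        by (rule order_trans[OF norm_triangle_ineq]) (use that in auto)
      also have "\<dots> \<le> s * norm u + s * norm v"
        using that by (intro add_mono mult_right_mono) auto
      finally show ?thesis using sn by (simp add: algebra_simps)
    qed
    have inS: "x + a *\<^sub>R u + b *\<^sub>R v \<in> S" if "0 \<le> a" "a \<le> s" "0 \<le> b" "b \<le> s" for a b
      using near[OF that] d3(2) by (auto simp: d_def dist_commute subset_iff)
    obtain a b where ab: "0 \<le> a" "a \<le> s" "0 \<le> b" "b \<le> s" and e1: "f (x + s *\<^sub>R u + s *\<^sub>R v) - f (x + s *\<^sub>R u) - f (x + s *\<^sub>R v) + f x = s * s * ?H u v (x + a *\<^sub>R u + b *\<^sub>R v)"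
      by (rule second_derivative_mean_value[OF S f s inS]) simp_all
    have inS': "x + a *\<^sub>R v + b *\<^sub>R u \<in> S" if "0 \<le> a" "a \<le> s" "0 \<le> b" "b \<le> s" for a b
      using inS[OF that(3,4,1,2)] by (simp add: add.assoc add.commute[of "a *\<^sub>R v"])
    obtain a' b' where ab': "0 \<le> a'" "a' \<le> s" "0 \<le> b'" "b' \<le> s"
      and e2: "f (x + s *\<^sub>R v + s *\<^sub>R u) - f (x + s *\<^sub>R v) - f (x + s *\<^sub>R u) + f x = s * s * ?H v u (x + a' *\<^sub>R v + b' *\<^sub>R u)"
      by (rule second_derivative_mean_value[OF S f s inS']) simp_all
    have "x + s *\<^sub>R v + s *\<^sub>R u = x + s *\<^sub>R u + s *\<^sub>R v" by simp
    with e1 e2 have "s * s * ?H u v (x + a *\<^sub>R u + b *\<^sub>R v) = s * s * ?H v u (x + a' *\<^sub>R v + b' *\<^sub>R u)"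
      by (smt (verit))
    then have eq: "?H u v (x + a *\<^sub>R u + b *\<^sub>R v) = ?H v u (x + a' *\<^sub>R v + b' *\<^sub>R u)" using s by simp
    have "dist (?H u v (x + a *\<^sub>R u + b *\<^sub>R v)) (?H u v x) < e / 2"
      using d1(2) inS[OF ab] near[OF ab] by (simp add: d_def)
    moreover have pt: "x + b' *\<^sub>R u + a' *\<^sub>R v = x + a' *\<^sub>R v + b' *\<^sub>R u" by simp
    have "dist (x + b' *\<^sub>R u + a' *\<^sub>R v) x < d2"
      using near[OF ab'(3,4,1,2)] by (simp add: d_def)
    from d2(2)[OF inS[OF ab'(3,4,1,2)] this]
    have "dist (?H v u (x + a' *\<^sub>R v + b' *\<^sub>R u)) (?H v u x) < e / 2"
      unfolding pt .
    ultimately show ?thesis using eq unfolding dist_real_def by linarith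
  qed
  then have "\<bar>?H u v x - ?H v u x\<bar> \<le> 0" by (rule field_le_epsilon) simp
  then show ?thesis by simp
qed

lemma second_derivative_symmetric:
  fixes f :: "'a::euclidean_space \<Rightarrow> 'b::euclidean_space"
  assumes S: "open S" and f: "smooth_on S f" and x: "x \<in> S"
  shows "frechet_derivative (\<lambda>y. frechet_derivative f (at y) u) (at x) v =
         frechet_derivative (\<lambda>y. frechet_derivative f (at y) v) (at x) u"
proof (rule euclidean_eqI)
  fix b :: 'b
  let ?F = "\<lambda>y. frechet_derivative f (at y)"
  have *: "frechet_derivative (\<lambda>y. ?F y u) (at x) v \<bullet> b =
      frechet_derivative (\<lambda>y. frechet_derivative (\<lambda>y. f y \<bullet> b) (at y) u) (at x) v" for u v
  proof -
    have 1: "frechet_derivative (\<lambda>y. f y \<bullet> b) (at y) u = ?F y u \<bullet> b" if "y \<in> S" for y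
      using frechet_derivative_at[OF has_derivative_inner_left[OF smooth_on_has_derivative[OF S f that]]]
      by metis
    have "((\<lambda>y. ?F y u) has_derivative frechet_derivative (\<lambda>y. ?F y u) (at x)) (at x)"
      by (rule smooth_on_has_derivative[OF S smooth_on_frechet_derivative[OF S f smooth_on_const[OF S]] x])
    from has_derivative_inner_left[OF this, of b]
    have "((\<lambda>y. frechet_derivative (\<lambda>y. f y \<bullet> b) (at y) u) has_derivative
        (\<lambda>h. frechet_derivative (\<lambda>y. ?F y u) (at x) h \<bullet> b)) (at x)"
      by (rule has_derivative_transform_within_open[OF _ S x]) (simp add: 1)
    from frechet_derivative_at[OF this] show ?thesis by metis
  qed
  have "Ck_on 2 S (\<lambda>y. f y \<bullet> b)"
    using smooth_on_inner[OF S f smooth_on_const[OF S]] unfolding smooth_on_def by blast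
  from second_derivative_symmetric_real[OF S this x]
  show "frechet_derivative (\<lambda>y. ?F y u) (at x) v \<bullet> b = frechet_derivative (\<lambda>y. ?F y v) (at x) u \<bullet> b"
    by (simp add: *)
qed

subsection \<open>Matrix inverses\<close>

lemma smooth_on_det:
  fixes A :: "'a::euclidean_space \<Rightarrow> real^'n^'n"
  assumes "open S" "\<And>i j. smooth_on S (\<lambda>x. A x $ i $ j)"
  shows "smooth_on S (\<lambda>x. det (A x))"
  unfolding det_def
  by (intro smooth_on_sum smooth_on_mult smooth_on_const smooth_on_prod assms)

lemma matrix_inv_inverse:
  fixes A :: "real^'n^'n"
  assumes "invertible A"
  shows "A ** matrix_inv A = mat 1" and "matrix_inv A ** A = mat 1"
  using someI_ex[OF assms[unfolded invertible_def]] by (simp_all add: matrix_inv_def)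

text \<open>
  By Cramer's rule the entries of the inverse are quotients of determinants.
\<close>

lemma smooth_on_matrix_inv:
  fixes A :: "'a::euclidean_space \<Rightarrow> real^'n^'n"
  assumes "open S" "\<And>i j. smooth_on S (\<lambda>x. A x $ i $ j)" "\<And>x. x \<in> S \<Longrightarrow> invertible (A x)"
  shows "smooth_on S (\<lambda>x. matrix_inv (A x) $ i $ j)"
proof -
  let ?C = "\<lambda>x. \<chi> k l. if l = i then (axis j 1 :: real^'n) $ k else A x $ k $ l"
  have nz: "det (A x) \<noteq> 0" if "x \<in> S" for x
    using assms(3)[OF that] by (simp add: invertible_det_nz)
  have "smooth_on S (\<lambda>x. (?C x) $ k $ l)" for k l
    by (cases "l = i") (auto simp: assms intro: smooth_intros)
  then have sm: "smooth_on S (\<lambda>x. det (?C x) / det (A x))"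
    using assms nz by (intro smooth_on_divide smooth_on_det)
  have "matrix_inv (A x) $ i $ j = det (?C x) / det (A x)" if "x \<in> S" for x
  proof -
    have "A x *v (matrix_inv (A x) *v axis j 1) = axis j 1"
      using matrix_inv_inverse(1)[OF assms(3)[OF that]] by (simp add: matrix_vector_mul_assoc)
    from this[unfolded cramer[OF nz[OF that]]]
    have "(matrix_inv (A x) *v axis j 1) $ i = det (?C x) / det (A x)" by simp
    then show ?thesis by (simp add: matrix_vector_mult_basis column_def)
  qed
  then show ?thesis
    by (rule smooth_on_eqI[OF sm])
qed

section \<open>Coordinates on the tangent spaces of a manifold\<close>

locale atlas =
  fixes M :: "('m, 'e::euclidean_space) chart set"
  assumes atlas: "smooth_atlas M"
begin

lemma inj_chart: "\<kappa> \<in> M \<Longrightarrow> inj_on (chart_map \<kappa>) (chart_dom \<kappa>)"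
  using atlas by (simp add: smooth_atlas_def)

lemma chart_inv_chart_map: "\<kappa> \<in> M \<Longrightarrow> x \<in> chart_dom \<kappa> \<Longrightarrow> chart_inv \<kappa> (chart_map \<kappa> x) = x"
  by (simp add: chart_inv_def inj_chart)

lemma chart_map_chart_inv: "y \<in> chart_img \<kappa> \<Longrightarrow> chart_map \<kappa> (chart_inv \<kappa> y) = y"
  by (simp add: chart_inv_def chart_img_def f_inv_into_f)

lemma chart_inv_dom: "y \<in> chart_img \<kappa> \<Longrightarrow> chart_inv \<kappa> y \<in> chart_dom \<kappa>"
  by (simp add: chart_inv_def chart_img_def inv_into_into)

lemma open_overlap: "\<kappa> \<in> M \<Longrightarrow> \<kappa>' \<in> M \<Longrightarrow> open (chart_map \<kappa> ` (chart_dom \<kappa> \<inter> chart_dom \<kappa>'))"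
  using atlas by (simp add: smooth_atlas_def)

lemma open_chart_img: "\<kappa> \<in> M \<Longrightarrow> open (chart_img \<kappa>)"
  using open_overlap[of \<kappa> \<kappa>] by (simp add: chart_img_def)

lemma smooth_transition:
  "\<kappa> \<in> M \<Longrightarrow> \<kappa>' \<in> M \<Longrightarrow> smooth_on (chart_map \<kappa> ` (chart_dom \<kappa> \<inter> chart_dom \<kappa>')) (transition \<kappa> \<kappa>')"
  using atlas by (simp add: smooth_atlas_def)

lemma transition_chart_map:
  "\<kappa> \<in> M \<Longrightarrow> x \<in> chart_dom \<kappa> \<Longrightarrow> transition \<kappa> \<kappa>' (chart_map \<kappa> x) = chart_map \<kappa>' x"
  by (simp add: transition_def chart_inv_chart_map)

abbreviation jac where
  "jac \<kappa> \<kappa>' x \<equiv> frechet_derivative (transition \<kappa> \<kappa>') (at (chart_map \<kappa> x))"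

lemma transition_has_derivative:
  assumes "\<kappa> \<in> charts_at M x" "\<kappa>' \<in> charts_at M x"
  shows "(transition \<kappa> \<kappa>' has_derivative jac \<kappa> \<kappa>' x)
           (at (chart_map \<kappa> x))"
  using assms smooth_on_has_derivative[OF open_overlap smooth_transition]
  by (auto simp: charts_at_def)

lemma linear_transition_derivative:
  assumes "\<kappa> \<in> charts_at M x" "\<kappa>' \<in> charts_at M x"
  shows "linear (jac \<kappa> \<kappa>' x)"
  using transition_has_derivative[OF assms] has_derivative_linear by blast

lemma transition_derivative_compose:
  assumes k: "\<kappa> \<in> charts_at M x" "\<kappa>' \<in> charts_at M x" "\<kappa>'' \<in> charts_at M x"
  shows "jac \<kappa>' \<kappa>'' x
           (jac \<kappa> \<kappa>' x b)
         = jac \<kappa> \<kappa>'' x b"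
proof -
  have M: "\<kappa> \<in> M" "\<kappa>' \<in> M" "\<kappa>'' \<in> M"
    and x: "x \<in> chart_dom \<kappa>" "x \<in> chart_dom \<kappa>'" "x \<in> chart_dom \<kappa>''"
    using k by (auto simp: charts_at_def)
  let ?U = "chart_map \<kappa> ` (chart_dom \<kappa> \<inter> chart_dom \<kappa>')"
  have "chart_map \<kappa>' x = transition \<kappa> \<kappa>' (chart_map \<kappa> x)"
    using transition_chart_map M x by simp
  with has_derivative_compose[OF transition_has_derivative[OF k(1,2)], of "transition \<kappa>' \<kappa>''"]
    transition_has_derivative[OF k(2,3)]
  have "((\<lambda>y. transition \<kappa>' \<kappa>'' (transition \<kappa> \<kappa>' y)) has_derivative
     (\<lambda>b. jac \<kappa>' \<kappa>'' x
           (jac \<kappa> \<kappa>' x b))) (at (chart_map \<kappa> x))"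
    by simp
  then have "(transition \<kappa> \<kappa>'' has_derivative
     (\<lambda>b. jac \<kappa>' \<kappa>'' x
           (jac \<kappa> \<kappa>' x b))) (at (chart_map \<kappa> x))"
    by (rule has_derivative_transform_within_open[OF _ open_overlap[OF M(1,2)]])
       (use M x in \<open>auto simp: transition_chart_map\<close>)
  from frechet_derivative_at[OF this] show ?thesis by metis
qed

lemma transition_derivative_self:
  assumes "\<kappa> \<in> charts_at M x"
  shows "jac \<kappa> \<kappa> x b = b"
proof -
  have k: "\<kappa> \<in> M" "x \<in> chart_dom \<kappa>" using assms by (auto simp: charts_at_def)
  have "(transition \<kappa> \<kappa> has_derivative (\<lambda>b. b)) (at (chart_map \<kappa> x))"
    by (rule has_derivative_transform_within_open[OF has_derivative_ident open_chart_img[OF k(1)]])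
       (use k in \<open>auto simp: chart_img_def transition_chart_map\<close>)
  from frechet_derivative_at[OF this] show ?thesis by metis
qed

lemma coord_vec_self [simp]: "\<kappa> \<in> charts_at M x \<Longrightarrow> coord_vec M \<kappa> x b \<kappa> = b"
  by (simp add: coord_vec_def transition_derivative_self)

lemma coord_vec_tangent: "\<kappa> \<in> charts_at M x \<Longrightarrow> coord_vec M \<kappa> x b \<in> tangent_space M x"
  by (auto simp: tangent_space_def coord_vec_def transition_derivative_compose)

lemma tangent_change_chart:
  assumes "v \<in> tangent_space M x" "\<kappa> \<in> charts_at M x" "\<kappa>' \<in> charts_at M x"
  shows "v \<kappa>' = jac \<kappa> \<kappa>' x (v \<kappa>)"
  using assms(1)[unfolded tangent_space_def, THEN CollectD] assms(2,3) by blast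

lemma tangent_eq_coord_vec:
  assumes "\<kappa> \<in> charts_at M x" "v \<in> tangent_space M x"
  shows "coord_vec M \<kappa> x (v \<kappa>) = v"
proof
  fix \<eta>
  show "coord_vec M \<kappa> x (v \<kappa>) \<eta> = v \<eta>"
  proof (cases "\<eta> \<in> charts_at M x")
    case True
    then show ?thesis
      by (simp only: coord_vec_def if_True tangent_change_chart[OF assms(2,1) True, symmetric])
  next
    case False
    then have "v \<eta> = 0"
      using assms(2)[unfolded tangent_space_def, THEN CollectD] by blast
    with False show ?thesis
      by (simp only: coord_vec_def if_False)
  qed
qed

lemma tangent_eqI:
  assumes "\<kappa> \<in> charts_at M x" "u \<in> tangent_space M x" "v \<in> tangent_space M x" "u \<kappa> = v \<kappa>"
  shows "u = v"
  by (rule trans[OF tangent_eq_coord_vec[OF assms(1,2), symmetric, unfolded assms(4)]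
        tangent_eq_coord_vec[OF assms(1,3)]])

lemma tangent_outside: "v \<in> tangent_space M x \<Longrightarrow> \<kappa> \<notin> charts_at M x \<Longrightarrow> v \<kappa> = 0"
  unfolding tangent_space_def by blast

lemma tangent_spaceI:
  assumes "\<And>\<kappa> \<kappa>'. \<kappa> \<in> charts_at M x \<Longrightarrow> \<kappa>' \<in> charts_at M x \<Longrightarrow>
      v \<kappa>' = jac \<kappa> \<kappa>' x (v \<kappa>)"
    and "\<And>\<kappa>. \<kappa> \<notin> charts_at M x \<Longrightarrow> v \<kappa> = 0"
  shows "v \<in> tangent_space M x"
  unfolding tangent_space_def using assms by blast

lemma tangent_combination:
  assumes "u \<in> tangent_space M x" "v \<in> tangent_space M x"
  shows "(\<lambda>\<kappa>. a *\<^sub>R u \<kappa> + b *\<^sub>R v \<kappa>) \<in> tangent_space M x"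
proof (rule tangent_spaceI)
  fix \<kappa> \<kappa>' assume k: "\<kappa> \<in> charts_at M x" "\<kappa>' \<in> charts_at M x"
  note lin = linear_transition_derivative[OF k]
  show "a *\<^sub>R u \<kappa>' + b *\<^sub>R v \<kappa>' = jac \<kappa> \<kappa>' x
      (a *\<^sub>R u \<kappa> + b *\<^sub>R v \<kappa>)"
    unfolding linear_add[OF lin] linear_cmul[OF lin]
      tangent_change_chart[OF assms(1) k] tangent_change_chart[OF assms(2) k] ..
qed (simp add: tangent_outside[OF assms(1)] tangent_outside[OF assms(2)])

lemma coord_vec_combination:
  assumes "\<kappa> \<in> charts_at M x"
  shows "coord_vec M \<kappa> x (a *\<^sub>R u + b *\<^sub>R v) = (\<lambda>\<eta>. a *\<^sub>R coord_vec M \<kappa> x u \<eta> + b *\<^sub>R coord_vec M \<kappa> x v \<eta>)"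
  by (rule tangent_eqI[OF assms coord_vec_tangent[OF assms] tangent_combination])
     (simp_all add: assms coord_vec_tangent)

lemma chart_inv_charts_at: "\<kappa> \<in> M \<Longrightarrow> y \<in> chart_img \<kappa> \<Longrightarrow> \<kappa> \<in> charts_at M (chart_inv \<kappa> y)"
  by (simp add: charts_at_def chart_inv_dom)

lemma charts_at_points: "\<kappa> \<in> charts_at M x \<Longrightarrow> x \<in> points M"
  by (auto simp: charts_at_def points_def)

lemma linear_functional_coord:
  assumes \<alpha>: "linear_functional_on_tangent M x \<alpha>" and k: "\<kappa> \<in> charts_at M x"
  shows "linear (\<lambda>b. \<alpha> (coord_vec M \<kappa> x b))"
proof -
  have *: "\<alpha> (coord_vec M \<kappa> x (a *\<^sub>R u + b *\<^sub>R v)) = a * \<alpha> (coord_vec M \<kappa> x u) + b * \<alpha> (coord_vec M \<kappa> x v)"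
    for a b u v
    using \<alpha> by (simp add: linear_functional_on_tangent_def coord_vec_combination[OF k] coord_vec_tangent[OF k])
  show ?thesis
    by (rule linearI) (use *[of 1 _ 1] *[of _ _ 0] in auto)
qed

lemma symmetric_bilinear_coord:
  assumes g: "symmetric_bilinear_field M g" and k: "\<kappa> \<in> charts_at M x"
  shows "g x (coord_vec M \<kappa> x u) (coord_vec M \<kappa> x v) = g x (coord_vec M \<kappa> x v) (coord_vec M \<kappa> x u)"
    and "linear (\<lambda>v. g x (coord_vec M \<kappa> x u) (coord_vec M \<kappa> x v))"
    and "linear (\<lambda>u. g x (coord_vec M \<kappa> x u) (coord_vec M \<kappa> x v))"
proof -
  note x = charts_at_points[OF k] and t = coord_vec_tangent[OF k]
  show s: "g x (coord_vec M \<kappa> x u) (coord_vec M \<kappa> x v) = g x (coord_vec M \<kappa> x v) (coord_vec M \<kappa> x u)" for u v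
    using g x t by (simp add: symmetric_bilinear_field_def)
  show l: "linear (\<lambda>v. g x (coord_vec M \<kappa> x u) (coord_vec M \<kappa> x v))" for u
    by (rule linear_functional_coord[OF _ k]) (use g x t in \<open>simp add: symmetric_bilinear_field_def\<close>)
  show "linear (\<lambda>u. g x (coord_vec M \<kappa> x u) (coord_vec M \<kappa> x v))"
    unfolding s[of _ v] by (rule l)
qed

section \<open>Lie brackets and the Nijenhuis tensor in coordinates\<close>

text \<open>
  Differentiating the transformation law \<open>X' (\<tau> y) = D\<tau>(y) (X y)\<close> produces a term with the second
  derivative of \<open>\<tau>\<close>. In the Lie bracket it enters antisymmetrised and cancels.
\<close>

lemma vector_field_derivative_change:
  assumes X: "vector_field M X" and k: "\<kappa> \<in> charts_at M x" "\<kappa>' \<in> charts_at M x"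
  shows "frechet_derivative (\<lambda>y. X (chart_inv \<kappa>' y) \<kappa>') (at (chart_map \<kappa>' x))
            (jac \<kappa> \<kappa>' x w)
       = jac \<kappa> \<kappa>' x
            (frechet_derivative (\<lambda>y. X (chart_inv \<kappa> y) \<kappa>) (at (chart_map \<kappa> x)) w)
         + frechet_derivative (\<lambda>y. frechet_derivative (transition \<kappa> \<kappa>') (at y) (X x \<kappa>)) (at (chart_map \<kappa> x)) w"
proof -
  have M: "\<kappa> \<in> M" "\<kappa>' \<in> M" and x: "x \<in> chart_dom \<kappa>" "x \<in> chart_dom \<kappa>'"
    using k by (auto simp: charts_at_def)
  define \<tau> where "\<tau> = transition \<kappa> \<kappa>'"
  define U where "U = chart_map \<kappa> ` (chart_dom \<kappa> \<inter> chart_dom \<kappa>')"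
  have U: "open U" and x0: "chart_map \<kappa> x \<in> U"
    using open_overlap[OF M] x by (auto simp: U_def)
  have \<tau>: "smooth_on U \<tau>" using smooth_transition[OF M] by (simp add: U_def \<tau>_def)
  have DX: "((\<lambda>y. X (chart_inv \<eta> y) \<eta>) has_derivative
      frechet_derivative (\<lambda>y. X (chart_inv \<eta> y) \<eta>) (at (chart_map \<eta> x))) (at (chart_map \<eta> x))"
    if "\<eta> \<in> charts_at M x" for \<eta>
    by (rule smooth_on_has_derivative[OF open_chart_img])
       (use X that in \<open>auto simp: vector_field_def charts_at_def chart_img_def\<close>)
  have \<tau>x: "\<tau> (chart_map \<kappa> x) = chart_map \<kappa>' x"
    using transition_chart_map M x by (simp add: \<tau>_def)
  have 1: "((\<lambda>y. X (chart_inv \<kappa>' (\<tau> y)) \<kappa>') has_derivative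
      (\<lambda>w. frechet_derivative (\<lambda>y. X (chart_inv \<kappa>' y) \<kappa>') (at (chart_map \<kappa>' x))
            (frechet_derivative \<tau> (at (chart_map \<kappa> x)) w))) (at (chart_map \<kappa> x))"
    by (rule has_derivative_compose[OF smooth_on_has_derivative[OF U \<tau> x0],
          of "\<lambda>y. X (chart_inv \<kappa>' y) \<kappa>'"]) (use DX[OF k(2)] \<tau>x in simp)
  have law: "frechet_derivative \<tau> (at y) (X (chart_inv \<kappa> y) \<kappa>) = X (chart_inv \<kappa>' (\<tau> y)) \<kappa>'"
    if yU: "y \<in> U" for y
  proof -
    obtain z where z: "z \<in> chart_dom \<kappa>" "z \<in> chart_dom \<kappa>'" "y = chart_map \<kappa> z"
      using yU unfolding U_def by blast
    have "\<kappa> \<in> charts_at M z" "\<kappa>' \<in> charts_at M z" "X z \<in> tangent_space M z"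
      using z M X by (auto simp: charts_at_def vector_field_def points_def)
    from tangent_change_chart[OF this(3,1,2)] show ?thesis
      using z M by (simp add: \<tau>_def transition_chart_map chart_inv_chart_map)
  qed
  have "((\<lambda>y. frechet_derivative \<tau> (at y) (X (chart_inv \<kappa> y) \<kappa>)) has_derivative
     (\<lambda>w. frechet_derivative \<tau> (at (chart_map \<kappa> x))
            (frechet_derivative (\<lambda>y. X (chart_inv \<kappa> y) \<kappa>) (at (chart_map \<kappa> x)) w)
         + frechet_derivative (\<lambda>y. frechet_derivative \<tau> (at y) (X (chart_inv \<kappa> (chart_map \<kappa> x)) \<kappa>))
              (at (chart_map \<kappa> x)) w)) (at (chart_map \<kappa> x))"
    by (rule has_derivative_linear_family[OF U x0 _ _ DX[OF k(1)]])
       (auto intro!: linear_frechet_derivative smooth_on_differentiable[OF U \<tau>]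
         smooth_on_differentiable[OF U smooth_on_frechet_derivative[OF U \<tau> smooth_on_const[OF U]] x0])
  then have 2: "((\<lambda>y. X (chart_inv \<kappa>' (\<tau> y)) \<kappa>') has_derivative
     (\<lambda>w. frechet_derivative \<tau> (at (chart_map \<kappa> x))
            (frechet_derivative (\<lambda>y. X (chart_inv \<kappa> y) \<kappa>) (at (chart_map \<kappa> x)) w)
         + frechet_derivative (\<lambda>y. frechet_derivative \<tau> (at y) (X (chart_inv \<kappa> (chart_map \<kappa> x)) \<kappa>))
              (at (chart_map \<kappa> x)) w)) (at (chart_map \<kappa> x))"
    by (rule has_derivative_transform_within_open[OF _ U x0 law])
  show ?thesis
    using fun_cong[OF has_derivative_unique[OF 1 2], of w]
    by (simp add: \<tau>_def chart_inv_chart_map M x)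
qed

lemma lie_bracket_tangent:
  assumes X: "vector_field M X" and Y: "vector_field M Y" and x: "x \<in> points M"
  shows "lie_bracket M X Y x \<in> tangent_space M x"
proof -
  have "lie_bracket M X Y x \<kappa>' =
      jac \<kappa> \<kappa>' x (lie_bracket M X Y x \<kappa>)"
    if k: "\<kappa> \<in> charts_at M x" "\<kappa>' \<in> charts_at M x" for \<kappa> \<kappa>'
  proof -
    let ?U = "chart_map \<kappa> ` (chart_dom \<kappa> \<inter> chart_dom \<kappa>')"
    let ?\<tau> = "transition \<kappa> \<kappa>'"
    let ?D = "\<lambda>X \<eta>. frechet_derivative (\<lambda>y. X (chart_inv \<eta> y) \<eta>) (at (chart_map \<eta> x))"
    have M: "\<kappa> \<in> M" "\<kappa>' \<in> M" and U: "chart_map \<kappa> x \<in> ?U"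
      using k by (auto simp: charts_at_def)
    have T: "X x \<in> tangent_space M x" "Y x \<in> tangent_space M x"
      using X Y x by (auto simp: vector_field_def)
    note ch = tangent_change_chart[OF T(1) k] tangent_change_chart[OF T(2) k]
    note sym = second_derivative_symmetric[OF open_overlap[OF M] smooth_transition[OF M] U, of "X x \<kappa>" "Y x \<kappa>"]
    have "lie_bracket M X Y x \<kappa>' = ?D Y \<kappa>' (X x \<kappa>') - ?D X \<kappa>' (Y x \<kappa>')"
      using k by (simp add: lie_bracket_def)
    also have "\<dots> = frechet_derivative ?\<tau> (at (chart_map \<kappa> x)) (?D Y \<kappa> (X x \<kappa>))
        - frechet_derivative ?\<tau> (at (chart_map \<kappa> x)) (?D X \<kappa> (Y x \<kappa>))"
      unfolding ch vector_field_derivative_change[OF X k] vector_field_derivative_change[OF Y k] sym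
      by simp
    also have "\<dots> = frechet_derivative ?\<tau> (at (chart_map \<kappa> x)) (lie_bracket M X Y x \<kappa>)"
      using k linear_transition_derivative[OF k] by (simp add: lie_bracket_def linear_diff)
    finally show ?thesis .
  qed
  then show ?thesis
    by (rule tangent_spaceI) (auto simp: lie_bracket_def)
qed

end

definition local_endo ::
  "('m, 'e::euclidean_space) chart set \<Rightarrow> ('m \<Rightarrow> ('m, 'e) tvec \<Rightarrow> ('m, 'e) tvec)
     \<Rightarrow> ('m, 'e) chart \<Rightarrow> 'e \<Rightarrow> 'e \<Rightarrow> 'e" where
  "local_endo M J \<kappa> y b = J (chart_inv \<kappa> y) (coord_vec M \<kappa> (chart_inv \<kappa> y) b) \<kappa>"

text \<open>
  The Nijenhuis tensor of a field of endomorphisms L of a vector space, in terms of L and its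
  derivative at y.
\<close>

definition nijenhuis_local :: "('e::euclidean_space \<Rightarrow> 'e \<Rightarrow> 'e) \<Rightarrow> 'e \<Rightarrow> 'e \<Rightarrow> 'e \<Rightarrow> 'e" where
  "nijenhuis_local L y u v =
     (let L' = (\<lambda>z w. frechet_derivative (\<lambda>y. L y w) (at y) z) in
       L' (L y u) v - L' (L y v) u + L y (L' v u) - L y (L' u v))"

context atlas
begin

lemma endomorphism_field_chart:
  assumes J: "endomorphism_field M J" and k: "\<kappa> \<in> charts_at M x" and v: "v \<in> tangent_space M x"
  shows "J x v \<kappa> = local_endo M J \<kappa> (chart_map \<kappa> x) (v \<kappa>)"
  using k v by (simp add: local_endo_def charts_at_def chart_inv_chart_map tangent_eq_coord_vec)

lemma linear_local_endo:
  assumes J: "endomorphism_field M J" and k: "\<kappa> \<in> M" and y: "y \<in> chart_img \<kappa>"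
  shows "linear (local_endo M J \<kappa> y)"
proof -
  note c = chart_inv_charts_at[OF k y]
  have *: "local_endo M J \<kappa> y (a *\<^sub>R u + b *\<^sub>R v) = a *\<^sub>R local_endo M J \<kappa> y u + b *\<^sub>R local_endo M J \<kappa> y v"
    for a b u v
    using J charts_at_points[OF c]
    by (simp add: local_endo_def endomorphism_field_def coord_vec_combination[OF c] coord_vec_tangent[OF c])
  show ?thesis
    by (rule linearI) (use *[of 1 _ 1] *[of _ _ 0] in auto)
qed

lemma vector_field_endo:
  assumes J: "endomorphism_field M J"
    and sm: "\<And>\<kappa> b. \<kappa> \<in> M \<Longrightarrow> smooth_on (chart_img \<kappa>) (\<lambda>y. local_endo M J \<kappa> y b)"
    and X: "vector_field M X"
  shows "vector_field M (\<lambda>z. J z (X z))"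
  unfolding vector_field_def
proof (intro conjI ballI)
  show "J x (X x) \<in> tangent_space M x" if "x \<in> points M" for x
    using J X that by (auto simp: endomorphism_field_def vector_field_def)
  fix \<kappa> assume k: "\<kappa> \<in> M"
  have "smooth_on (chart_img \<kappa>) (\<lambda>y. local_endo M J \<kappa> y (X (chart_inv \<kappa> y) \<kappa>))"
    by (rule smooth_on_linear_family[OF open_chart_img[OF k] linear_local_endo[OF J k] sm[OF k]])
       (use X k in \<open>auto simp: vector_field_def\<close>)
  then show "smooth_on (chart_img \<kappa>) (\<lambda>y. J (chart_inv \<kappa> y) (X (chart_inv \<kappa> y)) \<kappa>)"
  proof (rule smooth_on_eqI)
    fix y assume y: "y \<in> chart_img \<kappa>"
    note c = chart_inv_charts_at[OF k y]
    have "X (chart_inv \<kappa> y) \<in> tangent_space M (chart_inv \<kappa> y)"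
      using X charts_at_points[OF c] by (simp add: vector_field_def)
    from endomorphism_field_chart[OF J c this] show "J (chart_inv \<kappa> y) (X (chart_inv \<kappa> y)) \<kappa> =
        local_endo M J \<kappa> y (X (chart_inv \<kappa> y) \<kappa>)"
      by (simp add: chart_map_chart_inv[OF y])
  qed
qed

text \<open>
  The terms with derivatives of X and Y cancel by \<open>J\<^sup>2 = -1\<close>; what remains depends only on the
  values of X and Y at the point.
\<close>

lemma nijenhuis_chart:
  assumes J: "endomorphism_field M J"
    and sm: "\<And>\<kappa> b. \<kappa> \<in> M \<Longrightarrow> smooth_on (chart_img \<kappa>) (\<lambda>y. local_endo M J \<kappa> y b)"
    and sq: "\<And>\<kappa> y b. \<kappa> \<in> M \<Longrightarrow> y \<in> chart_img \<kappa> \<Longrightarrow> local_endo M J \<kappa> y (local_endo M J \<kappa> y b) = - b"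
    and X: "vector_field M X" and Y: "vector_field M Y" and k: "\<kappa> \<in> charts_at M x"
  shows "nijenhuis M J X Y x \<kappa> = nijenhuis_local (local_endo M J \<kappa>) (chart_map \<kappa> x) (X x \<kappa>) (Y x \<kappa>)"
proof -
  define L where "L = local_endo M J \<kappa>"
  define y where "y = chart_map \<kappa> x"
  define L' where "L' = (\<lambda>z w. frechet_derivative (\<lambda>y. L y w) (at y) z)"
  define D where "D X = frechet_derivative (\<lambda>y. X (chart_inv \<kappa> y) \<kappa>) (at y)"
    for X :: "'m \<Rightarrow> ('m, 'e) tvec"
  have kM: "\<kappa> \<in> M" and x: "x \<in> chart_dom \<kappa>" "x \<in> points M"
    using k charts_at_points by (auto simp: charts_at_def)
  have yim: "y \<in> chart_img \<kappa>" and inv: "chart_inv \<kappa> y = x"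
    using kM x by (auto simp: y_def chart_img_def chart_inv_chart_map)
  note U = open_chart_img[OF kM]
  have lin: "linear (L z)" if "z \<in> chart_img \<kappa>" for z
    using linear_local_endo[OF J kM that] by (simp add: L_def)
  note lin0 = lin[OF yim]
  have br: "lie_bracket M X Y x \<kappa> = D Y (X x \<kappa>) - D X (Y x \<kappa>)" for X Y
    using k by (simp add: lie_bracket_def D_def y_def)
  have Jx: "J x v \<kappa> = L y (v \<kappa>)" if "v \<in> tangent_space M x" for v
    using endomorphism_field_chart[OF J k that] by (simp add: L_def y_def)
  have dif: "(\<lambda>z. L z b) differentiable (at y)" for b
    unfolding L_def by (rule smooth_on_differentiable[OF U sm[OF kM] yim])
  have DJ: "D (\<lambda>z. J z (X z)) w = L y (D X w) + L' w (X x \<kappa>)" if X: "vector_field M X" for X w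
  proof -
    have "((\<lambda>y. X (chart_inv \<kappa> y) \<kappa>) has_derivative D X) (at y)"
      unfolding D_def
      by (rule smooth_on_has_derivative[OF U _ yim]) (use X kM in \<open>simp add: vector_field_def\<close>)
    from has_derivative_linear_family[where L=L, OF U yim lin dif this]
    have "((\<lambda>y. L y (X (chart_inv \<kappa> y) \<kappa>)) has_derivative (\<lambda>z. L y (D X z) + L' z (X x \<kappa>))) (at y)"
      by (simp add: L'_def inv)
    then have "((\<lambda>y. J (chart_inv \<kappa> y) (X (chart_inv \<kappa> y)) \<kappa>) has_derivative (\<lambda>z. L y (D X z) + L' z (X x \<kappa>))) (at y)"
    proof (rule has_derivative_transform_within_open[OF _ U yim])
      fix y assume y: "y \<in> chart_img \<kappa>"
      note c = chart_inv_charts_at[OF kM y]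
      have "X (chart_inv \<kappa> y) \<in> tangent_space M (chart_inv \<kappa> y)"
        using X charts_at_points[OF c] by (simp add: vector_field_def)
      from endomorphism_field_chart[OF J c this]
      show "L y (X (chart_inv \<kappa> y) \<kappa>) = J (chart_inv \<kappa> y) (X (chart_inv \<kappa> y)) \<kappa>"
        by (simp add: chart_map_chart_inv[OF y] L_def)
    qed
    from fun_cong[OF frechet_derivative_at[OF this], of w] show ?thesis
      by (simp add: D_def)
  qed
  have JX: "vector_field M (\<lambda>z. J z (X z))" and JY: "vector_field M (\<lambda>z. J z (Y z))"
    by (rule vector_field_endo[OF J _ X], rule sm, assumption)
       (rule vector_field_endo[OF J _ Y], rule sm, assumption)
  have T: "X x \<in> tangent_space M x" "Y x \<in> tangent_space M x"
    using X Y x by (auto simp: vector_field_def)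
  have sq0: "L y (L y b) = - b" for b using sq[OF kM yim] by (simp add: L_def)
  have "nijenhuis M J X Y x \<kappa> =
     L' (L y (X x \<kappa>)) (Y x \<kappa>) - L' (L y (Y x \<kappa>)) (X x \<kappa>) + L y (L' (Y x \<kappa>) (X x \<kappa>)) - L y (L' (X x \<kappa>) (Y x \<kappa>))"
    unfolding nijenhuis_def Jx[OF lie_bracket_tangent[OF JX Y x(2)]] Jx[OF lie_bracket_tangent[OF X JY x(2)]]
      br DJ[OF X] DJ[OF Y] Jx[OF T(1)] Jx[OF T(2)]
    by (simp add: linear_add[OF lin0] linear_diff[OF lin0] sq0)
  then show ?thesis
    by (simp add: nijenhuis_local_def L_def[symmetric] L'_def y_def[symmetric])
qed

end

text \<open>
  Differentiating \<open>L\<^sup>2 = -1\<close> shows that the derivative of L anticommutes with L. Hence the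
  Nijenhuis tensor satisfies \<open>N(L u, v) = - L (N(u, v))\<close>, and it vanishes as soon as it does
  on a set that generates the space together with its image under L.
\<close>

lemma nijenhuis_local_generated:
  fixes L :: "'e::euclidean_space \<Rightarrow> 'e \<Rightarrow> 'e"
  assumes S: "open S" "y \<in> S" and lin: "\<And>z. z \<in> S \<Longrightarrow> linear (L z)"
    and dif: "\<And>b. (\<lambda>z. L z b) differentiable (at y)"
    and sq: "\<And>z b. z \<in> S \<Longrightarrow> L z (L z b) = - b"
    and gen: "\<And>w. \<exists>u\<in>H. \<exists>v\<in>H. w = u + L y v"
    and H: "\<And>u v. u \<in> H \<Longrightarrow> v \<in> H \<Longrightarrow> nijenhuis_local L y u v = 0"
  shows "nijenhuis_local L y u v = 0"
proof -
  define L' where "L' = (\<lambda>z w. frechet_derivative (\<lambda>y. L y w) (at y) z)"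
  have D: "((\<lambda>z. L z b) has_derivative (\<lambda>z. L' z b)) (at y)" for b
    using dif[of b] by (simp add: L'_def frechet_derivative_works)
  have lin1: "linear (\<lambda>z. L' z b)" for b using has_derivative_linear[OF D] .
  have lin2: "linear (L' z)" for z
    using frechet_derivative_linear_family[OF S lin dif] by (simp add: L'_def)
  note lin0 = lin[OF S(2)]
  note ls = linear_add[OF lin0] linear_add[OF lin1] linear_add[OF lin2]
     linear_diff[OF lin0] linear_diff[OF lin1] linear_diff[OF lin2]
     linear_neg[OF lin0] linear_neg[OF lin1] linear_neg[OF lin2]
  note sq0 = sq[OF S(2)]
  have N: "nijenhuis_local L y u v = L' (L y u) v - L' (L y v) u + L y (L' v u) - L y (L' u v)" for u v
    by (simp add: nijenhuis_local_def L'_def)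
  have anti: "L' z (L y b) = - L y (L' z b)" for z b
  proof -
    have "((\<lambda>x. L x (L x b)) has_derivative (\<lambda>z. L y (L' z b) + L' z (L y b))) (at y)"
      using has_derivative_linear_family[OF S lin dif D[of b]] by (simp add: L'_def)
    moreover have "((\<lambda>x. L x (L x b)) has_derivative (\<lambda>z. 0)) (at y)"
      by (rule has_derivative_transform_within_open[OF has_derivative_const[of "- b"] S]) (simp add: sq)
    ultimately have "L y (L' z b) + L' z (L y b) = 0"
      using has_derivative_unique fun_cong by metis
    then show ?thesis by (simp add: eq_neg_iff_add_eq_0 add.commute)
  qed
  have NJ: "nijenhuis_local L y (L y u) v = - L y (nijenhuis_local L y u v)" for u v
    by (simp add: N anti ls sq0)
  have Nadd: "nijenhuis_local L y (u + u') v = nijenhuis_local L y u v + nijenhuis_local L y u' v" for u u' v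
    by (simp add: N ls)
  have Nanti: "nijenhuis_local L y u v = - nijenhuis_local L y v u" for u v
    by (simp add: N)
  have NH: "nijenhuis_local L y u v = 0" if "v \<in> H" for u v
  proof -
    obtain a b where "a \<in> H" "b \<in> H" "u = a + L y b" using gen by blast
    then show ?thesis using H that by (simp add: Nadd NJ linear_0[OF lin0])
  qed
  obtain a b where ab: "a \<in> H" "b \<in> H" "v = a + L y b" using gen by blast
  have "nijenhuis_local L y v u = nijenhuis_local L y a u + - L y (nijenhuis_local L y b u)"
    by (simp add: ab(3) Nadd NJ)
  also have "\<dots> = 0"
    using NH[OF ab(1), of u] NH[OF ab(2), of u] Nanti[of a u] Nanti[of b u] by (simp add: linear_0[OF lin0])
  finally show ?thesis using Nanti[of u v] by simp
qed

section \<open>The atlas of the cotangent bundle\<close>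

locale cotangent = atlas M for M :: "('m, real^'n::finite) chart set"
begin

abbreviation tchart where "tchart \<equiv> cotangent_chart M"

lemma covector_value:
  assumes k: "\<kappa> \<in> charts_at M x" and \<alpha>: "\<alpha> \<in> cotangent_space M x" and v: "v \<in> tangent_space M x"
  shows "\<alpha> v = (\<chi> i. \<alpha> (coord_vec M \<kappa> x (axis i 1))) \<bullet> v \<kappa>"
proof -
  let ?f = "\<lambda>b. \<alpha> (coord_vec M \<kappa> x b)"
  have lin: "linear ?f"
    using linear_functional_coord[OF _ k] \<alpha> by (simp add: cotangent_space_def)
  have "?f (v \<kappa>) = (\<Sum>i\<in>UNIV. (v \<kappa> $ i) * ?f (axis i 1))"
    using linear_axis_expansion[OF lin, of "v \<kappa>"] by simp
  then show ?thesis
    using tangent_eq_coord_vec[OF k v] by (simp add: inner_vec_def mult.commute)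
qed

lemma cotangent_dom: "P \<in> chart_dom (tchart \<kappa>) \<longleftrightarrow> fst P \<in> chart_dom \<kappa> \<and> snd P \<in> cotangent_space M (fst P)"
  by (cases P) (simp add: cotangent_chart_def)

lemma cotangent_map: "chart_map (tchart \<kappa>) P =
    (chart_map \<kappa> (fst P), \<chi> i. snd P (coord_vec M \<kappa> (fst P) (axis i 1)))"
  by (cases P) (simp add: cotangent_chart_def)

text \<open>
  The momentum coordinates range over the whole space: this makes the chart images of the
  cotangent bundle cylinders over those of the base.
\<close>

lemma covector_with_momenta:
  assumes k: "\<kappa> \<in> charts_at M x"
  obtains \<alpha> where "\<alpha> \<in> cotangent_space M x" "(\<chi> i. \<alpha> (coord_vec M \<kappa> x (axis i 1))) = p"
proof
  let ?\<alpha> = "\<lambda>v. if v \<in> tangent_space M x then p \<bullet> v \<kappa> else 0"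
  show "?\<alpha> \<in> cotangent_space M x"
    by (simp add: cotangent_space_def linear_functional_on_tangent_def tangent_combination inner_add_right)
  show "(\<chi> i. ?\<alpha> (coord_vec M \<kappa> x (axis i 1))) = p"
    by (simp add: vec_eq_iff coord_vec_tangent[OF k] k inner_axis)
qed

lemma cotangent_overlap:
  assumes "\<kappa> \<in> M"
  shows "chart_map (tchart \<kappa>) ` (chart_dom (tchart \<kappa>) \<inter> chart_dom (tchart \<kappa>'))
       = chart_map \<kappa> ` (chart_dom \<kappa> \<inter> chart_dom \<kappa>') \<times> UNIV" (is "?L = ?R")
proof
  show "?L \<subseteq> ?R" by (auto simp: cotangent_dom cotangent_map)
  show "?R \<subseteq> ?L"
  proof (clarify)
    fix x p assume x: "x \<in> chart_dom \<kappa>" "x \<in> chart_dom \<kappa>'"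
    then have k: "\<kappa> \<in> charts_at M x" using assms by (simp add: charts_at_def)
    obtain \<alpha> where \<alpha>: "\<alpha> \<in> cotangent_space M x" "(\<chi> i. \<alpha> (coord_vec M \<kappa> x (axis i 1))) = p"
      by (rule covector_with_momenta[OF k])
    show "(chart_map \<kappa> x, p) \<in> ?L"
      by (rule image_eqI[where x="(x, \<alpha>)"]) (use x \<alpha> in \<open>auto simp: cotangent_dom cotangent_map\<close>)
  qed
qed

lemma cotangent_chart_img: "\<kappa> \<in> M \<Longrightarrow> chart_img (tchart \<kappa>) = chart_img \<kappa> \<times> UNIV"
  using cotangent_overlap[of \<kappa> \<kappa>] by (simp add: chart_img_def)

lemma inj_cotangent_chart:
  assumes "\<kappa> \<in> M"
  shows "inj_on (chart_map (tchart \<kappa>)) (chart_dom (tchart \<kappa>))"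
proof (rule inj_onI)
  fix P Q assume P: "P \<in> chart_dom (tchart \<kappa>)" and Q: "Q \<in> chart_dom (tchart \<kappa>)"
    and eq: "chart_map (tchart \<kappa>) P = chart_map (tchart \<kappa>) Q"
  have x: "fst P = fst Q"
    using inj_onD[OF inj_chart[OF assms], of "fst P" "fst Q"] P Q eq
    by (simp add: cotangent_dom cotangent_map)
  have k: "\<kappa> \<in> charts_at M (fst P)" using assms P by (simp add: charts_at_def cotangent_dom)
  have "snd P v = snd Q v" for v
  proof (cases "v \<in> tangent_space M (fst P)")
    case True
    have \<alpha>: "snd P \<in> cotangent_space M (fst P)" "snd Q \<in> cotangent_space M (fst P)"
      using P Q x by (auto simp: cotangent_dom)
    have "(\<chi> i. snd P (coord_vec M \<kappa> (fst P) (axis i 1))) = (\<chi> i. snd Q (coord_vec M \<kappa> (fst P) (axis i 1)))"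
      using eq x by (simp add: cotangent_map)
    then show ?thesis
      using covector_value[OF k \<alpha>(1) True] covector_value[OF k \<alpha>(2) True] by simp
  next
    case False
    then show ?thesis using P Q x by (simp add: cotangent_dom cotangent_space_def)
  qed
  with x show "P = Q" by (simp add: prod_eq_iff fun_eq_iff)
qed

text \<open>
  Momenta transform with the transposed Jacobian of the inverse coordinate change, so the
  transition maps of the cotangent bundle are again smooth.
\<close>

lemma cotangent_transition:
  assumes k: "\<kappa> \<in> M" "\<kappa>' \<in> M" and x: "x \<in> chart_dom \<kappa>" "x \<in> chart_dom \<kappa>'"
  shows "transition (tchart \<kappa>) (tchart \<kappa>') (chart_map \<kappa> x, p) =
     (transition \<kappa> \<kappa>' (chart_map \<kappa> x),
      \<chi> i. p \<bullet> frechet_derivative (transition \<kappa>' \<kappa>) (at (transition \<kappa> \<kappa>' (chart_map \<kappa> x))) (axis i 1))"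
proof -
  have c: "\<kappa> \<in> charts_at M x" "\<kappa>' \<in> charts_at M x" using k x by (auto simp: charts_at_def)
  obtain \<alpha> where \<alpha>: "\<alpha> \<in> cotangent_space M x" "(\<chi> i. \<alpha> (coord_vec M \<kappa> x (axis i 1))) = p"
    by (rule covector_with_momenta[OF c(1)])
  have "(x, \<alpha>) \<in> chart_dom (tchart \<kappa>)" using \<alpha> x by (simp add: cotangent_dom)
  from inv_into_f_f[OF inj_cotangent_chart[OF k(1)] this]
  have "chart_inv (tchart \<kappa>) (chart_map \<kappa> x, p) = (x, \<alpha>)"
    by (simp add: chart_inv_def cotangent_map \<alpha>)
  then have "transition (tchart \<kappa>) (tchart \<kappa>') (chart_map \<kappa> x, p) =
      (chart_map \<kappa>' x, \<chi> i. \<alpha> (coord_vec M \<kappa>' x (axis i 1)))"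
    by (simp add: transition_def cotangent_map)
  also have "(\<chi> i. \<alpha> (coord_vec M \<kappa>' x (axis i 1))) =
      (\<chi> i. p \<bullet> jac \<kappa>' \<kappa> x (axis i 1))"
    unfolding covector_value[OF c(1) \<alpha>(1) coord_vec_tangent[OF c(2)]] \<alpha>(2)
    using c by (simp add: coord_vec_def)
  finally show ?thesis
    using transition_chart_map[OF k(1) x(1)] by simp
qed

lemma smooth_cotangent_transition:
  assumes k: "\<kappa> \<in> M" "\<kappa>' \<in> M"
  shows "smooth_on (chart_map \<kappa> ` (chart_dom \<kappa> \<inter> chart_dom \<kappa>') \<times> UNIV)
           (transition (tchart \<kappa>) (tchart \<kappa>'))"
proof -
  let ?U = "chart_map \<kappa> ` (chart_dom \<kappa> \<inter> chart_dom \<kappa>')"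
  let ?V = "chart_map \<kappa>' ` (chart_dom \<kappa>' \<inter> chart_dom \<kappa>)"
  let ?W = "?U \<times> (UNIV :: (real^'n) set)"
  let ?\<tau> = "transition \<kappa> \<kappa>'" and ?\<tau>' = "transition \<kappa>' \<kappa>"
  have W: "open ?W" by (intro open_Times open_overlap k open_UNIV)
  have "\<forall>x \<in> chart_dom \<kappa> \<inter> chart_dom \<kappa>'. ?\<tau> (chart_map \<kappa> x) \<in> ?V"
    by (simp add: transition_chart_map[OF k(1)])
  then have V: "?\<tau> (fst y) \<in> ?V" if "y \<in> ?W" for y
    using that by auto
  have t: "smooth_on ?W (\<lambda>y. ?\<tau> (fst y))"
    by (rule smooth_on_compose[OF W smooth_transition[OF k] smooth_on_fst[OF W smooth_on_ident[OF W]]]) auto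
  have D: "smooth_on ?V (\<lambda>z. frechet_derivative ?\<tau>' (at z) (axis i 1))" for i
    by (rule smooth_on_frechet_derivative[OF open_overlap smooth_transition smooth_on_const])
       (use k open_overlap in auto)
  have "smooth_on ?W (\<lambda>y. (?\<tau> (fst y), \<chi> i. snd y \<bullet> frechet_derivative ?\<tau>' (at (?\<tau> (fst y))) (axis i 1)))"
    by (intro smooth_on_Pair smooth_on_vec_lambda smooth_on_inner smooth_on_snd smooth_on_ident W t
        smooth_on_compose[OF W D t]) (use V in auto)
  then show ?thesis
    by (rule smooth_on_eqI) (use cotangent_transition[OF k] in auto)
qed

lemma smooth_atlas_cotangent_bundle: "smooth_atlas (cotangent_bundle M)"
  unfolding smooth_atlas_def cotangent_bundle_def
  by (auto simp: inj_cotangent_chart cotangent_overlap open_Times open_overlap smooth_cotangent_transition)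

end

sublocale cotangent \<subseteq> TM: atlas "cotangent_bundle M"
  by (unfold_locales) (rule smooth_atlas_cotangent_bundle)

context cotangent
begin

lemma cotangent_charts_at:
  "\<kappa> \<in> M \<Longrightarrow> P \<in> chart_dom (tchart \<kappa>) \<Longrightarrow> tchart \<kappa> \<in> charts_at (cotangent_bundle M) P"
  by (simp add: charts_at_def cotangent_bundle_def)

lemma frame_in_coordinates:
  assumes "\<kappa> \<in> M" "P \<in> chart_dom (tchart \<kappa>)"
  shows "d_dq M \<kappa> P i (tchart \<kappa>) = (axis i 1, 0)"
    and "d_dp M \<kappa> P i (tchart \<kappa>) = (0, axis i 1)"
    and "delta_dq M g \<kappa> P i (tchart \<kappa>) =
       (axis i 1, \<chi> h. \<Sum>k\<in>UNIV. mom M \<kappa> P $ k * christoffel M g \<kappa> k i h (pos M \<kappa> P))"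
proof -
  note c = cotangent_charts_at[OF assms]
  show 1: "d_dq M \<kappa> P i (tchart \<kappa>) = (axis i 1, 0)" for i
    by (simp add: d_dq_def TM.coord_vec_self[OF c])
  show 2: "d_dp M \<kappa> P i (tchart \<kappa>) = (0, axis i 1)" for i
    by (simp add: d_dp_def TM.coord_vec_self[OF c])
  have "(\<Sum>h\<in>UNIV. f h *\<^sub>R (0 :: real^'n, axis h 1 :: real^'n)) = (0, \<chi> h. f h)" for f
    by (simp add: prod_eq_iff fst_sum snd_sum vec_eq_iff axis_def if_distrib cong: if_cong)
  then show "delta_dq M g \<kappa> P i (tchart \<kappa>) =
       (axis i 1, \<chi> h. \<Sum>k\<in>UNIV. mom M \<kappa> P $ k * christoffel M g \<kappa> k i h (pos M \<kappa> P))"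
    by (simp add: delta_dq_def 1 2)
qed

lemma frame_tangent:
  assumes "\<kappa> \<in> M" "P \<in> chart_dom (tchart \<kappa>)"
  shows "d_dp M \<kappa> P i \<in> tangent_space (cotangent_bundle M) P"
    and "delta_dq M g \<kappa> P i \<in> tangent_space (cotangent_bundle M) P"
proof -
  note c = cotangent_charts_at[OF assms]
  show *: "d_dp M \<kappa> P i \<in> tangent_space (cotangent_bundle M) P" for i
    by (simp add: d_dp_def TM.coord_vec_tangent[OF c])
  have dq: "d_dq M \<kappa> P i \<in> tangent_space (cotangent_bundle M) P"
    by (simp add: d_dq_def TM.coord_vec_tangent[OF c])
  have "(\<lambda>\<eta>. d_dq M \<kappa> P i \<eta> + (\<Sum>h\<in>I. f h *\<^sub>R d_dp M \<kappa> P h \<eta>)) \<in> tangent_space (cotangent_bundle M) P"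
    if "finite I" for I and f :: "'n \<Rightarrow> real"
    using that
  proof induction
    case (insert j I)
    from TM.tangent_combination[OF insert.IH *[of j], of 1 "f j"] insert.hyps show ?case
      by (simp add: add_ac)
  qed (simp add: dq)
  from this[OF finite_class.finite_UNIV] show "delta_dq M g \<kappa> P i \<in> tangent_space (cotangent_bundle M) P"
    by (simp add: delta_dq_def)
qed

end

section \<open>Riemannian geometry in one chart\<close>

locale metric_chart =
  fixes M :: "('m, real^'n::finite) chart set"
    and g :: "'m \<Rightarrow> ('m, real^'n) tvec \<Rightarrow> ('m, real^'n) tvec \<Rightarrow> real"
    and \<kappa> :: "('m, real^'n) chart"
    and U :: "(real^'n) set"
  assumes open_U: "open U"
    and smooth_metric: "\<And>i j. smooth_on U (\<lambda>y. metric_matrix M g \<kappa> y $ i $ j)"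
    and metric_sym: "\<And>y i j. y \<in> U \<Longrightarrow> metric_matrix M g \<kappa> y $ i $ j = metric_matrix M g \<kappa> y $ j $ i"
    and metric_pos: "\<And>y u. y \<in> U \<Longrightarrow> u \<noteq> 0 \<Longrightarrow> metric_form M g \<kappa> y u u > 0"
begin

abbreviation Gm where "Gm \<equiv> metric_matrix M g \<kappa>"
abbreviation Gi where "Gi \<equiv> inverse_metric_matrix M g \<kappa>"
abbreviation Rm where "Rm \<equiv> curvature_coeff M g \<kappa>"
abbreviation \<Gamma> where "\<Gamma> \<equiv> christoffel M g \<kappa>"

lemma metric_form_inner: "metric_form M g \<kappa> y u v = u \<bullet> (Gm y *v v)"
  by (simp add: metric_form_def inner_vec_def matrix_vector_mult_def sum_distrib_left mult_ac)

lemma inner_metric_commute: "y \<in> U \<Longrightarrow> u \<bullet> (Gm y *v v) = v \<bullet> (Gm y *v u)"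
  unfolding metric_form_inner[symmetric] metric_form_def
  by (subst sum.swap) (simp add: metric_sym[of y] mult_ac)

lemma metric_positive: "y \<in> U \<Longrightarrow> u \<noteq> 0 \<Longrightarrow> u \<bullet> (Gm y *v u) > 0"
  using metric_pos by (simp add: metric_form_inner)

lemma metric_invertible: "y \<in> U \<Longrightarrow> invertible (Gm y)"
proof -
  assume y: "y \<in> U"
  have "Gm y *v u = 0 \<longrightarrow> u = 0" for u
    using metric_positive[OF y, of u] by (cases "u = 0") auto
  then show ?thesis
    by (simp add: invertible_left_inverse matrix_left_invertible_ker)
qed

lemma Gm_Gi: "y \<in> U \<Longrightarrow> Gm y *v (Gi y *v w) = w"
  using matrix_inv_inverse(1)[OF metric_invertible]
  by (simp add: inverse_metric_matrix_def matrix_vector_mul_assoc)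

lemma Gi_Gm: "y \<in> U \<Longrightarrow> Gi y *v (Gm y *v w) = w"
  using matrix_inv_inverse(2)[OF metric_invertible]
  by (simp add: inverse_metric_matrix_def matrix_vector_mul_assoc)

lemma inner_Gi_commute: "y \<in> U \<Longrightarrow> u \<bullet> (Gi y *v v) = v \<bullet> (Gi y *v u)"
  by (metis Gm_Gi inner_commute inner_metric_commute)

lemma Gi_positive: "y \<in> U \<Longrightarrow> u \<noteq> 0 \<Longrightarrow> u \<bullet> (Gi y *v u) > 0"
  by (metis Gm_Gi inner_commute matrix_vector_mult_0_right metric_positive)

lemma Gi_nonneg: "y \<in> U \<Longrightarrow> u \<bullet> (Gi y *v u) \<ge> 0"
  using Gi_positive[of y u] by (cases "u = 0") auto

lemma smooth_Gi: "smooth_on U (\<lambda>y. Gi y $ i $ j)"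
  unfolding inverse_metric_matrix_def
  by (rule smooth_on_matrix_inv[OF open_U smooth_metric metric_invertible])

lemma smooth_partial_deriv: "smooth_on U f \<Longrightarrow> smooth_on U (partial_deriv i f)"
  unfolding partial_deriv_def by (intro smooth_on_frechet_derivative open_U smooth_on_const)

lemma smooth_christoffel: "smooth_on U (\<Gamma> k i j)"
  unfolding christoffel_def
  by (intro smooth_on_mult smooth_on_const smooth_on_sum smooth_on_add smooth_on_diff open_U
      smooth_Gi smooth_partial_deriv smooth_metric)

lemma partial_deriv_cong:
  assumes "smooth_on U f" "\<And>z. z \<in> U \<Longrightarrow> f z = h z" "y \<in> U"
  shows "partial_deriv i f y = partial_deriv i h y"
  unfolding partial_deriv_def
  using frechet_derivative_transform_within_open[OF smooth_on_differentiable[OF open_U assms(1,3)] open_U assms(3,2)]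
  by simp

lemma partial_metric_sym:
  "y \<in> U \<Longrightarrow> partial_deriv l (\<lambda>z. Gm z $ i $ j) y = partial_deriv l (\<lambda>z. Gm z $ j $ i) y"
  by (rule partial_deriv_cong[OF smooth_metric metric_sym])

lemma christoffel_sym: "y \<in> U \<Longrightarrow> \<Gamma> k i j y = \<Gamma> k j i y"
  unfolding christoffel_def by (simp add: partial_metric_sym[of y _ i j] add.commute)

lemma christoffel_lowered:
  assumes y: "y \<in> U"
  shows "(\<Sum>m\<in>UNIV. Gm y $ l $ m * \<Gamma> m i j y) = (1/2) *
     (partial_deriv i (\<lambda>z. Gm z $ j $ l) y + partial_deriv j (\<lambda>z. Gm z $ i $ l) y
      - partial_deriv l (\<lambda>z. Gm z $ i $ j) y)"
proof -
  define w :: "real^'n" where "w = (\<chi> l. (1/2) *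
     (partial_deriv i (\<lambda>z. Gm z $ j $ l) y + partial_deriv j (\<lambda>z. Gm z $ i $ l) y
      - partial_deriv l (\<lambda>z. Gm z $ i $ j) y))"
  have "\<Gamma> m i j y = (Gi y *v w) $ m" for m
    by (simp add: christoffel_def matrix_vector_mult_def w_def sum_distrib_left algebra_simps)
  then have "(\<Sum>m\<in>UNIV. Gm y $ l $ m * \<Gamma> m i j y) = (Gm y *v (Gi y *v w)) $ l"
    by (simp add: matrix_vector_mult_def[of "Gm y"])
  then show ?thesis by (simp add: Gm_Gi[OF y]) (simp add: w_def)
qed

text \<open>
  In the sum of the two lowered Christoffel symbols all derivatives of the metric cancel except
  the one in direction i.
\<close>

lemma metric_compatible:
  assumes y: "y \<in> U"
  shows "partial_deriv i (\<lambda>z. Gm z $ j $ l) y =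
     (\<Sum>m\<in>UNIV. Gm y $ l $ m * \<Gamma> m i j y) + (\<Sum>m\<in>UNIV. Gm y $ j $ m * \<Gamma> m i l y)"
  unfolding christoffel_lowered[OF y]
  using partial_metric_sym[OF y, of i j l] partial_metric_sym[OF y, of j i l] partial_metric_sym[OF y, of l i j]
  by (simp add: field_simps)

subsection \<open>Symmetries of the curvature tensor\<close>

lemma curvature_antisym: "Rm l k i j y = - Rm l k j i y"
  by (simp add: curvature_coeff_def sum_subtractf)

lemma curvature_bianchi:
  assumes y: "y \<in> U"
  shows "Rm l k i j y + Rm l i j k y + Rm l j k i y = 0"
proof -
  have d: "partial_deriv i (\<Gamma> l j k) y = partial_deriv i (\<Gamma> l k j) y" for i j k
    by (rule partial_deriv_cong[OF smooth_christoffel christoffel_sym y])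
  show ?thesis
    by (simp add: curvature_coeff_def sum_subtractf d[of i k j] d[of j k i] d[of k i j]
        christoffel_sym[OF y, of _ k j] christoffel_sym[OF y, of _ k i] christoffel_sym[OF y, of _ j i])
qed

lemma partial_deriv_sum:
  assumes "\<And>m. smooth_on U (f m)" "y \<in> U"
  shows "partial_deriv i (\<lambda>z. \<Sum>m\<in>I. f m z) y = (\<Sum>m\<in>I. partial_deriv i (f m) y)"
proof -
  have "((\<lambda>z. \<Sum>m\<in>I. f m z) has_derivative (\<lambda>v. \<Sum>m\<in>I. frechet_derivative (f m) (at y) v)) (at y)"
    by (intro has_derivative_sum smooth_on_has_derivative[OF open_U assms(1,2)])
  from fun_cong[OF frechet_derivative_at[OF this]] show ?thesis
    by (simp add: partial_deriv_def)
qed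

lemma partial_deriv_add:
  assumes "smooth_on U f" "smooth_on U h" "y \<in> U"
  shows "partial_deriv i (\<lambda>z. f z + h z) y = partial_deriv i f y + partial_deriv i h y"
  using fun_cong[OF frechet_derivative_at[OF has_derivative_add[OF
      smooth_on_has_derivative[OF open_U assms(1,3)] smooth_on_has_derivative[OF open_U assms(2,3)]]]]
  by (simp add: partial_deriv_def)

lemma partial_deriv_mult:
  assumes "smooth_on U f" "smooth_on U h" "y \<in> U"
  shows "partial_deriv i (\<lambda>z. f z * h z) y = partial_deriv i f y * h y + f y * partial_deriv i h y"
  using fun_cong[OF frechet_derivative_at[OF has_derivative_mult[OF
      smooth_on_has_derivative[OF open_U assms(1,3)] smooth_on_has_derivative[OF open_U assms(2,3)]]], of "axis i 1"]
  by (simp add: partial_deriv_def add.commute)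

lemma second_partial_commute:
  assumes "smooth_on U f" "y \<in> U"
  shows "partial_deriv i (partial_deriv j f) y = partial_deriv j (partial_deriv i f) y"
  unfolding partial_deriv_def[abs_def]
  by (rule second_derivative_symmetric[OF open_U assms])

text \<open>
  Differentiating metric compatibility a second time writes \<open>\<partial>\<^sub>i\<partial>\<^sub>j g\<^sub>k\<^sub>l\<close> as a sum of the terms
  a and b below, taken for (k, l) and (l, k). The a-terms antisymmetrised in i, j are the
  lowered curvature, and the b-terms together are symmetric in i, j. As second derivatives
  commute, the claim follows.
\<close>

lemma curvature_metric_antisym:
  assumes y: "y \<in> U"
  shows "(\<Sum>m\<in>UNIV. Gm y $ l $ m * Rm m k i j y)
       = - (\<Sum>m\<in>UNIV. Gm y $ k $ m * Rm m l i j y)"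
proof -
  define a where "a i j k l = (\<Sum>m\<in>UNIV. Gm y $ l $ m *
      (partial_deriv i (\<Gamma> m j k) y + (\<Sum>h\<in>UNIV. \<Gamma> m i h y * \<Gamma> h j k y)))" for i j k l
  define b where "b i j k l = (\<Sum>m\<in>UNIV. \<Sum>h\<in>UNIV. Gm y $ m $ h * \<Gamma> h i l y * \<Gamma> m j k y)" for i j k l
  have curv: "(\<Sum>m\<in>UNIV. Gm y $ l $ m * Rm m k i j y) = a i j k l - a j i k l" for l k
    unfolding a_def curvature_coeff_def
    by (simp add: sum_subtractf sum.distrib right_diff_distrib distrib_left)
  have b_swap: "b i j l k = b j i k l" for i j k l
    unfolding b_def by (subst sum.swap) (simp add: metric_sym[OF y, of _ _] mult_ac)
  have deriv_half: "partial_deriv i (\<lambda>z. \<Sum>m\<in>UNIV. Gm z $ l $ m * \<Gamma> m j k z) y = a i j k l + b i j k l" for i j k l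
  proof -
    have "partial_deriv i (\<lambda>z. \<Sum>m\<in>UNIV. Gm z $ l $ m * \<Gamma> m j k z) y =
      (\<Sum>m\<in>UNIV. partial_deriv i (\<lambda>z. Gm z $ l $ m) y * \<Gamma> m j k y + Gm y $ l $ m * partial_deriv i (\<Gamma> m j k) y)"
      by (simp add: partial_deriv_sum[OF smooth_on_mult[OF open_U smooth_metric smooth_christoffel] y]
          partial_deriv_mult[OF smooth_metric smooth_christoffel y])
    also have "\<dots> = (\<Sum>m\<in>UNIV. \<Sum>h\<in>UNIV. Gm y $ m $ h * \<Gamma> h i l y * \<Gamma> m j k y)
       + (\<Sum>m\<in>UNIV. \<Sum>h\<in>UNIV. Gm y $ l $ h * \<Gamma> h i m y * \<Gamma> m j k y)
       + (\<Sum>m\<in>UNIV. Gm y $ l $ m * partial_deriv i (\<Gamma> m j k) y)"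
      by (simp add: metric_compatible[OF y] sum.distrib distrib_right sum_distrib_right)
    also have "(\<Sum>m\<in>UNIV. \<Sum>h\<in>UNIV. Gm y $ l $ h * \<Gamma> h i m y * \<Gamma> m j k y)
        = (\<Sum>m\<in>UNIV. Gm y $ l $ m * (\<Sum>h\<in>UNIV. \<Gamma> m i h y * \<Gamma> h j k y))"
      by (subst sum.swap) (simp add: sum_distrib_left mult_ac)
    finally show ?thesis
      by (simp add: a_def b_def distrib_left sum.distrib)
  qed
  have S: "partial_deriv i (partial_deriv j (\<lambda>z. Gm z $ k $ l)) y = a i j k l + b i j k l + (a i j l k + b i j l k)"
    for i j
  proof -
    let ?f = "\<lambda>k l z. \<Sum>m\<in>UNIV. Gm z $ l $ m * \<Gamma> m j k z"
    have sm: "smooth_on U (?f k l)" for k l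
      by (intro smooth_on_sum smooth_on_mult open_U smooth_metric smooth_christoffel)
    have "partial_deriv i (partial_deriv j (\<lambda>z. Gm z $ k $ l)) y = partial_deriv i (\<lambda>z. ?f k l z + ?f l k z) y"
      by (rule partial_deriv_cong[OF smooth_partial_deriv[OF smooth_metric] metric_compatible y])
    also have "\<dots> = partial_deriv i (?f k l) y + partial_deriv i (?f l k) y"
      by (rule partial_deriv_add[OF sm sm y])
    finally show ?thesis unfolding deriv_half .
  qed
  have "a i j k l + b i j k l + (a i j l k + b i j l k) = a j i k l + b j i k l + (a j i l k + b j i l k)"
    using second_partial_commute[OF smooth_metric y, of i j k l] unfolding S .
  then show ?thesis
    unfolding curv using b_swap[of i j k l] b_swap[of j i k l] by simp
qed

end

subsection \<open>Multilinear forms given by coefficients\<close>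

text \<open>
  The value on four vectors of the covariant tensor with components r; polarisation needs sums
  of vectors, which components alone cannot express.
\<close>

definition form4 :: "('n \<Rightarrow> 'n \<Rightarrow> 'n \<Rightarrow> 'n \<Rightarrow> real) \<Rightarrow> real^'n::finite \<Rightarrow> real^'n \<Rightarrow> real^'n \<Rightarrow> real^'n \<Rightarrow> real" where
  "form4 r u v w z = (\<Sum>i\<in>UNIV. \<Sum>j\<in>UNIV. \<Sum>k\<in>UNIV. \<Sum>l\<in>UNIV. r i j k l * u $ i * v $ j * w $ k * z $ l)"

lemma form4_add:
  "form4 r (u + u') v w z = form4 r u v w z + form4 r u' v w z"
  "form4 r u (v + v') w z = form4 r u v w z + form4 r u v' w z"
  "form4 r u v (w + w') z = form4 r u v w z + form4 r u v w' z"
  "form4 r u v w (z + z') = form4 r u v w z + form4 r u v w z'"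
  by (simp_all add: form4_def algebra_simps sum.distrib)

lemma form4_scale:
  "form4 r (s *\<^sub>R u) v w z = s * form4 r u v w z"
  "form4 r u (s *\<^sub>R v) w z = s * form4 r u v w z"
  "form4 r u v (s *\<^sub>R w) z = s * form4 r u v w z"
  "form4 r u v w (s *\<^sub>R z) = s * form4 r u v w z"
  by (simp_all add: form4_def sum_distrib_left mult_ac)

lemma sum_axis:
  fixes f :: "'n::finite \<Rightarrow> real"
  shows "(\<Sum>i\<in>UNIV. f i * axis a 1 $ i) = f a"
  by (simp add: axis_def if_distrib cong: if_cong)

lemma form4_axis: "form4 r (axis a 1) (axis b 1) (axis c 1) (axis d 1) = r a b c d"
  unfolding form4_def
  by (simp add: sum_axis sum_distrib_right[symmetric])

lemma form4_permute:
  "form4 r u v w z = form4 (\<lambda>i j k l. r j i k l) v u w z"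
  "form4 r u v w z = form4 (\<lambda>i j k l. r i k j l) u w v z"
  "form4 r u v w z = form4 (\<lambda>i j k l. r i j l k) u v z w"
proof -
  show "form4 r u v w z = form4 (\<lambda>i j k l. r j i k l) v u w z"
    unfolding form4_def by (rule trans[OF sum.swap]) (simp only: mult_ac)
  show "form4 r u v w z = form4 (\<lambda>i j k l. r i k j l) u w v z"
    unfolding form4_def by (rule sum.cong[OF refl], rule trans[OF sum.swap]) (simp only: mult_ac)
  show "form4 r u v w z = form4 (\<lambda>i j k l. r i j l k) u v z w"
    unfolding form4_def
    by (rule sum.cong[OF refl], rule sum.cong[OF refl], rule trans[OF sum.swap]) (simp only: mult_ac)
qed

lemma form4_uminus: "form4 (\<lambda>i j k l. - r i j k l) u v w z = - form4 r u v w z"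
  by (simp add: form4_def sum_negf)

lemma form4_swap12: "(\<And>i j k l. r i j k l = - r j i k l) \<Longrightarrow> form4 r u v w z = - form4 r v u w z"
  using form4_permute(1)[of r u v w z] form4_uminus[of r v u w z]
  by (metis (no_types, lifting) ext)

lemma form4_swap34: "(\<And>i j k l. r i j k l = - r i j l k) \<Longrightarrow> form4 r u v w z = - form4 r u v z w"
  using form4_permute(3)[of r u v w z] form4_uminus[of r u v z w]
  by (metis (no_types, lifting) ext)

lemma form4_cyclic:
  assumes "\<And>i j k l. r i j k l + r j k i l + r k i j l = 0"
  shows "form4 r u v w z + form4 r v w u z + form4 r w u v z = 0"
proof -
  have 1: "form4 r v w u z = form4 (\<lambda>i j k. r j k i) u v w z"
    by (rule trans[OF form4_permute(2)], rule form4_permute(1))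
  have 2: "form4 r w u v z = form4 (\<lambda>i j k. r k i j) u v w z"
    by (rule trans[OF form4_permute(1)], rule form4_permute(2))
  have "form4 r u v w z + form4 r v w u z + form4 r w u v z
      = form4 (\<lambda>i j k l. r i j k l + r j k i l + r k i j l) u v w z"
    unfolding 1 2 by (simp only: form4_def sum.distrib distrib_right)
  also have "\<dots> = 0" by (simp add: assms form4_def)
  finally show ?thesis .
qed

text \<open>
  The sectional curvatures determine the curvature tensor. Both polarisations rest on the pair
  symmetry, which is a consequence of the two antisymmetries and the cyclic identity. They make
  the form alternating in its first three arguments, so that the cyclic sum is three times the
  form itself.
\<close>

lemma curvature_like_zero:
  fixes r :: "'n::finite \<Rightarrow> 'n \<Rightarrow> 'n \<Rightarrow> 'n \<Rightarrow> real"
  assumes a12: "\<And>i j k l. r i j k l = - r j i k l"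
    and a34: "\<And>i j k l. r i j k l = - r i j l k"
    and cyc: "\<And>i j k l. r i j k l + r j k i l + r k i j l = 0"
    and sec: "\<And>u v. form4 r u v v u = 0"
  shows "r i j k l = 0"
proof -
  let ?F = "form4 r"
  note A = form4_swap12[of r, OF a12] and B = form4_swap34[of r, OF a34]
  note C = form4_cyclic[of r, OF cyc]
  have pair: "?F u v w z = ?F w z u v" for u v w z
    using C[of u v w z] C[of v w z u] C[of w z u v] C[of z u v w]
      A[of u v w z] A[of v w u z] A[of w u v z] A[of z u v w] A[of u v z w] A[of v z u w]
      A[of w z u v] A[of z u w v] A[of z w u v] A[of w z v u] A[of v w z u] A[of z v w u]
      B[of u v w z] B[of v w u z] B[of w u v z] B[of z u v w] B[of u v z w] B[of v z u w]
      B[of w z u v] B[of z u w v] B[of z w u v] B[of w z v u] B[of v w z u] B[of z v w u]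
      B[of w u z v] A[of u w v z] A[of u z v w] A[of u w z v] B[of u z v w]
    by linarith
  have p1: "?F u v v u' = 0" for u u' v
    using sec[of "u + u'" v] sec[of u v] sec[of u' v] pair[of u v v u'] A[of v u' u v] B[of u' v u v]
    by (simp add: form4_add)
  have p2: "?F u v w z = - ?F u w v z" for u v w z
    using p1[of u "v + w" z] p1[of u v z] p1[of u w z] by (simp add: form4_add)
  have "?F u v w z = 0" for u v w z
    using C[of u v w z] p2[of v w u z] A[of v u w z] p2[of w u v z] A[of w v u z] p2[of u v w z]
      A[of u w v z] A[of u v w z] A[of v w u z] A[of w u v z] by linarith
  from this[of "axis i 1" "axis j 1" "axis k 1" "axis l 1"] show ?thesis
    by (simp add: form4_axis)
qed

section \<open>Constant sectional curvature\<close>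

lemma form4_tensor:
  "form4 (\<lambda>i j k l. a j k * b i l) u v w z =
    (\<Sum>i\<in>UNIV. \<Sum>l\<in>UNIV. b i l * u $ i * z $ l) * (\<Sum>j\<in>UNIV. \<Sum>k\<in>UNIV. a j k * v $ j * w $ k)"
proof -
  have "(\<Sum>i\<in>UNIV. \<Sum>l\<in>UNIV. b i l * u $ i * z $ l) * (\<Sum>j\<in>UNIV. \<Sum>k\<in>UNIV. a j k * v $ j * w $ k)
    = (\<Sum>i\<in>UNIV. \<Sum>j\<in>UNIV. (\<Sum>k\<in>UNIV. a j k * v $ j * w $ k) * (\<Sum>l\<in>UNIV. b i l * u $ i * z $ l))"
    by (rule trans[OF sum_product]) (simp only: mult.commute)
  also have "\<dots> = form4 (\<lambda>i j k l. a j k * b i l) u v w z"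
    unfolding form4_def sum_product by (simp only: mult_ac)
  finally show ?thesis ..
qed

lemma form4_diff_scale:
  "form4 (\<lambda>i j k l. r i j k l - c * (s i j k l - s' i j k l)) u v w z
     = form4 r u v w z - c * (form4 s u v w z - form4 s' u v w z)"
  by (simp add: form4_def sum_subtractf left_diff_distrib right_diff_distrib sum_distrib_left mult_ac)

context metric_chart
begin

lemma metric_form_curvature:
  assumes y: "y \<in> U"
  shows "metric_form M g \<kappa> y (curvature_op M g \<kappa> y u v w) z =
    form4 (\<lambda>i j k l. \<Sum>m\<in>UNIV. Gm y $ l $ m * Rm m k i j y) u v w z"
proof -
  let ?R = "\<lambda>i j k l. \<Sum>m\<in>UNIV. Gm y $ l $ m * Rm m k i j y"
  let ?a = "curvature_op M g \<kappa> y u v w"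
  have 1: "(\<Sum>m\<in>UNIV. Gm y $ l $ m * ?a $ m) =
      (\<Sum>k\<in>UNIV. \<Sum>i\<in>UNIV. \<Sum>j\<in>UNIV. ?R i j k l * (u $ i * v $ j * w $ k))" for l
  proof -
    have "(\<Sum>m\<in>UNIV. Gm y $ l $ m * ?a $ m) = (\<Sum>m\<in>UNIV. \<Sum>k\<in>UNIV. \<Sum>i\<in>UNIV. \<Sum>j\<in>UNIV.
        Gm y $ l $ m * Rm m k i j y * (u $ i * v $ j * w $ k))"
      by (simp add: curvature_op_def sum_distrib_left mult.assoc)
    also have "\<dots> = (\<Sum>k\<in>UNIV. \<Sum>m\<in>UNIV. \<Sum>i\<in>UNIV. \<Sum>j\<in>UNIV.
        Gm y $ l $ m * Rm m k i j y * (u $ i * v $ j * w $ k))"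
      by (rule sum.swap)
    also have "\<dots> = (\<Sum>k\<in>UNIV. \<Sum>i\<in>UNIV. \<Sum>m\<in>UNIV. \<Sum>j\<in>UNIV.
        Gm y $ l $ m * Rm m k i j y * (u $ i * v $ j * w $ k))"
      by (rule sum.cong[OF refl], rule sum.swap)
    also have "\<dots> = (\<Sum>k\<in>UNIV. \<Sum>i\<in>UNIV. \<Sum>j\<in>UNIV. \<Sum>m\<in>UNIV.
        Gm y $ l $ m * Rm m k i j y * (u $ i * v $ j * w $ k))"
      by (rule sum.cong[OF refl], rule sum.cong[OF refl], rule sum.swap)
    finally show ?thesis by (simp add: sum_distrib_right)
  qed
  have "metric_form M g \<kappa> y ?a z = (\<Sum>l\<in>UNIV. z $ l * (\<Sum>m\<in>UNIV. Gm y $ l $ m * ?a $ m))"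
    unfolding metric_form_def
    by (subst sum.swap) (simp add: sum_distrib_left mult_ac metric_sym[OF y, of _ _])
  also have "\<dots> = form4 (\<lambda>l k i j. ?R i j k l) z w u v"
    unfolding 1 form4_def by (simp add: sum_distrib_left mult_ac)
  also have "\<dots> = form4 ?R u v w z"
    by (rule trans[OF form4_permute(2)], rule trans[OF form4_permute(1)], rule trans[OF form4_permute(3)],
        rule trans[OF form4_permute(2)], rule form4_permute(3))
  finally show ?thesis .
qed

text \<open>
  The strict Cauchy inequality, from the positivity of the metric on the component of v
  orthogonal to u. It ensures that the quotient defining the sectional curvature has a nonzero
  denominator.
\<close>

lemma gram_positive:
  assumes y: "y \<in> U" and u: "u \<noteq> 0" and v: "v \<notin> span {u}"
  shows "metric_form M g \<kappa> y u u * metric_form M g \<kappa> y v v - (metric_form M g \<kappa> y u v)\<^sup>2 > 0"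
proof -
  let ?m = "metric_form M g \<kappa> y"
  define w where "w = ?m u u *\<^sub>R v - ?m u v *\<^sub>R u"
  have uu: "?m u u > 0" using metric_pos[OF y u] .
  have "w \<noteq> 0"
  proof
    assume "w = 0"
    then have "?m u u *\<^sub>R v = ?m u v *\<^sub>R u" by (simp add: w_def)
    then have "(1 / ?m u u) *\<^sub>R (?m u u *\<^sub>R v) = (1 / ?m u u) *\<^sub>R (?m u v *\<^sub>R u)" by simp
    then have "v = (?m u v / ?m u u) *\<^sub>R u" using uu by simp
    then have "v \<in> span {u}" by (metis span_base span_scale insertI1)
    with v show False by blast
  qed
  then have "0 < ?m w w" by (rule metric_pos[OF y])
  also have "?m w w = ?m u u * (?m u u * ?m v v - (?m u v)\<^sup>2)"
    unfolding metric_form_inner w_def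
    using inner_metric_commute[OF y, of v u]
    by (simp add: matrix_vector_mult_diff_distrib matrix_vector_mult_scaleR inner_diff_left
        inner_diff_right algebra_simps power2_eq_square)
  finally show ?thesis using uu by (simp add: zero_less_mult_iff)
qed

end

locale constant_curvature_chart = metric_chart M g \<kappa> U
  for M :: "('m, real^'n::finite) chart set" and g \<kappa> U +
  fixes c :: real
  assumes sectional: "\<And>y u v. y \<in> U \<Longrightarrow> u \<noteq> v \<Longrightarrow> independent {u, v} \<Longrightarrow> sectional_curvature M g \<kappa> y u v = c"
begin

text \<open>
  The difference r of the two sides is a curvature-like tensor. Its value on the arguments
  \<open>u, v, v, u\<close> is zero: by the curvature hypothesis if u and v span a plane, and by antisymmetry
  otherwise. The second case covers all pairs of vectors in dimension 1.
\<close>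

lemma lowered_curvature:
  assumes y: "y \<in> U"
  shows "(\<Sum>m\<in>UNIV. Gm y $ l $ m * Rm m k i j y)
       = c * (Gm y $ j $ k * Gm y $ i $ l - Gm y $ i $ k * Gm y $ j $ l)"
proof -
  let ?R = "\<lambda>i j k l. \<Sum>m\<in>UNIV. Gm y $ l $ m * Rm m k i j y"
  let ?s = "\<lambda>i j k l. Gm y $ j $ k * Gm y $ i $ l" and ?s' = "\<lambda>i j k l. Gm y $ i $ k * Gm y $ j $ l"
  define r where "r = (\<lambda>i j k l. ?R i j k l - c * (?s i j k l - ?s' i j k l))"
  let ?m = "metric_form M g \<kappa> y"
  have s: "Gm y $ a $ b = Gm y $ b $ a" for a b using metric_sym[OF y] .
  have form_r: "form4 r u v v u = ?m (curvature_op M g \<kappa> y u v v) u - c * (?m u u * ?m v v - (?m u v)\<^sup>2)" for u v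
  proof -
    have 1: "form4 ?s u v v u = ?m u u * ?m v v"
      unfolding form4_tensor[of "\<lambda>j k. Gm y $ j $ k" "\<lambda>i l. Gm y $ i $ l"] metric_form_def ..
    have "form4 ?s' u v v u = form4 ?s v u v u" by (rule form4_permute(1))
    also have "\<dots> = ?m v u * ?m u v"
      unfolding form4_tensor[of "\<lambda>j k. Gm y $ j $ k" "\<lambda>i l. Gm y $ i $ l"] metric_form_def ..
    also have "?m v u = ?m u v"
      unfolding metric_form_inner by (rule inner_metric_commute[OF y])
    finally have 2: "form4 ?s' u v v u = (?m u v)\<^sup>2" by (simp add: power2_eq_square)
    show ?thesis
      unfolding r_def form4_diff_scale 1 2 metric_form_curvature[OF y] ..
  qed
  have a12: "r i j k l = - r j i k l" for i j k l
    unfolding r_def using curvature_antisym[of _ k i j y] by (simp add: sum_negf algebra_simps)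
  have a34: "r i j k l = - r i j l k" for i j k l
    unfolding r_def using curvature_metric_antisym[OF y, of l k i j] by (simp add: algebra_simps)
  have cyc: "r i j k l + r j k i l + r k i j l = 0" for i j k l
  proof -
    have "?R i j k l + ?R j k i l + ?R k i j l = (\<Sum>m\<in>UNIV. Gm y $ l $ m *
       (Rm m k i j y + Rm m i j k y + Rm m j k i y))"
      by (simp only: sum.distrib distrib_left)
    then have "?R i j k l + ?R j k i l + ?R k i j l = 0"
      using curvature_bianchi[OF y] by simp
    moreover have "c * (?s i j k l - ?s' i j k l) + c * (?s j k i l - ?s' j k i l) + c * (?s k i j l - ?s' k i j l) = 0"
      by (simp add: s[of k i] s[of k j] s[of j i] algebra_simps)
    ultimately show ?thesis unfolding r_def by linarith
  qed
  have sec: "form4 r u v v u = 0" for u v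
  proof (cases "u = 0 \<or> v \<in> span {u}")
    case True
    then obtain a where "u = 0 \<or> v = a *\<^sub>R u" by (auto simp: span_singleton)
    moreover have "form4 r 0 v v 0 = 0" using form4_scale(1)[of r 0 0 v v 0] by simp
    moreover have "form4 r u u w z = 0" for w z
      using form4_swap12[of r u u w z, OF a12] by simp
    ultimately show ?thesis by (auto simp: form4_scale)
  next
    case False
    then have uv: "u \<noteq> v" "independent {u, v}"
      using independent_insertI[of v "{u}"] by (auto simp: insert_commute span_base)
    from sectional[OF y uv] gram_positive[OF y, of u v] False show ?thesis
      unfolding form_r by (simp add: sectional_curvature_def field_simps)
  qed
  have "r i j k l = 0" by (rule curvature_like_zero[OF a12 a34 cyc sec])
  then show ?thesis by (simp add: r_def)
qed

lemma curvature_constant: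
  assumes y: "y \<in> U"
  shows "Rm l k i j y =
    c * ((if l = i then Gm y $ j $ k else 0) - (if l = j then Gm y $ i $ k else 0))"
proof -
  let ?X = "\<chi> m. Rm m k i j y"
  let ?Y = "c *\<^sub>R (Gm y $ j $ k *\<^sub>R axis i 1 - Gm y $ i $ k *\<^sub>R axis j 1) :: real^'n"
  have "Gm y *v ?X = Gm y *v ?Y"
    by (simp add: vec_eq_iff matrix_vector_mult_def[of _ ?X] lowered_curvature[OF y]
        matrix_vector_mult_scaleR matrix_vector_mult_diff_distrib matrix_vector_mult_basis column_def
        metric_sym[OF y, of _ i] metric_sym[OF y, of _ j] right_diff_distrib)
  then have "?X = ?Y" by (metis Gi_Gm[OF y])
  then have "?X $ l = ?Y $ l" by simp
  then show ?thesis by (auto simp: axis_def)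
qed

end

section \<open>The Levi-Civita connection acting on vectors and covectors\<close>

context metric_chart
begin

text \<open>
  The vertical part of the horizontal lift of u at the covector p.
\<close>

definition chr :: "real^'n \<Rightarrow> real^'n \<Rightarrow> real^'n \<Rightarrow> real^'n" where
  "chr y p u = (\<chi> h. \<Sum>i\<in>UNIV. \<Sum>k\<in>UNIV. p $ k * \<Gamma> k i h y * u $ i)"

definition conn :: "real^'n \<Rightarrow> real^'n \<Rightarrow> real^'n \<Rightarrow> real^'n" where
  "conn y x u = (\<chi> k. \<Sum>i\<in>UNIV. \<Sum>j\<in>UNIV. \<Gamma> k i j y * x $ i * u $ j)"

lemma linear_chr_vector: "linear (chr y p)"
  by (rule linearI) (simp_all add: chr_def vec_eq_iff algebra_simps sum.distrib sum_distrib_left)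

lemma linear_chr_covector: "linear (\<lambda>p. chr y p u)"
  by (rule linearI) (simp_all add: chr_def vec_eq_iff algebra_simps sum.distrib sum_distrib_left)

lemma conn_sym: "y \<in> U \<Longrightarrow> conn y x u = conn y u x"
  unfolding conn_def vec_eq_iff
  by (simp, subst sum.swap) (simp add: christoffel_sym[of y] mult_ac)

text \<open>
  Christoffel symbols act on a vector by \<open>conn\<close> and on a covector by \<open>chr\<close>; the two actions are dual
  to each other.
\<close>

lemma chr_conn: "chr y p x \<bullet> u = p \<bullet> conn y x u"
proof -
  have "chr y p x \<bullet> u = (\<Sum>h\<in>UNIV. \<Sum>i\<in>UNIV. \<Sum>k\<in>UNIV. p $ k * \<Gamma> k i h y * x $ i * u $ h)"
    by (simp add: chr_def inner_vec_def sum_distrib_right)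
  also have "\<dots> = (\<Sum>h\<in>UNIV. \<Sum>k\<in>UNIV. \<Sum>i\<in>UNIV. p $ k * \<Gamma> k i h y * x $ i * u $ h)"
    by (rule sum.cong[OF refl], rule sum.swap)
  also have "\<dots> = (\<Sum>k\<in>UNIV. \<Sum>h\<in>UNIV. \<Sum>i\<in>UNIV. p $ k * \<Gamma> k i h y * x $ i * u $ h)"
    by (rule sum.swap)
  also have "\<dots> = (\<Sum>k\<in>UNIV. \<Sum>i\<in>UNIV. \<Sum>h\<in>UNIV. p $ k * \<Gamma> k i h y * x $ i * u $ h)"
    by (rule sum.cong[OF refl], rule sum.swap)
  also have "\<dots> = p \<bullet> conn y x u"
    by (simp add: conn_def inner_vec_def sum_distrib_left mult_ac)
  finally show ?thesis .
qed

lemma chr_sym: "y \<in> U \<Longrightarrow> chr y p x \<bullet> u = chr y p u \<bullet> x"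
  by (simp add: chr_conn conn_sym[of y x u])

lemma smooth_chr: "smooth_on U (\<lambda>y. chr y p u)"
  unfolding chr_def
  by (intro smooth_on_vec_lambda smooth_on_sum smooth_on_mult smooth_on_const smooth_christoffel open_U)

lemma derivative_partials:
  assumes "smooth_on U f" "y \<in> U"
  shows "frechet_derivative f (at y) x = (\<Sum>i\<in>UNIV. x $ i * partial_deriv i f y)"
proof -
  have lin: "linear (frechet_derivative f (at y))"
    by (rule linear_frechet_derivative[OF smooth_on_differentiable[OF open_U assms]])
  show ?thesis
    using linear_axis_expansion[OF lin, of x] by (simp add: partial_deriv_def)
qed

lemma has_derivative_componentwise:
  fixes f :: "'a::real_normed_vector \<Rightarrow> real^'n"
  assumes "\<And>i. ((\<lambda>x. f x $ i) has_derivative (\<lambda>v. f' v $ i)) (at x)"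
  shows "(f has_derivative f') (at x)"
proof -
  have "((\<lambda>x. f x \<bullet> b) has_derivative (\<lambda>v. f' v \<bullet> b)) (at x)" if "b \<in> Basis" for b
  proof -
    from that obtain i where "b = axis i 1" by (auto simp: Basis_vec_def)
    then show ?thesis using assms[of i] by (simp add: inner_axis)
  qed
  then show ?thesis using has_derivative_componentwise_within[of f f' x UNIV] by simp
qed

text \<open>
  The metric is parallel: this is metric compatibility with the vectors u and x contracted.
\<close>

lemma derivative_metric:
  assumes y: "y \<in> U"
  shows "((\<lambda>y. Gm y *v u) has_derivative (\<lambda>x. Gm y *v conn y x u + chr y (Gm y *v u) x)) (at y)"
proof (rule has_derivative_componentwise)
  fix l
  have "((\<lambda>y. \<Sum>j\<in>UNIV. Gm y $ l $ j * u $ j) has_derivative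
     (\<lambda>x. \<Sum>j\<in>UNIV. frechet_derivative (\<lambda>z. Gm z $ l $ j) (at y) x * u $ j)) (at y)"
    by (intro has_derivative_sum has_derivative_mult_left smooth_on_has_derivative[OF open_U smooth_metric y])
  moreover have "(\<Sum>j\<in>UNIV. frechet_derivative (\<lambda>z. Gm z $ l $ j) (at y) x * u $ j)
      = (Gm y *v conn y x u + chr y (Gm y *v u) x) $ l" for x
  proof -
    have "(\<Sum>j\<in>UNIV. frechet_derivative (\<lambda>z. Gm z $ l $ j) (at y) x * u $ j) =
        (\<Sum>j\<in>UNIV. \<Sum>i\<in>UNIV. \<Sum>m\<in>UNIV. Gm y $ j $ m * \<Gamma> m i l y * x $ i * u $ j)
      + (\<Sum>j\<in>UNIV. \<Sum>i\<in>UNIV. \<Sum>m\<in>UNIV. Gm y $ l $ m * \<Gamma> m i j y * x $ i * u $ j)"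
      by (simp add: derivative_partials[OF smooth_metric y] metric_compatible[OF y] distrib_left
          distrib_right sum.distrib sum_distrib_left sum_distrib_right mult_ac)
    also have "(\<Sum>j\<in>UNIV. \<Sum>i\<in>UNIV. \<Sum>m\<in>UNIV. Gm y $ l $ m * \<Gamma> m i j y * x $ i * u $ j)
        = (\<Sum>j\<in>UNIV. \<Sum>m\<in>UNIV. \<Sum>i\<in>UNIV. Gm y $ l $ m * \<Gamma> m i j y * x $ i * u $ j)"
      by (rule sum.cong[OF refl], rule sum.swap)
    also have "\<dots> = (\<Sum>m\<in>UNIV. \<Sum>j\<in>UNIV. \<Sum>i\<in>UNIV. Gm y $ l $ m * \<Gamma> m i j y * x $ i * u $ j)"
      by (rule sum.swap)
    also have "\<dots> = (\<Sum>m\<in>UNIV. \<Sum>i\<in>UNIV. \<Sum>j\<in>UNIV. Gm y $ l $ m * \<Gamma> m i j y * x $ i * u $ j)"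
      by (rule sum.cong[OF refl], rule sum.swap)
    also have "\<dots> = (Gm y *v conn y x u) $ l"
      by (simp add: matrix_vector_mult_def conn_def sum_distrib_left mult_ac)
    also have "(\<Sum>j\<in>UNIV. \<Sum>i\<in>UNIV. \<Sum>m\<in>UNIV. Gm y $ j $ m * \<Gamma> m i l y * x $ i * u $ j)
        = (\<Sum>i\<in>UNIV. \<Sum>j\<in>UNIV. \<Sum>m\<in>UNIV. Gm y $ j $ m * \<Gamma> m i l y * x $ i * u $ j)"
      by (rule sum.swap)
    also have "\<dots> = (\<Sum>i\<in>UNIV. \<Sum>m\<in>UNIV. \<Sum>j\<in>UNIV. Gm y $ j $ m * \<Gamma> m i l y * x $ i * u $ j)"
      by (rule sum.cong[OF refl], rule sum.swap)
    also have "\<dots> = chr y (Gm y *v u) x $ l"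
      by (simp add: matrix_vector_mult_def chr_def sum_distrib_right sum_distrib_left mult_ac metric_sym[OF y, of _ _])
    finally show ?thesis by simp
  qed
  ultimately show "((\<lambda>y. (Gm y *v u) $ l) has_derivative
      (\<lambda>x. (Gm y *v conn y x u + chr y (Gm y *v u) x) $ l)) (at y)"
    by (simp add: matrix_vector_mult_def[of "Gm _" u])
qed

end

context constant_curvature_chart
begin

text \<open>
  The left-hand side is the vertical part of the bracket of the horizontal lifts of x and u.
  The product terms of the curvature come from differentiating the momenta along the lifts.
\<close>

lemma curvature_horizontal:
  fixes p :: "real^'n"
  assumes y: "y \<in> U"
  defines "D \<equiv> \<lambda>u x. frechet_derivative (\<lambda>y. chr y p u) (at y) x"
  shows "D u x + chr y (chr y p x) u - (D x u + chr y (chr y p u) x)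
       = c *\<^sub>R ((p \<bullet> x) *\<^sub>R (Gm y *v u) - (p \<bullet> u) *\<^sub>R (Gm y *v x))"
proof (unfold vec_eq_iff, intro allI)
  fix h
  have D: "D u x $ h = (\<Sum>j\<in>UNIV. \<Sum>k\<in>UNIV. \<Sum>i\<in>UNIV. p $ k * partial_deriv i (\<Gamma> k j h) y * u $ j * x $ i)" for u x
  proof -
    have 1: "((\<lambda>y. chr y p u $ h) has_derivative (\<lambda>x. D u x $ h)) (at y)"
      unfolding D_def
      by (intro bounded_linear.has_derivative[OF bounded_linear_vec_nth] smooth_on_has_derivative[OF open_U smooth_chr y])
    have "((\<lambda>y. \<Sum>j\<in>UNIV. \<Sum>k\<in>UNIV. p $ k * \<Gamma> k j h y * u $ j) has_derivative
      (\<lambda>x. \<Sum>j\<in>UNIV. \<Sum>k\<in>UNIV. p $ k * frechet_derivative (\<Gamma> k j h) (at y) x * u $ j)) (at y)"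
      by (intro has_derivative_sum has_derivative_mult_left has_derivative_mult_right
          smooth_on_has_derivative[OF open_U smooth_christoffel y])
    then have 2: "((\<lambda>y. chr y p u $ h) has_derivative
      (\<lambda>x. \<Sum>j\<in>UNIV. \<Sum>k\<in>UNIV. p $ k * frechet_derivative (\<Gamma> k j h) (at y) x * u $ j)) (at y)"
      by (simp add: chr_def)
    show ?thesis
      using fun_cong[OF has_derivative_unique[OF 1 2], of x]
      by (simp add: derivative_partials[OF smooth_christoffel y] sum_distrib_left sum_distrib_right mult_ac)
  qed
  let ?S = "\<lambda>f. \<Sum>j\<in>UNIV. \<Sum>i\<in>UNIV. \<Sum>k\<in>UNIV. p $ k * f i j k * u $ j * x $ i"
  have E1: "D u x $ h = ?S (\<lambda>i j k. partial_deriv i (\<Gamma> k j h) y)"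
    unfolding D by (rule sum.cong[OF refl], rule sum.swap)
  have E2: "D x u $ h = ?S (\<lambda>i j k. partial_deriv j (\<Gamma> k i h) y)"
  proof -
    have "D x u $ h = (\<Sum>i\<in>UNIV. \<Sum>j\<in>UNIV. \<Sum>k\<in>UNIV. p $ k * partial_deriv j (\<Gamma> k i h) y * x $ i * u $ j)"
      unfolding D by (rule sum.cong[OF refl], rule sum.swap)
    also have "\<dots> = ?S (\<lambda>i j k. partial_deriv j (\<Gamma> k i h) y)"
      by (rule trans[OF sum.swap]) (simp only: mult_ac)
    finally show ?thesis .
  qed
  have cc: "chr y (chr y p x) u $ h =
      (\<Sum>j\<in>UNIV. \<Sum>i\<in>UNIV. \<Sum>k\<in>UNIV. p $ k * (\<Sum>m\<in>UNIV. \<Gamma> k i m y * \<Gamma> m j h y) * u $ j * x $ i)" for u x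
  proof -
    have "chr y (chr y p x) u $ h =
       (\<Sum>j\<in>UNIV. \<Sum>m\<in>UNIV. \<Sum>i\<in>UNIV. \<Sum>k\<in>UNIV. p $ k * (\<Gamma> k i m y * \<Gamma> m j h y) * u $ j * x $ i)"
      by (simp add: chr_def sum_distrib_left sum_distrib_right mult_ac)
    also have "\<dots> = (\<Sum>j\<in>UNIV. \<Sum>i\<in>UNIV. \<Sum>m\<in>UNIV. \<Sum>k\<in>UNIV. p $ k * (\<Gamma> k i m y * \<Gamma> m j h y) * u $ j * x $ i)"
      by (rule sum.cong[OF refl], rule sum.swap)
    also have "\<dots> = (\<Sum>j\<in>UNIV. \<Sum>i\<in>UNIV. \<Sum>k\<in>UNIV. \<Sum>m\<in>UNIV. p $ k * (\<Gamma> k i m y * \<Gamma> m j h y) * u $ j * x $ i)"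
      by (rule sum.cong[OF refl], rule sum.cong[OF refl], rule sum.swap)
    finally show ?thesis by (simp add: sum_distrib_left sum_distrib_right)
  qed
  have E3: "chr y (chr y p x) u $ h = ?S (\<lambda>i j k. \<Sum>m\<in>UNIV. \<Gamma> k i m y * \<Gamma> m j h y)"
    by (rule cc)
  have E4: "chr y (chr y p u) x $ h = ?S (\<lambda>i j k. \<Sum>m\<in>UNIV. \<Gamma> k j m y * \<Gamma> m i h y)"
    unfolding cc by (rule trans[OF sum.swap]) (simp only: mult_ac)
  have "(D u x + chr y (chr y p x) u - (D x u + chr y (chr y p u) x)) $ h
      = ?S (\<lambda>i j k. Rm k h i j y)"
    unfolding vector_add_component vector_minus_component E1 E2 E3 E4
    by (simp only: sum.distrib[symmetric] sum_subtractf[symmetric] curvature_coeff_def)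
       (simp add: sum_subtractf algebra_simps)
  also have "\<dots> = (\<Sum>j\<in>UNIV. \<Sum>i\<in>UNIV. c * (p $ i * Gm y $ j $ h * u $ j * x $ i - p $ j * Gm y $ i $ h * u $ j * x $ i))"
    by (simp add: curvature_constant[OF y] right_diff_distrib left_diff_distrib sum_subtractf
        if_distrib[of "\<lambda>z. _ * z"] if_distrib[of "\<lambda>z. z * _"] mult_ac cong: if_cong)
  also have "\<dots> = c * ((p \<bullet> x) * (\<Sum>j\<in>UNIV. Gm y $ h $ j * u $ j) - (p \<bullet> u) * (\<Sum>i\<in>UNIV. Gm y $ h $ i * x $ i))"
  proof -
    have 1: "(\<Sum>j\<in>UNIV. \<Sum>i\<in>UNIV. p $ i * Gm y $ j $ h * u $ j * x $ i) = (\<Sum>j\<in>UNIV. Gm y $ h $ j * u $ j) * (p \<bullet> x)"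
      unfolding sum_product inner_vec_def by (simp add: metric_sym[OF y, of _ h] mult_ac)
    have 2: "(\<Sum>j\<in>UNIV. \<Sum>i\<in>UNIV. p $ j * Gm y $ i $ h * u $ j * x $ i) = (p \<bullet> u) * (\<Sum>i\<in>UNIV. Gm y $ h $ i * x $ i)"
      by (simp add: sum_product inner_vec_def metric_sym[OF y, of _ h] mult_ac)
    show ?thesis
      by (simp only: sum_distrib_left[symmetric] sum_subtractf 1 2) (simp add: mult.commute)
  qed
  also have "\<dots> = (c *\<^sub>R ((p \<bullet> x) *\<^sub>R (Gm y *v u) - (p \<bullet> u) *\<^sub>R (Gm y *v x))) $ h"
    by (simp add: matrix_vector_mult_def)
  finally show "(D u x + chr y (chr y p x) u - (D x u + chr y (chr y p u) x)) $ h = \<dots>" .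
qed

end

section \<open>Horizontal lifts and the energy density\<close>

context metric_chart
begin

abbreviation UT where "UT \<equiv> U \<times> (UNIV :: (real^'n) set)"

definition hor :: "(real^'n) \<times> (real^'n) \<Rightarrow> real^'n \<Rightarrow> (real^'n) \<times> (real^'n)" where
  "hor y u = (u, chr (fst y) (snd y) u)"

definition raised :: "(real^'n) \<times> (real^'n) \<Rightarrow> real^'n" where
  "raised y = Gi (fst y) *v snd y"

definition energy :: "(real^'n) \<times> (real^'n) \<Rightarrow> real" where
  "energy y = (1/2) * (snd y \<bullet> raised y)"

lemma energy_nonneg: "fst y \<in> U \<Longrightarrow> energy y \<ge> 0"
  using Gi_nonneg[of "fst y" "snd y"] by (simp add: energy_def raised_def)

lemma inner_raised: "snd y \<bullet> raised y = 2 * energy y"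
  by (simp add: energy_def)

lemma raised_inner_metric: "fst y \<in> U \<Longrightarrow> raised y \<bullet> (Gm (fst y) *v u) = snd y \<bullet> u"
  unfolding raised_def using inner_metric_commute[of "fst y" "Gi (fst y) *v snd y" u]
  by (simp add: Gm_Gi inner_commute)

lemma open_chart_bundle: "open UT"
  by (intro open_Times open_U open_UNIV)

lemma smooth_on_bundle: "smooth_on U f \<Longrightarrow> smooth_on UT (\<lambda>y. f (fst y))"
  by (rule smooth_on_compose[OF open_chart_bundle _ smooth_on_fst[OF open_chart_bundle smooth_on_ident[OF open_chart_bundle]]]) auto

lemma smooth_momentum: "smooth_on UT snd"
  using smooth_on_snd[OF open_chart_bundle smooth_on_ident[OF open_chart_bundle]] by simp

lemma smooth_raised: "smooth_on UT raised"
proof -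
  have "smooth_on UT (\<lambda>y. \<chi> i. \<Sum>j\<in>UNIV. Gi (fst y) $ i $ j * snd y $ j)"
    by (intro smooth_on_vec_lambda smooth_on_sum smooth_on_mult smooth_on_vec_nth smooth_momentum
        smooth_on_bundle[OF smooth_Gi] open_chart_bundle)
  then show ?thesis
    by (rule smooth_on_eqI) (simp add: raised_def matrix_vector_mult_def)
qed

lemma smooth_energy: "smooth_on UT energy"
  unfolding energy_def
  by (intro smooth_on_mult smooth_on_const smooth_on_inner smooth_momentum smooth_raised open_chart_bundle)

lemma smooth_Gm_vec: "smooth_on U (\<lambda>y. Gm y *v u)"
  unfolding matrix_vector_mult_def
  by (intro smooth_on_vec_lambda smooth_on_sum smooth_on_mult smooth_on_const smooth_metric open_U)

lemma chr_bundle_derivative: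
  assumes y: "fst y \<in> U"
  shows "((\<lambda>y. chr (fst y) (snd y) u) has_derivative
     (\<lambda>w. chr (fst y) (snd w) u + frechet_derivative (\<lambda>q. chr q (snd y) u) (at (fst y)) (fst w))) (at y)"
proof -
  have y': "y \<in> UT" using y by (cases y) auto
  have d: "((\<lambda>y. chr (fst y) p u) has_derivative
      (\<lambda>w. frechet_derivative (\<lambda>q. chr q p u) (at (fst y)) (fst w))) (at y)" for p
    by (rule has_derivative_compose[where g="\<lambda>q. chr q p u", OF has_derivative_fst[OF has_derivative_ident]
          smooth_on_has_derivative[OF open_U smooth_chr y]])
  show ?thesis
    using has_derivative_linear_family[where L="\<lambda>y p. chr (fst y) p u", OF open_chart_bundle y' linear_chr_covector
        differentiableI[OF d] has_derivative_snd[OF has_derivative_ident]]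
    unfolding frechet_derivative_at[OF d, symmetric] .
qed

lemma Gm_bundle_derivative:
  assumes y: "fst y \<in> U"
  shows "((\<lambda>y. Gm (fst y) *v u) has_derivative
     (\<lambda>w. Gm (fst y) *v conn (fst y) (fst w) u + chr (fst y) (Gm (fst y) *v u) (fst w))) (at y)"
  by (rule has_derivative_compose[where g="\<lambda>q. Gm q *v u", OF has_derivative_fst[OF has_derivative_ident]
        derivative_metric[OF y]])

text \<open>
  Since the metric is parallel, horizontal lifts preserve the energy density, so that its
  derivative only sees the vertical part of a tangent vector. The derivative of the inverse metric is
  avoided by differentiating \<open>g (raised y) = p\<close>.
\<close>

lemma energy_derivative:
  assumes y: "fst y \<in> U"
  shows "(energy has_derivative (\<lambda>w. raised y \<bullet> (snd w - chr (fst y) (snd y) (fst w)))) (at y)"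
proof -
  have y': "y \<in> UT" using y by (cases y) auto
  define r where "r = raised y"
  define R where "R = frechet_derivative raised (at y)"
  let ?DG = "\<lambda>w. Gm (fst y) *v conn (fst y) (fst w) r + chr (fst y) (Gm (fst y) *v r) (fst w)"
  have R: "(raised has_derivative R) (at y)"
    unfolding R_def by (rule smooth_on_has_derivative[OF open_chart_bundle smooth_raised y'])
  have Gr: "Gm (fst y) *v r = snd y" by (simp add: r_def raised_def Gm_Gi[OF y])
  have 1: "((\<lambda>y. Gm (fst y) *v raised y) has_derivative (\<lambda>w. Gm (fst y) *v R w + ?DG w)) (at y)"
    using has_derivative_linear_family[where L="\<lambda>y u. Gm (fst y) *v u", OF open_chart_bundle y'
        matrix_vector_mul_linear differentiableI[OF Gm_bundle_derivative[OF y]] R]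
    unfolding frechet_derivative_at[OF Gm_bundle_derivative[OF y], symmetric] r_def .
  have 2: "((\<lambda>y. Gm (fst y) *v raised y) has_derivative snd) (at y)"
    by (rule has_derivative_transform_within_open[OF _ open_chart_bundle y', where f=snd])
       (auto simp: raised_def Gm_Gi intro: bounded_linear_imp_has_derivative bounded_linear_snd)
  have rR: "snd y \<bullet> R w = r \<bullet> snd w - 2 * (r \<bullet> chr (fst y) (snd y) (fst w))" for w
  proof -
    have "r \<bullet> (Gm (fst y) *v R w + ?DG w) = r \<bullet> snd w"
      using fun_cong[OF has_derivative_unique[OF 1 2], of w] by simp
    moreover have "r \<bullet> (Gm (fst y) *v u) = snd y \<bullet> u" for u
      unfolding r_def by (rule raised_inner_metric[OF y])
    moreover have "snd y \<bullet> conn (fst y) (fst w) r = r \<bullet> chr (fst y) (snd y) (fst w)"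
      by (simp add: chr_conn[symmetric] inner_commute)
    ultimately show ?thesis unfolding Gr inner_add_right by simp
  qed
  have "(energy has_derivative (\<lambda>w. (1/2) * (snd y \<bullet> R w + snd w \<bullet> raised y))) (at y)"
    unfolding energy_def[abs_def]
    by (intro has_derivative_mult_right has_derivative_inner R has_derivative_snd has_derivative_ident)
  moreover have "(1/2) * (snd y \<bullet> R w + snd w \<bullet> raised y) = raised y \<bullet> (snd w - chr (fst y) (snd y) (fst w))" for w
    unfolding rR r_def by (simp add: inner_diff_right inner_commute[of "snd w"])
  ultimately show ?thesis by simp
qed

end

section \<open>Integrability in one chart\<close>

context constant_curvature_chart
begin

text \<open>
  The coefficients a and b stand for functions of the energy density, and da, db for their
  derivatives with respect to it. Only horizontal lifts are tested. The values of \<open>L\<close> on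
  them are known near the point, so the derivative of L on a horizontal lift is obtained by
  differentiating the equation LH, in terms of the derivatives DB of B and D of \<open>chr\<close>. In the resulting expression
  for the Nijenhuis tensor the vertical terms cancel by V and HK, and the argument of the
  remaining application of L vanishes by HB.
\<close>

lemma integrable_in_chart:
  fixes L :: "(real^'n) \<times> (real^'n) \<Rightarrow> (real^'n) \<times> (real^'n) \<Rightarrow> (real^'n) \<times> (real^'n)"
    and a b :: "(real^'n) \<times> (real^'n) \<Rightarrow> real" and da db :: real
  assumes y0: "fst y0 \<in> U"
    and lin: "\<And>y. fst y \<in> U \<Longrightarrow> linear (L y)"
    and dif: "\<And>w. (\<lambda>y. L y w) differentiable (at y0)"
    and LH: "\<And>y u. fst y \<in> U \<Longrightarrow>
       L y (hor y u) = (0, a y *\<^sub>R (Gm (fst y) *v u) + (b y * (snd y \<bullet> u)) *\<^sub>R snd y)"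
    and sq: "\<And>y w. fst y \<in> U \<Longrightarrow> L y (L y w) = - w"
    and Da: "(a has_derivative (\<lambda>w. (raised y0 \<bullet> (snd w - chr (fst y0) (snd y0) (fst w))) * da)) (at y0)"
    and Db: "(b has_derivative (\<lambda>w. (raised y0 \<bullet> (snd w - chr (fst y0) (snd y0) (fst w))) * db)) (at y0)"
    and key: "da * (a y0 + 2 * energy y0 * b y0) - a y0 * b y0 = c"
  shows "nijenhuis_local L y0 u v = 0"
proof -
  define q where "q = fst y0"
  define p where "p = snd y0"
  define r where "r = raised y0"
  define t' where "t' w = r \<bullet> (snd w - chr q p (fst w))" for w
  define S where "S = UT"
  define \<alpha> where "\<alpha> = a y0"
  define \<beta> where "\<beta> = b y0"
  define B where "B y u = a y *\<^sub>R (Gm (fst y) *v u) + (b y * (snd y \<bullet> u)) *\<^sub>R snd y" for y u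
  define B0 where "B0 u = \<alpha> *\<^sub>R (Gm q *v u) + (\<beta> * (p \<bullet> u)) *\<^sub>R p" for u
  define D where "D u x = frechet_derivative (\<lambda>q. chr q p u) (at q) x" for u x
  define DB where "DB w u = (t' w * da) *\<^sub>R (Gm q *v u) + \<alpha> *\<^sub>R (Gm q *v conn q (fst w) u + chr q (Gm q *v u) (fst w))
      + (t' w * db * (p \<bullet> u)) *\<^sub>R p + (\<beta> * (snd w \<bullet> u)) *\<^sub>R p + (\<beta> * (p \<bullet> u)) *\<^sub>R snd w" for w u
  define L' where "L' = (\<lambda>z w. frechet_derivative (\<lambda>y. L y w) (at y0) z)"
  have q: "q \<in> U" using y0 by (simp add: q_def)
  have S: "open S" "y0 \<in> S" using open_chart_bundle y0 by (auto simp: S_def mem_Times_iff)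
  have linS: "linear (L y)" if "y \<in> S" for y using lin that by (auto simp: S_def)
  note lin0 = linS[OF S(2)]
  note lc = linear_add[OF linear_chr_vector] linear_cmul[OF linear_chr_vector] linear_0[OF linear_chr_vector]
    linear_add[OF linear_chr_covector] linear_cmul[OF linear_chr_covector] linear_0[OF linear_chr_covector]
  have h0: "hor y0 u = (u, chr q p u)" for u by (simp add: hor_def q_def p_def)
  have LH0: "L y0 (hor y0 u) = (0, B0 u)" for u
    using LH[OF y0] by (simp add: B0_def \<alpha>_def \<beta>_def q_def p_def)
  have sq0: "L y0 (L y0 w) = - w" for w using sq[OF y0] .
  have DBd: "((\<lambda>y. B y u) has_derivative (\<lambda>w. DB w u)) (at y0)" for u
  proof -
    have *: "((\<lambda>y. B y u) has_derivative
       (\<lambda>w. (a y0 *\<^sub>R (Gm (fst y0) *v conn (fst y0) (fst w) u + chr (fst y0) (Gm (fst y0) *v u) (fst w))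
            + (t' w * da) *\<^sub>R (Gm (fst y0) *v u))
         + ((b y0 * (snd y0 \<bullet> u)) *\<^sub>R snd w
            + (b y0 * (snd w \<bullet> u) + (t' w * db) * (snd y0 \<bullet> u)) *\<^sub>R snd y0))) (at y0)"
      unfolding B_def
      by (intro has_derivative_add has_derivative_scaleR has_derivative_mult has_derivative_inner_left
          has_derivative_snd has_derivative_ident Gm_bundle_derivative[OF y0]
          Da[folded q_def p_def r_def, folded t'_def] Db[folded q_def p_def r_def, folded t'_def])
    show ?thesis
      by (rule has_derivative_eq_rhs[OF *])
         (simp add: DB_def fun_eq_iff \<alpha>_def \<beta>_def q_def p_def scaleR_add_left add_ac)
  qed
  have L'H: "L' w (hor y0 u) = (0, DB w u) - L y0 (0, chr q (snd w) u + D u (fst w))" for w u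
  proof -
    have hd: "((\<lambda>y. hor y u) has_derivative (\<lambda>w. (0, chr q (snd w) u + D u (fst w)))) (at y0)"
      unfolding hor_def q_def D_def p_def
      by (intro has_derivative_Pair has_derivative_const chr_bundle_derivative[OF y0])
    have 1: "((\<lambda>y. L y (hor y u)) has_derivative
       (\<lambda>w. L y0 (0, chr q (snd w) u + D u (fst w)) + L' w (hor y0 u))) (at y0)"
      using has_derivative_linear_family[OF S linS dif hd] by (simp add: L'_def)
    have 2: "((\<lambda>y. L y (hor y u)) has_derivative (\<lambda>w. (0, DB w u))) (at y0)"
    proof (rule has_derivative_transform_within_open[OF _ S])
      show "((\<lambda>y. (0, B y u)) has_derivative (\<lambda>w. (0, DB w u))) (at y0)"
        by (intro has_derivative_Pair has_derivative_const DBd)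
    qed (auto simp: LH B_def S_def)
    show ?thesis
      unfolding fun_cong[OF has_derivative_unique[OF 2 1], of w] by simp
  qed
  have t'H: "t' (hor y0 u) = 0" for u by (simp add: t'_def h0)
  have gm: "v \<bullet> (Gm q *v u) = u \<bullet> (Gm q *v v)" for u v
    by (rule inner_metric_commute[OF q])
  have rB: "r \<bullet> B0 u = (\<alpha> + 2 * energy y0 * \<beta>) * (p \<bullet> u)" for u
  proof -
    have "r \<bullet> (Gm q *v u) = p \<bullet> u" using raised_inner_metric[OF y0] by (simp add: r_def q_def p_def)
    moreover have "r \<bullet> p = 2 * energy y0"
      using inner_raised[of y0] by (simp add: r_def p_def inner_commute)
    ultimately show ?thesis
      unfolding B0_def by (simp add: inner_add_right algebra_simps)
  qed
  have B0sym: "B0 u \<bullet> v = B0 v \<bullet> u" for u v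
    unfolding B0_def using gm[of v u] by (simp add: inner_add_left inner_add_right inner_commute)
  have V: "DB (0, B0 u) v - DB (0, B0 v) u = c *\<^sub>R ((p \<bullet> u) *\<^sub>R (Gm q *v v) - (p \<bullet> v) *\<^sub>R (Gm q *v u))" for u v
  proof -
    have t: "t' (0, B0 u) = (\<alpha> + 2 * energy y0 * \<beta>) * (p \<bullet> u)" for u
      by (simp add: t'_def lc rB)
    have conn0: "conn q 0 u = 0" for u by (simp add: conn_def vec_eq_iff)
    have DB0: "DB (0, B0 u) v = ((\<alpha> + 2 * energy y0 * \<beta>) * (p \<bullet> u) * da) *\<^sub>R (Gm q *v v)
       + ((\<alpha> + 2 * energy y0 * \<beta>) * (p \<bullet> u) * db * (p \<bullet> v)) *\<^sub>R p
       + (\<beta> * (B0 u \<bullet> v)) *\<^sub>R p + (\<beta> * (p \<bullet> v)) *\<^sub>R B0 u" for u v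
      by (simp add: DB_def t lc conn0)
    have k: "c = da * (\<alpha> + 2 * energy y0 * \<beta>) - \<alpha> * \<beta>" using key by (simp add: \<alpha>_def \<beta>_def)
    show ?thesis
      unfolding DB0 B0sym[of v u] unfolding B0_def k
      by (simp add: vec_eq_iff algebra_simps)
  qed
  have HK: "chr q (snd (hor y0 v)) u + D u v - (chr q (snd (hor y0 u)) v + D v u)
      = c *\<^sub>R ((p \<bullet> v) *\<^sub>R (Gm q *v u) - (p \<bullet> u) *\<^sub>R (Gm q *v v))" for u v
    using curvature_horizontal[OF q, of p u v] by (simp add: D_def h0 add.commute)
  have HB: "DB (hor y0 v) u - chr q (B0 u) v = DB (hor y0 u) v - chr q (B0 v) u" for u v
  proof -
    have *: "DB (hor y0 v) u - chr q (B0 u) v = \<alpha> *\<^sub>R (Gm q *v conn q v u) + (\<beta> * (chr q p v \<bullet> u)) *\<^sub>R p" for u v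
      unfolding DB_def t'H by (simp add: B0_def lc h0 scaleR_add_right)
    show ?thesis unfolding * using conn_sym[OF q, of u v] chr_sym[OF q, of p u v] by simp
  qed
  show ?thesis
  proof (rule nijenhuis_local_generated[OF S linS dif, where H="range (hor y0)"])
    show "L z (L z b) = - b" if "z \<in> S" for z b
      by (rule sq) (use that in \<open>auto simp: S_def\<close>)
    show "\<exists>u\<in>range (hor y0). \<exists>v\<in>range (hor y0). w = u + L y0 v" for w
    proof -
      have linB: "linear B0"
        by (rule linearI) (simp_all add: B0_def vec_eq_iff algebra_simps matrix_vector_right_distrib
            matrix_vector_mult_scaleR inner_add_right)
      (* J is injective, so B0 is injective and hence onto: every vertical vector is the image
         of a horizontal lift *)
      have "u = 0" if "B0 u = 0" for u
      proof -
        have "- hor y0 u = L y0 (L y0 (hor y0 u))" by (simp add: sq0)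
        also have "\<dots> = 0" by (simp add: LH0 that linear_0[OF lin0] flip: zero_prod_def)
        finally show ?thesis by (simp add: h0 zero_prod_def)
      qed
      then have "surj B0"
        using linear_injective_imp_surjective[OF linB] linear_injective_0[OF linB] by blast
      then obtain v where "B0 v = snd w - chr q p (fst w)" by (metis surjD)
      then have "w = hor y0 (fst w) + L y0 (hor y0 v)"
        unfolding LH0 unfolding h0 by (simp add: prod_eq_iff)
      then show ?thesis by blast
    qed
    show "nijenhuis_local L y0 x z = 0" if "x \<in> range (hor y0)" "z \<in> range (hor y0)" for x z
    proof -
      from that obtain u v where uv: "x = hor y0 u" "z = hor y0 v" by blast
      have lL: "L y0 (0, a - b) = L y0 (0, a) - L y0 (0, b)" for a b
        using linear_diff[OF lin0, of "(0, a)" "(0, b)"] by simp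
      have D0: "D u 0 = 0" for u
      proof -
        have "linear (\<lambda>x. D u x)" unfolding D_def
          using linear_frechet_derivative[OF smooth_on_differentiable[OF open_U smooth_chr q]] by simp
        from linear_0[OF this] show ?thesis .
      qed
      have LL: "L y0 (L' w (hor y0 u)) = L y0 (0, DB w u) + (0, chr q (snd w) u + D u (fst w))" for w u
        unfolding L'H linear_diff[OF lin0] sq0 by simp
      have "nijenhuis_local L y0 (hor y0 u) (hor y0 v) =
          L' (0, B0 u) (hor y0 v) - L' (0, B0 v) (hor y0 u)
          + L y0 (L' (hor y0 v) (hor y0 u)) - L y0 (L' (hor y0 u) (hor y0 v))"
        by (simp add: nijenhuis_local_def L'_def LH0)
      also have "\<dots> = (0, (DB (0, B0 u) v - DB (0, B0 v) u)
            + (chr q (snd (hor y0 v)) u + D u v - (chr q (snd (hor y0 u)) v + D v u)))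
          + L y0 (0, (DB (hor y0 v) u - chr q (B0 u) v) - (DB (hor y0 u) v - chr q (B0 v) u))"
        unfolding LL unfolding L'H lL by (simp add: D0 h0)
      also have "\<dots> = L y0 0"
        unfolding V HK HB[of v u] by (simp add: algebra_simps flip: zero_prod_def)
      also have "\<dots> = 0" by (rule linear_0[OF lin0])
      finally show ?thesis by (simp add: uv)
    qed
  qed
qed

end

section \<open>The coefficient functions\<close>

locale natural_coefficients =
  fixes A c :: real and lam mu :: "real \<Rightarrow> real"
  assumes smooth_lam: "smooth_on {0..} lam" and smooth_mu: "smooth_on {0..} mu"
    and lam_pos: "\<And>t. t \<ge> 0 \<Longrightarrow> lam t > 0"
    and ratio_pos: "\<And>t. t \<ge> 0 \<Longrightarrow> (A\<^sup>2 - 2 * c * t * (lam t)\<^sup>2) / (lam t + 2 * t * halfline_deriv lam t) > 0"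
    and lam_mu_pos: "\<And>t. t \<ge> 0 \<Longrightarrow> lam t + 2 * t * mu t > 0"
    and A_pos: "A > 0"
begin

text \<open>
  The rank one coefficients are built from these three functions. The quotient of Q and S is
  the ratio that is assumed to be positive.
\<close>

definition N where "N t = c * (lam t)^3 + A\<^sup>2 * halfline_deriv lam t"
definition Q where "Q t = A\<^sup>2 - 2 * c * t * (lam t)\<^sup>2"
definition S where "S t = lam t + 2 * t * halfline_deriv lam t"
definition a1 where "a1 t = A / lam t"
definition b1 where "b1 t = - (N t / (A * lam t * S t))"
definition a2 where "a2 t = lam t / A"
definition b2 where "b2 t = N t / (A * Q t)"
definition d1 where "d1 t = (- N t + mu t * Q t) / (A * S t)"
definition c2 where "c2 t = (lam t)\<^sup>2 / A"
definition d2 where "d2 t = (lam t * N t + mu t * A\<^sup>2 * S t) / (A * Q t)"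

text \<open>
  The ratio of Q and S is positive, so Q has no zero; as \<open>Q 0 = A\<^sup>2\<close>, the intermediate value
  theorem keeps it positive.
\<close>

lemma Q_pos: assumes t: "t \<ge> 0" shows "Q t > 0"
proof (rule ccontr)
  assume "\<not> Q t > 0"
  then have "Q t \<le> 0" by simp
  moreover have "Q 0 \<ge> 0" by (simp add: Q_def)
  moreover have "continuous_on {0..t} Q"
  proof -
    have "continuous_on {0..} lam" using smooth_lam unfolding smooth_on_def by (metis Ck_on.simps(1))
    then have "continuous_on {0..t} lam" by (rule continuous_on_subset) auto
    then show ?thesis unfolding Q_def by (intro continuous_intros)
  qed
  ultimately obtain s where "0 \<le> s" "Q s = 0"
    using IVT2'[of Q t 0 0] t by auto
  then show False using ratio_pos[of s] by (simp add: Q_def)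
qed

lemma S_pos: assumes t: "t \<ge> 0" shows "S t > 0"
  using ratio_pos[OF t] Q_pos[OF t] by (simp add: Q_def S_def zero_less_divide_iff)

lemma coefficient_pos:
  assumes t: "t \<ge> 0"
  shows "A \<noteq> 0" "lam t \<noteq> 0" "Q t \<noteq> 0" "S t \<noteq> 0"
  using A_pos lam_pos[OF t] Q_pos[OF t] S_pos[OF t] by auto

text \<open>
  The identities between the coefficients all come from this relation, which makes the values
  on p of the forms with coefficients (a1, b1) and (a2, b2) inverse to each other.
\<close>

lemma coefficient_relation: "A\<^sup>2 * S t - lam t * Q t = 2 * t * N t"
  by (simp add: N_def Q_def S_def algebra_simps power2_eq_square power3_eq_cube)

lemma a1_a2: "t \<ge> 0 \<Longrightarrow> a1 t * a2 t = 1"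
  using coefficient_pos[of t] by (simp add: a1_def a2_def)

text \<open>
  The value of the form with coefficients (a1, b1) in the direction of p.
\<close>

lemma a1_b1:
  assumes "t \<ge> 0" shows "a1 t + 2 * t * b1 t = Q t / (A * S t)"
proof -
  have "a1 t + 2 * t * b1 t = (A\<^sup>2 * S t - 2 * t * N t) / (A * lam t * S t)"
    using coefficient_pos[OF assms] by (simp add: a1_def b1_def field_simps power2_eq_square)
  also have "A\<^sup>2 * S t - 2 * t * N t = lam t * Q t" using coefficient_relation[of t] by simp
  finally show ?thesis using coefficient_pos[OF assms] by simp
qed

text \<open>
  The coefficient of the rank one term in the product of the forms with coefficients
  (a1, b1) and (a2, b2).
\<close>

lemma inverse_coefficient:
  assumes "t \<ge> 0" shows "a2 t * b1 t + a1 t * b2 t + 2 * t * b1 t * b2 t = 0"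
proof -
  have "a2 t * b1 t + a1 t * b2 t + 2 * t * b1 t * b2 t = a2 t * b1 t + (a1 t + 2 * t * b1 t) * b2 t"
    by (simp add: algebra_simps)
  also have "\<dots> = 0"
    unfolding a1_b1[OF assms] using coefficient_pos[OF assms]
    by (simp add: a2_def b1_def b2_def field_simps)
  finally show ?thesis .
qed

text \<open>
  The rank one coefficient of the vertical metric pulled back by the form with coefficients
  (a1, b1).
\<close>

lemma metric_coefficient:
  assumes "t \<ge> 0"
  shows "c2 t * (2 * a1 t * b1 t + 2 * t * (b1 t)\<^sup>2) + d2 t * (a1 t + 2 * t * b1 t)\<^sup>2 = d1 t"
proof -
  have "c2 t * (2 * a1 t * b1 t + 2 * t * (b1 t)\<^sup>2) + d2 t * (a1 t + 2 * t * b1 t)\<^sup>2 =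
      c2 t * (b1 t * (a1 t + (a1 t + 2 * t * b1 t))) + d2 t * (a1 t + 2 * t * b1 t)\<^sup>2"
    by (simp add: algebra_simps power2_eq_square)
  also have "\<dots> = d1 t"
    unfolding a1_b1[OF assms] using coefficient_pos[OF assms]
    by (simp add: a1_def b1_def c2_def d1_def d2_def field_simps power2_eq_square)
  finally show ?thesis .
qed

lemma c2_a1: "t \<ge> 0 \<Longrightarrow> c2 t * (a1 t)\<^sup>2 = A"
  using coefficient_pos[of t] by (simp add: c2_def a1_def field_simps power2_eq_square)

lemma metric_pos_horizontal:
  assumes "t \<ge> 0" shows "A + 2 * t * d1 t > 0"
proof -
  have "A + 2 * t * d1 t = (A\<^sup>2 * S t - 2 * t * N t + 2 * t * mu t * Q t) / (A * S t)"
    using coefficient_pos[OF assms] by (simp add: d1_def field_simps power2_eq_square)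
  also have "A\<^sup>2 * S t - 2 * t * N t + 2 * t * mu t * Q t = (lam t + 2 * t * mu t) * Q t"
    using coefficient_relation[of t] by (simp add: algebra_simps)
  finally show ?thesis
    using A_pos S_pos[OF assms] Q_pos[OF assms] lam_mu_pos[OF assms] by simp
qed

lemma c2_pos: "t \<ge> 0 \<Longrightarrow> c2 t > 0"
  using lam_pos[of t] A_pos by (simp add: c2_def)

lemma metric_pos_vertical:
  assumes "t \<ge> 0" shows "c2 t + 2 * t * d2 t > 0"
proof -
  have "c2 t + 2 * t * d2 t = (lam t * (lam t * Q t + 2 * t * N t) + 2 * t * mu t * A\<^sup>2 * S t) / (A * Q t)"
    using coefficient_pos[OF assms] by (simp add: c2_def d2_def field_simps power2_eq_square)
  also have "lam t * (lam t * Q t + 2 * t * N t) + 2 * t * mu t * A\<^sup>2 * S t = A\<^sup>2 * S t * (lam t + 2 * t * mu t)"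
  proof -
    have r: "lam t * Q t + 2 * t * N t = A\<^sup>2 * S t" using coefficient_relation[of t] by simp
    show ?thesis unfolding r by (simp add: algebra_simps)
  qed
  finally show ?thesis
    using A_pos S_pos[OF assms] Q_pos[OF assms] lam_mu_pos[OF assms] by simp
qed

lemma lam_differentiable: "t \<ge> 0 \<Longrightarrow> lam differentiable (at t within {0..})"
  by (rule smooth_halfline_differentiable[OF smooth_lam])

lemma a1_derivative:
  assumes t: "t \<ge> 0"
  shows "(a1 has_derivative (\<lambda>h. h * (- A * halfline_deriv lam t / (lam t)\<^sup>2))) (at t within {0..})"
proof -
  have "((\<lambda>t. A * inverse (lam t)) has_derivative
      (\<lambda>h. A * - (inverse (lam t) * (h * halfline_deriv lam t) * inverse (lam t)))) (at t within {0..})"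
    by (intro has_derivative_mult_right Deriv.has_derivative_inverse coefficient_pos(2)[OF t]
        halfline_has_derivative(1)[OF lam_differentiable[OF t] t])
  moreover have "(\<lambda>t. A * inverse (lam t)) = a1"
    by (simp add: a1_def fun_eq_iff divide_inverse)
  moreover have "(\<lambda>h. A * - (inverse (lam t) * (h * halfline_deriv lam t) * inverse (lam t)))
      = (\<lambda>h. h * (- A * halfline_deriv lam t / (lam t)\<^sup>2))"
    by (simp add: fun_eq_iff divide_inverse power2_eq_square mult_ac)
  ultimately show ?thesis by simp
qed

lemma b1_derivative:
  assumes t: "t \<ge> 0"
  obtains db where "(b1 has_derivative (\<lambda>h. h * db)) (at t within {0..})"
proof -
  have d: "lam differentiable (at t within {0..})" "halfline_deriv lam differentiable (at t within {0..})"
    using smooth_halfline_differentiable t smooth_lam smooth_halfline_deriv by blast+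
  have "b1 differentiable (at t within {0..})"
    unfolding b1_def N_def S_def
    using d coefficient_pos[OF t, unfolded S_def] by (auto intro!: derivative_intros)
  then show ?thesis using halfline_has_derivative(1)[OF _ t] that by blast
qed

text \<open>
  The coefficient of \<open>(p \<bullet> u) g v - (p \<bullet> v) g u\<close> in the antisymmetrised vertical derivatives of the form with
  coefficients (a1, b1); it has to match the curvature. The first factor is the derivative of
  \<open>a1 = A / \<lambda>\<close>.
\<close>

lemma integrability_coefficient:
  assumes t: "t \<ge> 0"
  shows "- A * halfline_deriv lam t / (lam t)\<^sup>2 * (a1 t + 2 * t * b1 t) - a1 t * b1 t = c"
proof -
  have "- A * halfline_deriv lam t / (lam t)\<^sup>2 * (Q t / (A * S t)) - a1 t * b1 t
      = (N t - halfline_deriv lam t * Q t) / ((lam t)\<^sup>2 * S t)"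
    using coefficient_pos[OF t] by (simp add: a1_def b1_def field_simps power2_eq_square)
  also have "N t - halfline_deriv lam t * Q t = c * ((lam t)\<^sup>2 * S t)"
    by (simp add: N_def Q_def S_def algebra_simps power2_eq_square power3_eq_cube)
  finally show ?thesis
    unfolding a1_b1[OF t] using coefficient_pos[OF t] by simp
qed

lemma smooth_coefficients:
  fixes e :: "'a::euclidean_space \<Rightarrow> real"
  assumes W: "open W" and e: "smooth_on W e" and pos: "\<And>y. y \<in> W \<Longrightarrow> e y \<ge> 0"
  shows "smooth_on W (\<lambda>y. a1 (e y))" "smooth_on W (\<lambda>y. b1 (e y))" "smooth_on W (\<lambda>y. a2 (e y))"
    "smooth_on W (\<lambda>y. b2 (e y))" "smooth_on W (\<lambda>y. c2 (e y))" "smooth_on W (\<lambda>y. d1 (e y))"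
    "smooth_on W (\<lambda>y. d2 (e y))"
proof -
  have l: "smooth_on W (\<lambda>y. lam (e y))" "smooth_on W (\<lambda>y. mu (e y))"
      "smooth_on W (\<lambda>y. halfline_deriv lam (e y))"
    using pos by (auto intro!: smooth_on_compose[OF W _ e] smooth_lam smooth_mu smooth_halfline_deriv)
  have nz: "A * lam (e y) * S (e y) \<noteq> 0" "A * Q (e y) \<noteq> 0" "A * S (e y) \<noteq> 0" "A \<noteq> 0" "lam (e y) \<noteq> 0"
    if "y \<in> W" for y
    using coefficient_pos[OF pos[OF that]] by auto
  note rules = smooth_on_mult smooth_on_add smooth_on_diff smooth_on_power smooth_on_const e l W
  have NQS: "smooth_on W (\<lambda>y. N (e y))" "smooth_on W (\<lambda>y. Q (e y))" "smooth_on W (\<lambda>y. S (e y))"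
    unfolding N_def Q_def S_def by (intro rules)+
  show "smooth_on W (\<lambda>y. a1 (e y))" "smooth_on W (\<lambda>y. b1 (e y))" "smooth_on W (\<lambda>y. a2 (e y))"
    "smooth_on W (\<lambda>y. b2 (e y))" "smooth_on W (\<lambda>y. c2 (e y))" "smooth_on W (\<lambda>y. d1 (e y))"
    "smooth_on W (\<lambda>y. d2 (e y))"
    unfolding a1_def b1_def a2_def b2_def c2_def d1_def d2_def
    by (intro rules NQS smooth_on_divide smooth_on_uminus nz; assumption)+
qed

end

section \<open>The Hermitian structure in a chart\<close>

text \<open>
  J and G are global fields that are known on the adapted frame of every chart; linearity
  extends these formulas to all tangent vectors.
\<close>

locale hermitian_data = cotangent M + natural_coefficients A c lam mu
  for M :: "('m, real^'n::finite) chart set" and A c lam mu +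
  fixes g :: "'m \<Rightarrow> ('m, real^'n) tvec \<Rightarrow> ('m, real^'n) tvec \<Rightarrow> real"
    and J :: "('m, 'n) cotangent_point \<Rightarrow> ('m, 'n) cotangent_tvec \<Rightarrow> ('m, 'n) cotangent_tvec"
    and G :: "('m, 'n) cotangent_point \<Rightarrow> ('m, 'n) cotangent_tvec \<Rightarrow> ('m, 'n) cotangent_tvec \<Rightarrow> real"
  assumes metric: "riemannian_metric M g"
    and curvature: "constant_sectional_curvature M g c"
    and J_endo: "endomorphism_field (cotangent_bundle M) J"
    and J_hor: "\<And>\<kappa> P i. \<kappa> \<in> M \<Longrightarrow> P \<in> chart_dom (tchart \<kappa>) \<Longrightarrow>
           J P (delta_dq M g \<kappa> P i) =
             (\<lambda>\<eta>. \<Sum>j\<in>UNIV. J1_coeff A c lam M g \<kappa> P i j *\<^sub>R d_dp M \<kappa> P j \<eta>)"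
    and J_vert: "\<And>\<kappa> P i. \<kappa> \<in> M \<Longrightarrow> P \<in> chart_dom (tchart \<kappa>) \<Longrightarrow>
           J P (d_dp M \<kappa> P i) =
             (\<lambda>\<eta>. - (\<Sum>j\<in>UNIV. J2_coeff A c lam M g \<kappa> P i j *\<^sub>R delta_dq M g \<kappa> P j \<eta>))"
    and G_sym: "symmetric_bilinear_field (cotangent_bundle M) G"
    and G_hor: "\<And>\<kappa> P i j. \<kappa> \<in> M \<Longrightarrow> P \<in> chart_dom (tchart \<kappa>) \<Longrightarrow>
           G P (delta_dq M g \<kappa> P i) (delta_dq M g \<kappa> P j) =
             c1_coeff A (energy_density M g \<kappa> P) * g_lower M g \<kappa> P i j
             + d1_coeff A c lam mu (energy_density M g \<kappa> P) * mom M \<kappa> P $ i * mom M \<kappa> P $ j"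
    and G_vert: "\<And>\<kappa> P i j. \<kappa> \<in> M \<Longrightarrow> P \<in> chart_dom (tchart \<kappa>) \<Longrightarrow>
           G P (d_dp M \<kappa> P i) (d_dp M \<kappa> P j) =
             c2_coeff A lam (energy_density M g \<kappa> P) * g_upper M g \<kappa> P i j
             + d2_coeff A c lam mu (energy_density M g \<kappa> P)
               * g_raised M g \<kappa> P i * g_raised M g \<kappa> P j"
    and G_mixed: "\<And>\<kappa> P i j. \<kappa> \<in> M \<Longrightarrow> P \<in> chart_dom (tchart \<kappa>) \<Longrightarrow>
           G P (d_dp M \<kappa> P i) (delta_dq M g \<kappa> P j) = 0"

lemma (in cotangent) metric_chart_at:
  assumes g: "riemannian_metric M g" and k: "\<kappa> \<in> M"
  shows "metric_chart M g \<kappa> (chart_img \<kappa>)"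
proof
  show "open (chart_img \<kappa>)" by (rule open_chart_img[OF k])
  show "smooth_on (chart_img \<kappa>) (\<lambda>y. metric_matrix M g \<kappa> y $ i $ j)" for i j
    using g k by (simp add: riemannian_metric_def metric_matrix_def)
  fix y assume y: "y \<in> chart_img \<kappa>"
  note c = chart_inv_charts_at[OF k y]
  have sb: "symmetric_bilinear_field M g" using g by (simp add: riemannian_metric_def)
  note b = symmetric_bilinear_coord[OF sb c]
  show "metric_matrix M g \<kappa> y $ i $ j = metric_matrix M g \<kappa> y $ j $ i" for i j
    using b(1) by (simp add: metric_matrix_def)
  have e: "metric_form M g \<kappa> y u v = g (chart_inv \<kappa> y) (coord_vec M \<kappa> (chart_inv \<kappa> y) u) (coord_vec M \<kappa> (chart_inv \<kappa> y) v)"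
    for u v
  proof -
    let ?g = "\<lambda>u v. g (chart_inv \<kappa> y) (coord_vec M \<kappa> (chart_inv \<kappa> y) u) (coord_vec M \<kappa> (chart_inv \<kappa> y) v)"
    have "?g u v = (\<Sum>i\<in>UNIV. u $ i *\<^sub>R ?g (axis i 1) v)"
      by (rule linear_axis_expansion[OF b(3)])
    also have "\<dots> = (\<Sum>i\<in>UNIV. u $ i *\<^sub>R (\<Sum>j\<in>UNIV. v $ j *\<^sub>R ?g (axis i 1) (axis j 1)))"
      by (rule sum.cong[OF refl], rule arg_cong, rule linear_axis_expansion[OF b(2)])
    finally show ?thesis
      by (simp add: metric_form_def metric_matrix_def sum_distrib_left mult_ac)
  qed
  show "0 < metric_form M g \<kappa> y u u" if u: "u \<noteq> 0" for u
  proof -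
    have "coord_vec M \<kappa> (chart_inv \<kappa> y) u \<noteq> (\<lambda>_. 0)"
      using coord_vec_self[OF c, of u] u by metis
    then show ?thesis
      unfolding e using g charts_at_points[OF c] coord_vec_tangent[OF c]
      by (simp add: riemannian_metric_def)
  qed
qed

abbreviation (in hermitian_data) CB where "CB \<equiv> cotangent_bundle M"

locale hermitian_chart =
  hermitian_data M A c lam mu g J G + constant_curvature_chart M g \<kappa> "chart_img \<kappa>" c
  for M :: "('m, real^'n::finite) chart set" and A c lam mu g J G \<kappa> +
  assumes chart: "\<kappa> \<in> M"

lemma (in hermitian_data) hermitian_chart_at:
  assumes k: "\<kappa> \<in> M"
  shows "hermitian_chart M A c lam mu g J G \<kappa>"
proof -
  interpret metric_chart M g \<kappa> "chart_img \<kappa>" by (rule metric_chart_at[OF metric k])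
  show ?thesis
    by unfold_locales (use curvature k in \<open>auto simp: constant_sectional_curvature_def\<close>)
qed

context hermitian_chart
begin

abbreviation T where "T \<equiv> tchart \<kappa>"
abbreviation pt where "pt \<equiv> chart_inv T"
abbreviation W where "W \<equiv> chart_img \<kappa> \<times> (UNIV :: (real^'n) set)"

lemma T_in: "T \<in> CB" using chart by (simp add: cotangent_bundle_def)

lemma T_img: "chart_img T = W" by (rule cotangent_chart_img[OF chart])

lemma
  assumes y: "fst y \<in> chart_img \<kappa>"
  shows pt_dom: "pt y \<in> chart_dom T" and T_pt: "chart_map T (pt y) = y"
    and pos_pt: "pos M \<kappa> (pt y) = fst y" and mom_pt: "mom M \<kappa> (pt y) = snd y"
    and T_at: "T \<in> charts_at CB (pt y)"
proof -
  have y': "y \<in> chart_img T" using y by (simp add: T_img mem_Times_iff)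
  show "pt y \<in> chart_dom T" by (rule TM.chart_inv_dom[OF y'])
  show p: "chart_map T (pt y) = y" by (rule TM.chart_map_chart_inv[OF y'])
  show "pos M \<kappa> (pt y) = fst y" "mom M \<kappa> (pt y) = snd y" by (simp_all add: pos_def mom_def p)
  show "T \<in> charts_at CB (pt y)" by (rule TM.chart_inv_charts_at[OF T_in y'])
qed

lemma Gi_sym: "q \<in> chart_img \<kappa> \<Longrightarrow> Gi q $ i $ j = Gi q $ j $ i"
  using inner_Gi_commute[of q "axis i 1" "axis j 1"]
  by (simp add: inner_axis' matrix_vector_mult_basis column_def)

lemma
  assumes y: "fst y \<in> chart_img \<kappa>"
  shows g_lower_pt: "g_lower M g \<kappa> (pt y) i j = Gm (fst y) $ i $ j"
    and g_upper_pt: "g_upper M g \<kappa> (pt y) i j = Gi (fst y) $ i $ j"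
    and g_raised_pt: "g_raised M g \<kappa> (pt y) i = raised y $ i"
    and energy_pt: "energy_density M g \<kappa> (pt y) = energy y"
proof -
  show "g_lower M g \<kappa> (pt y) i j = Gm (fst y) $ i $ j" by (simp add: g_lower_def pos_pt[OF y])
  show u: "g_upper M g \<kappa> (pt y) i j = Gi (fst y) $ i $ j" for i j by (simp add: g_upper_def pos_pt[OF y])
  show "g_raised M g \<kappa> (pt y) i = raised y $ i"
    by (simp add: g_raised_def u mom_pt[OF y] raised_def matrix_vector_mult_def Gi_sym[OF y, of i] mult.commute)
  show "energy_density M g \<kappa> (pt y) = energy y"
    by (simp add: energy_density_def u mom_pt[OF y] raised_def energy_def matrix_vector_mult_def
        inner_vec_def sum_distrib_left mult_ac)
qed

lemma hor_axis: "hor y (axis i 1) = (axis i 1, \<chi> h. \<Sum>k\<in>UNIV. snd y $ k * \<Gamma> k i h (fst y))"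
proof -
  have "chr (fst y) (snd y) (axis i 1) $ h = (\<Sum>j\<in>UNIV. (\<Sum>k\<in>UNIV. snd y $ k * \<Gamma> k j h (fst y)) * axis i 1 $ j)" for h
    by (simp add: chr_def sum_distrib_right)
  then show ?thesis by (simp only: sum_axis hor_def vec_eq_iff prod_eq_iff fst_conv snd_conv vec_lambda_beta) simp
qed

lemma linear_hor: "linear (hor y)"
  by (rule linearI)
     (simp_all add: hor_def linear_add[OF linear_chr_vector] linear_cmul[OF linear_chr_vector])

lemma delta_pt:
  assumes y: "fst y \<in> chart_img \<kappa>"
  shows "delta_dq M g \<kappa> (pt y) i T = hor y (axis i 1)"
    and "delta_dq M g \<kappa> (pt y) i = coord_vec CB T (pt y) (hor y (axis i 1))"
proof -
  show 1: "delta_dq M g \<kappa> (pt y) i T = hor y (axis i 1)"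
    by (simp add: frame_in_coordinates(3)[OF chart pt_dom[OF y]] pos_pt[OF y] mom_pt[OF y] hor_axis)
  show "delta_dq M g \<kappa> (pt y) i = coord_vec CB T (pt y) (hor y (axis i 1))"
    using TM.tangent_eq_coord_vec[OF T_at[OF y] frame_tangent(2)[OF chart pt_dom[OF y], of g i]]
    by (simp add: 1)
qed

lemma dp_pt: "d_dp M \<kappa> (pt y) i = coord_vec CB T (pt y) (0, axis i 1)"
  by (simp add: d_dp_def)

subsection \<open>The almost complex structure\<close>

abbreviation L where "L \<equiv> local_endo CB J T"

definition Bv where "Bv y u = a1 (energy y) *\<^sub>R (Gm (fst y) *v u) + (b1 (energy y) * (snd y \<bullet> u)) *\<^sub>R snd y"
definition Cv where "Cv y w = a2 (energy y) *\<^sub>R (Gi (fst y) *v w) + (b2 (energy y) * (raised y \<bullet> w)) *\<^sub>R raised y"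

lemma linear_L: "fst y \<in> chart_img \<kappa> \<Longrightarrow> linear (L y)"
  by (rule TM.linear_local_endo[OF J_endo T_in]) (simp add: T_img mem_Times_iff)

lemma linear_Bv: "linear (Bv y)"
  by (rule linearI) (simp_all add: Bv_def vec_eq_iff algebra_simps matrix_vector_right_distrib
      matrix_vector_mult_scaleR inner_add_right)

lemma linear_Cv: "linear (Cv y)"
  by (rule linearI) (simp_all add: Cv_def vec_eq_iff algebra_simps matrix_vector_right_distrib
      matrix_vector_mult_scaleR inner_add_right)

lemma L_hor:
  assumes y: "fst y \<in> chart_img \<kappa>"
  shows "L y (hor y u) = (0, Bv y u)"
proof (rule linear_eq_on_axes[where f="\<lambda>u. L y (hor y u)" and h="\<lambda>u. (0, Bv y u)"])
  show "linear (\<lambda>u. L y (hor y u))"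
    using linear_compose[OF linear_hor linear_L[OF y]] by (simp add: o_def)
  show "linear (\<lambda>u. (0, Bv y u))"
    by (rule linearI) (simp_all add: linear_add[OF linear_Bv] linear_cmul[OF linear_Bv])
  fix i
  note P = pt_dom[OF y]
  have "L y (hor y (axis i 1)) = J (pt y) (delta_dq M g \<kappa> (pt y) i) T"
    using TM.endomorphism_field_chart[OF J_endo T_at[OF y] frame_tangent(2)[OF chart P, of g i]]
    by (simp add: T_pt[OF y] delta_pt(1)[OF y])
  also have "\<dots> = (\<Sum>j\<in>UNIV. J1_coeff A c lam M g \<kappa> (pt y) i j *\<^sub>R (0, axis j 1))"
    by (simp add: J_hor[OF chart P] frame_in_coordinates(2)[OF chart P])
  also have "\<dots> = (0, \<chi> j. J1_coeff A c lam M g \<kappa> (pt y) i j)"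
    by (simp add: prod_eq_iff fst_sum snd_sum vec_eq_iff axis_def if_distrib cong: if_cong)
  also have "(\<chi> j. J1_coeff A c lam M g \<kappa> (pt y) i j) = Bv y (axis i 1)"
    by (simp add: vec_eq_iff J1_coeff_def Let_def energy_pt[OF y] g_lower_pt[OF y] mom_pt[OF y]
        Bv_def a1_def b1_def N_def S_def matrix_vector_mult_basis column_def metric_sym[OF y, of i] inner_axis)
  finally show "L y (hor y (axis i 1)) = (0, Bv y (axis i 1))" .
qed

lemma L_vert:
  assumes y: "fst y \<in> chart_img \<kappa>"
  shows "L y (0, w) = - hor y (Cv y w)"
proof (rule linear_eq_on_axes[where f="\<lambda>w. L y (0, w)" and h="\<lambda>w. - hor y (Cv y w)"])
  show "linear (\<lambda>w. L y (0, w))"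
    by (rule linearI) (use linear_add[OF linear_L[OF y], of "(0, _)" "(0, _)"]
        linear_cmul[OF linear_L[OF y], of _ "(0, _)"] in auto)
  show "linear (\<lambda>w. - hor y (Cv y w))"
    by (rule linearI) (simp_all add: linear_add[OF linear_Cv] linear_cmul[OF linear_Cv]
        linear_add[OF linear_hor] linear_cmul[OF linear_hor])
  fix i
  note P = pt_dom[OF y]
  have "L y (0, axis i 1) = J (pt y) (d_dp M \<kappa> (pt y) i) T"
    using TM.endomorphism_field_chart[OF J_endo T_at[OF y] frame_tangent(1)[OF chart P, of i]]
    by (simp add: T_pt[OF y] frame_in_coordinates(2)[OF chart P])
  also have "\<dots> = - (\<Sum>j\<in>UNIV. J2_coeff A c lam M g \<kappa> (pt y) i j *\<^sub>R hor y (axis j 1))"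
    by (simp add: J_vert[OF chart P] delta_pt(1)[OF y])
  also have "(\<Sum>j\<in>UNIV. J2_coeff A c lam M g \<kappa> (pt y) i j *\<^sub>R hor y (axis j 1)) =
      hor y (\<chi> j. J2_coeff A c lam M g \<kappa> (pt y) i j)"
    unfolding linear_axis_expansion[OF linear_hor, of y "\<chi> j. J2_coeff A c lam M g \<kappa> (pt y) i j"] by simp
  also have "(\<chi> j. J2_coeff A c lam M g \<kappa> (pt y) i j) = Cv y (axis i 1)"
    by (simp add: vec_eq_iff J2_coeff_def Let_def energy_pt[OF y] g_upper_pt[OF y] g_raised_pt[OF y]
        Cv_def a2_def b2_def N_def Q_def matrix_vector_mult_basis column_def Gi_sym[OF y, of i] inner_axis)
  finally show "L y (0, axis i 1) = - hor y (Cv y (axis i 1))" .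
qed

definition vert where "vert y w = snd w - chr (fst y) (snd y) (fst w)"

lemma hor_vert: "w = hor y (fst w) + (0, vert y w)"
  by (simp add: hor_def vert_def prod_eq_iff)

text \<open>
  Explicit form of J in the chart, from which its smoothness can be read off.
\<close>

lemma L_formula:
  assumes y: "fst y \<in> chart_img \<kappa>"
  shows "L y w = (0, Bv y (fst w)) - hor y (Cv y (vert y w))"
  using linear_add[OF linear_L[OF y], of "hor y (fst w)" "(0, vert y w)"] hor_vert[of w y]
  by (simp add: L_hor[OF y] L_vert[OF y])

lemma Gi_momentum: "Gi (fst y) *v snd y = raised y" by (simp add: raised_def)

text \<open>
  Both forms are a multiple of the metric or its inverse plus a rank one term in p or r, so the
  product only involves the two coefficient identities.
\<close>

lemma Cv_Bv:
  assumes y: "fst y \<in> chart_img \<kappa>"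
  shows "Cv y (Bv y u) = u"
proof -
  let ?t = "energy y"
  have t: "?t \<ge> 0" by (rule energy_nonneg[OF y])
  have "Cv y (Bv y u) = (a1 ?t * a2 ?t) *\<^sub>R u
      + ((a2 ?t * b1 ?t + a1 ?t * b2 ?t + 2 * ?t * b1 ?t * b2 ?t) * (snd y \<bullet> u)) *\<^sub>R raised y"
    unfolding Cv_def Bv_def inner_add_right inner_scaleR_right raised_inner_metric[OF y]
      inner_commute[of "raised y" "snd y"] inner_raised[of y]
    by (simp add: matrix_vector_right_distrib matrix_vector_mult_scaleR Gi_Gm[OF y] Gi_momentum vec_eq_iff algebra_simps)
  then show ?thesis by (simp add: a1_a2[OF t] inverse_coefficient[OF t])
qed

lemma Bv_Cv:
  assumes y: "fst y \<in> chart_img \<kappa>"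
  shows "Bv y (Cv y w) = w"
proof -
  have "Bv y u = 0 \<longrightarrow> u = 0" for u
    using Cv_Bv[OF y, of u] linear_0[OF linear_Cv] by metis
  then have "surj (Bv y)"
    using linear_injective_imp_surjective[OF linear_Bv] linear_injective_0[OF linear_Bv] by blast
  then obtain u where "w = Bv y u" by (metis surjD)
  then show ?thesis by (simp add: Cv_Bv[OF y])
qed

lemma L_squared:
  assumes y: "fst y \<in> chart_img \<kappa>"
  shows "L y (L y w) = - w"
  unfolding L_formula[OF y, of w] linear_diff[OF linear_L[OF y]] L_hor[OF y] L_vert[OF y] Bv_Cv[OF y] Cv_Bv[OF y]
  by (simp add: hor_def vert_def prod_eq_iff)

lemma smooth_vert: "smooth_on W (\<lambda>y. vert y w)"
proof -
  have "smooth_on W (\<lambda>y. chr (fst y) (snd y) (fst w))"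
    by (rule smooth_on_linear_family[OF open_chart_bundle linear_chr_covector smooth_on_bundle[OF smooth_chr] smooth_momentum])
  then show ?thesis
    unfolding vert_def by (intro smooth_on_diff smooth_on_const open_chart_bundle)
qed

lemma energy_nonneg_W: "y \<in> W \<Longrightarrow> energy y \<ge> 0"
  by (rule energy_nonneg) auto

lemmas smooth_coeffs = smooth_coefficients[OF open_chart_bundle smooth_energy energy_nonneg_W]

lemma smooth_Gi_vec: "smooth_on (chart_img \<kappa>) (\<lambda>y. Gi y *v u)"
  unfolding matrix_vector_mult_def
  by (intro smooth_on_vec_lambda smooth_on_sum smooth_on_mult smooth_on_const smooth_Gi open_U)

lemma smooth_L: "smooth_on W (\<lambda>y. L y w)"
proof -
  note sm = open_chart_bundle smooth_coeffs smooth_momentum smooth_raised smooth_on_const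
    smooth_on_scaleR smooth_on_add smooth_on_diff smooth_on_mult smooth_on_inner smooth_vert
  have B: "smooth_on W (\<lambda>y. Bv y u)" for u
    unfolding Bv_def by (intro sm smooth_on_bundle[OF smooth_Gm_vec])
  have C: "smooth_on W (\<lambda>y. Cv y (vert y w))"
  proof -
    have "smooth_on W (\<lambda>y. Gi (fst y) *v vert y w)"
      by (rule smooth_on_linear_family[OF open_chart_bundle matrix_vector_mul_linear
            smooth_on_bundle[OF smooth_Gi_vec] smooth_vert])
    then show ?thesis unfolding Cv_def by (intro sm)
  qed
  have h: "smooth_on W (\<lambda>y. chr (fst y) (snd y) u)" for u
    by (rule smooth_on_linear_family[OF open_chart_bundle linear_chr_covector smooth_on_bundle[OF smooth_chr] smooth_momentum])
  have "smooth_on W (\<lambda>y. chr (fst y) (snd y) (Cv y (vert y w)))"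
    by (rule smooth_on_linear_family[OF open_chart_bundle linear_chr_vector h C])
  then have "smooth_on W (\<lambda>y. (0, Bv y (fst w)) - hor y (Cv y (vert y w)))"
    unfolding hor_def by (intro sm smooth_on_Pair B C)
  then show ?thesis
    by (rule smooth_on_eqI) (auto intro: L_formula)
qed

lemma L_integrable:
  assumes y: "fst y \<in> chart_img \<kappa>"
  shows "nijenhuis_local L y u v = 0"
proof -
  have yW: "y \<in> W" using y by (simp add: mem_Times_iff)
  have t: "energy y \<ge> 0" by (rule energy_nonneg[OF y])
  obtain db where db: "(b1 has_derivative (\<lambda>h. h * db)) (at (energy y) within {0..})"
    by (rule b1_derivative[OF t])
  note chain = halfline_chain[OF _ energy_derivative[OF y] open_chart_bundle yW energy_nonneg_W]
  show ?thesis
    by (rule integrable_in_chart[OF y linear_L smooth_on_differentiable[OF open_chart_bundle smooth_L yW]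
          L_hor[unfolded Bv_def] L_squared chain[OF a1_derivative[OF t]] chain[OF db]
          integrability_coefficient[OF t]])
qed

subsection \<open>The metric\<close>

definition H where "H y v w = G (pt y) (coord_vec CB T (pt y) v) (coord_vec CB T (pt y) w)"

definition G1 where "G1 y u v = A * (u \<bullet> (Gm (fst y) *v v)) + d1 (energy y) * (snd y \<bullet> u) * (snd y \<bullet> v)"
definition G2 where "G2 y u v = c2 (energy y) * (u \<bullet> (Gi (fst y) *v v)) + d2 (energy y) * (raised y \<bullet> u) * (raised y \<bullet> v)"

lemma
  assumes y: "fst y \<in> chart_img \<kappa>"
  shows H_sym: "H y v w = H y w v" and linear_H: "linear (H y v)" and linear_H': "linear (\<lambda>v. H y v w)"
  unfolding H_def
  by (rule TM.symmetric_bilinear_coord[OF G_sym T_at[OF y]])+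

lemma linear_G1: "linear (G1 y u)" "linear (\<lambda>u. G1 y u v)"
  by (auto intro!: linearI simp: G1_def algebra_simps matrix_vector_right_distrib matrix_vector_mult_scaleR inner_add_right inner_add_left)

lemma linear_G2: "linear (G2 y u)" "linear (\<lambda>u. G2 y u v)"
  by (auto intro!: linearI simp: G2_def algebra_simps matrix_vector_right_distrib matrix_vector_mult_scaleR inner_add_right inner_add_left)

lemma linear_vertical: "linear (\<lambda>w::real^'n. (0 :: real^'n, w))"
  by (rule linearI) auto

lemma H_frame:
  assumes y: "fst y \<in> chart_img \<kappa>"
  shows "H y (hor y u) (hor y v) = G1 y u v" and "H y (0, w) (0, z) = G2 y w z" and "H y (0, w) (hor y u) = 0"
proof -
  note P = pt_dom[OF y]
  note lh = linear_compose[OF linear_hor linear_H[OF y], unfolded o_def]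
    linear_compose[OF linear_hor linear_H'[OF y], unfolded o_def]
    linear_compose[OF linear_vertical linear_H[OF y], unfolded o_def]
    linear_compose[OF linear_vertical linear_H'[OF y], unfolded o_def]
  show "H y (hor y u) (hor y v) = G1 y u v"
  proof (rule bilinear_eq_on_axes[OF lh(1) lh(2) linear_G1])
    fix i j show "H y (hor y (axis i 1)) (hor y (axis j 1)) = G1 y (axis i 1) (axis j 1)"
      using G_hor[OF chart P, of i j]
      by (simp add: H_def delta_pt(2)[OF y] G1_def c1_coeff_def d1_coeff_def Let_def energy_pt[OF y] g_lower_pt[OF y]
          mom_pt[OF y] d1_def N_def Q_def S_def matrix_vector_mult_basis column_def inner_axis inner_axis')
  qed
  show "H y (0, w) (0, z) = G2 y w z"
  proof (rule bilinear_eq_on_axes[OF lh(3) lh(4) linear_G2])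
    fix i j show "H y (0, axis i 1) (0, axis j 1) = G2 y (axis i 1) (axis j 1)"
      using G_vert[OF chart P, of i j]
      by (simp add: H_def dp_pt G2_def c2_coeff_def d2_coeff_def Let_def energy_pt[OF y] g_upper_pt[OF y]
          g_raised_pt[OF y] c2_def d2_def N_def Q_def S_def matrix_vector_mult_basis column_def inner_axis inner_axis')
  qed
  have "linear (\<lambda>v::real^'n. 0::real)" by (rule linearI) auto
  from bilinear_eq_on_axes[OF lh(1) lh(4) this this] show "H y (0, w) (hor y u) = 0"
    using G_mixed[OF chart P] by (simp add: H_def delta_pt(2)[OF y] dp_pt)
qed

lemma H_formula:
  assumes y: "fst y \<in> chart_img \<kappa>"
  shows "H y v w = G1 y (fst v) (fst w) + G2 y (vert y v) (vert y w)"
proof -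
  have "H y v w = H y (hor y (fst v) + (0, vert y v)) (hor y (fst w) + (0, vert y w))"
    unfolding hor_vert[symmetric] ..
  also have "\<dots> = G1 y (fst v) (fst w) + G2 y (vert y v) (vert y w)"
    unfolding linear_add[OF linear_H[OF y]] linear_add[OF linear_H'[OF y]] H_frame[OF y]
      H_sym[OF y, of "hor y _" "(0, _)"] by simp
  finally show ?thesis .
qed

lemma cauchy_momentum:
  assumes y: "fst y \<in> chart_img \<kappa>"
  shows "(snd y \<bullet> u)\<^sup>2 \<le> 2 * energy y * (u \<bullet> (Gm (fst y) *v u))"
proof (cases "u = 0")
  case False
  let ?m = "\<lambda>u v. u \<bullet> (Gm (fst y) *v v)"
  define X where "X = ?m u u"
  have X: "X > 0" unfolding X_def by (rule metric_positive[OF y False])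
  define w where "w = X *\<^sub>R raised y - (snd y \<bullet> u) *\<^sub>R u"
  have "0 \<le> ?m w w"
    using metric_positive[OF y, of w] by (cases "w = 0") auto
  also have "?m w w = X * (2 * energy y * X - (snd y \<bullet> u)\<^sup>2)"
  proof -
    have "?m (raised y) (raised y) = 2 * energy y"
      by (simp add: raised_inner_metric[OF y] inner_raised[of y])
    moreover have "?m (raised y) u = snd y \<bullet> u" "?m u (raised y) = snd y \<bullet> u"
      using inner_metric_commute[OF y, of u] by (simp_all add: raised_inner_metric[OF y])
    ultimately show ?thesis
      by (simp add: w_def X_def[symmetric] matrix_vector_mult_diff_distrib matrix_vector_mult_scaleR
          inner_diff_left inner_diff_right algebra_simps power2_eq_square)
  qed
  finally show ?thesis using X by (simp add: zero_le_mult_iff X_def)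
qed simp

text \<open>
  A rank one perturbation of a positive form is positive if it is so in the direction of p,
  where the Cauchy inequality is an equality.
\<close>

lemma positive_perturbation:
  fixes X s C D t :: real
  assumes "X > 0" "s\<^sup>2 \<le> 2 * t * X" "C > 0" "C + 2 * t * D > 0"
  shows "C * X + D * s * s > 0"
proof (cases "D \<ge> 0")
  case True
  then show ?thesis using assms(1,3) by (simp add: add_pos_nonneg mult.assoc)
next
  case False
  then have "D * (2 * t * X) \<le> D * s\<^sup>2" using assms(2) by (intro mult_left_mono_neg) auto
  moreover have "(C + 2 * t * D) * X > 0" using assms by simp
  ultimately show ?thesis by (simp add: algebra_simps power2_eq_square)
qed

lemma G1_positive:
  assumes y: "fst y \<in> chart_img \<kappa>" and u: "u \<noteq> 0"
  shows "G1 y u u > 0"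
  unfolding G1_def
  by (rule positive_perturbation[OF metric_positive[OF y u] cauchy_momentum[OF y] A_pos
        metric_pos_horizontal[OF energy_nonneg[OF y]]])

text \<open>
  The Cauchy inequality for the inverse metric is the one for the metric with \<open>Gi w\<close> in place
  of u.
\<close>

lemma G2_positive:
  assumes y: "fst y \<in> chart_img \<kappa>" and w: "w \<noteq> 0"
  shows "G2 y w w > 0"
proof -
  have "(raised y \<bullet> w)\<^sup>2 \<le> 2 * energy y * (w \<bullet> (Gi (fst y) *v w))"
    using cauchy_momentum[OF y, of "Gi (fst y) *v w"] inner_Gi_commute[OF y, of "snd y" w]
    by (simp add: Gm_Gi[OF y] raised_def inner_commute)
  from positive_perturbation[OF Gi_positive[OF y w] this c2_pos metric_pos_vertical]
  show ?thesis unfolding G2_def using energy_nonneg[OF y] by blast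
qed

lemma H_positive:
  assumes y: "fst y \<in> chart_img \<kappa>" and w: "w \<noteq> 0"
  shows "H y w w > 0"
proof -
  have z: "G1 y 0 0 = 0" "G2 y 0 0 = 0"
    using linear_0[OF linear_G1(1)] linear_0[OF linear_G2(1)] by blast+
  have "w = 0" if "fst w = 0" "vert y w = 0"
    using hor_vert[of w y] unfolding that linear_0[OF linear_hor] by (simp flip: zero_prod_def)
  with w have "fst w \<noteq> 0 \<or> vert y w \<noteq> 0" by blast
  then show ?thesis
    unfolding H_formula[OF y]
    using G1_positive[OF y, of "fst w"] G2_positive[OF y, of "vert y w"] z
    by (cases "fst w = 0"; cases "vert y w = 0") auto
qed

lemma smooth_H: "smooth_on W (\<lambda>y. H y v w)"
proof -
  note sm = open_chart_bundle smooth_coeffs smooth_momentum smooth_raised smooth_on_const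
    smooth_on_add smooth_on_mult smooth_on_inner smooth_vert
  have "smooth_on W (\<lambda>y. Gi (fst y) *v vert y w)"
    by (rule smooth_on_linear_family[OF open_chart_bundle matrix_vector_mul_linear
          smooth_on_bundle[OF smooth_Gi_vec] smooth_vert])
  then have "smooth_on W (\<lambda>y. G1 y (fst v) (fst w) + G2 y (vert y v) (vert y w))"
    unfolding G1_def G2_def by (intro sm smooth_on_bundle[OF smooth_Gm_vec])
  then show ?thesis by (rule smooth_on_eqI) (auto intro: H_formula)
qed

text \<open>
  J maps horizontal lifts isometrically onto vertical vectors.
\<close>

lemma G2_Bv:
  assumes y: "fst y \<in> chart_img \<kappa>"
  shows "G2 y (Bv y u) (Bv y v) = G1 y u v"
proof -
  let ?t = "energy y"
  have t: "?t \<ge> 0" by (rule energy_nonneg[OF y])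
  let ?m = "u \<bullet> (Gm (fst y) *v v)" and ?pu = "snd y \<bullet> u" and ?pv = "snd y \<bullet> v"
  have Bi: "Bv y u \<bullet> x = a1 ?t * (x \<bullet> (Gm (fst y) *v u)) + b1 ?t * (snd y \<bullet> u) * (snd y \<bullet> x)" for u x
    by (simp add: Bv_def inner_add_left inner_add_right inner_commute)
  have rB: "raised y \<bullet> Bv y u = (a1 ?t + 2 * ?t * b1 ?t) * (snd y \<bullet> u)" for u
    unfolding Bv_def inner_add_right inner_scaleR_right raised_inner_metric[OF y]
      inner_commute[of "raised y" "snd y"] inner_raised[of y]
    by (simp add: algebra_simps)
  have GiB: "Gi (fst y) *v Bv y v = a1 ?t *\<^sub>R v + (b1 ?t * ?pv) *\<^sub>R raised y"
    by (simp add: Bv_def matrix_vector_right_distrib matrix_vector_mult_scaleR Gi_Gm[OF y] Gi_momentum)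
  have "Bv y u \<bullet> (Gi (fst y) *v Bv y v) = a1 ?t * (Bv y u \<bullet> v) + b1 ?t * ?pv * (raised y \<bullet> Bv y u)"
    unfolding GiB by (simp add: inner_add_right inner_commute)
  also have "\<dots> = (a1 ?t)\<^sup>2 * ?m + (2 * a1 ?t * b1 ?t + 2 * ?t * (b1 ?t)\<^sup>2) * ?pu * ?pv"
    unfolding Bi rB using inner_metric_commute[OF y, of v u] by (simp add: algebra_simps power2_eq_square)
  finally have 1: "Bv y u \<bullet> (Gi (fst y) *v Bv y v)
      = (a1 ?t)\<^sup>2 * ?m + (2 * a1 ?t * b1 ?t + 2 * ?t * (b1 ?t)\<^sup>2) * ?pu * ?pv" .
  have "G2 y (Bv y u) (Bv y v) = (c2 ?t * (a1 ?t)\<^sup>2) * ?m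
      + (c2 ?t * (2 * a1 ?t * b1 ?t + 2 * ?t * (b1 ?t)\<^sup>2) + d2 ?t * (a1 ?t + 2 * ?t * b1 ?t)\<^sup>2) * ?pu * ?pv"
    unfolding G2_def 1 rB by (simp add: algebra_simps power2_eq_square)
  also have "\<dots> = G1 y u v"
    unfolding c2_a1[OF t] metric_coefficient[OF t] G1_def ..
  finally show ?thesis .
qed

lemma H_hermitian:
  assumes y: "fst y \<in> chart_img \<kappa>"
  shows "H y (L y v) (L y w) = H y v w"
proof -
  have 1: "fst (L y v) = - Cv y (vert y v)" "vert y (L y v) = Bv y (fst v)" for v
    unfolding L_formula[OF y]
    by (simp_all add: hor_def vert_def linear_neg[OF linear_chr_vector])
  have "G1 y (- Cv y a) (- Cv y b) = G2 y a b" for a b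
    using G2_Bv[OF y, of "Cv y a" "Cv y b"]
    by (simp add: Bv_Cv[OF y] linear_neg[OF linear_G1(1)] linear_neg[OF linear_G1(2)])
  then show ?thesis
    unfolding H_formula[OF y] 1 G2_Bv[OF y] by simp
qed

end

section \<open>The global statement\<close>

context hermitian_data
begin

lemma bundle_chart:
  assumes "\<eta> \<in> CB"
  obtains \<kappa> where "\<kappa> \<in> M" "\<eta> = tchart \<kappa>"
  using assms by (auto simp: cotangent_bundle_def)

lemma smooth_J: "\<eta> \<in> CB \<Longrightarrow> smooth_on (chart_img \<eta>) (\<lambda>y. local_endo (CB) J \<eta> y b)"
proof -
  assume "\<eta> \<in> CB"
  then obtain \<kappa> where k: "\<kappa> \<in> M" "\<eta> = tchart \<kappa>" by (rule bundle_chart)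
  interpret hermitian_chart M A c lam mu g J G \<kappa> by (rule hermitian_chart_at[OF k(1)])
  show ?thesis using smooth_L T_img k(2) by simp
qed

lemma J_squared_chart:
  "\<eta> \<in> CB \<Longrightarrow> y \<in> chart_img \<eta> \<Longrightarrow>
    local_endo (CB) J \<eta> y (local_endo (CB) J \<eta> y b) = - b"
proof -
  assume "\<eta> \<in> CB" and y: "y \<in> chart_img \<eta>"
  then obtain \<kappa> where k: "\<kappa> \<in> M" "\<eta> = tchart \<kappa>" by (meson bundle_chart)
  interpret hermitian_chart M A c lam mu g J G \<kappa> by (rule hermitian_chart_at[OF k(1)])
  have "fst y \<in> chart_img \<kappa>" using y T_img k(2) by (simp add: mem_Times_iff)
  from L_squared[OF this] show ?thesis using k(2) by simp
qed

lemma point_chart: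
  assumes "P \<in> points (CB)"
  obtains \<kappa> where "\<kappa> \<in> M" "tchart \<kappa> \<in> charts_at (CB) P"
  using assms by (auto simp: points_def cotangent_bundle_def charts_at_def)

lemma almost_complex: "almost_complex_structure (CB) J"
  unfolding almost_complex_structure_def
proof (intro conjI ballI allI J_endo)
  show "smooth_on (chart_img \<eta>) (\<lambda>y. J (chart_inv \<eta> y) (coord_vec (CB) \<eta> (chart_inv \<eta> y) b) \<eta>)"
    if "\<eta> \<in> CB" for \<eta> b
    using smooth_J[OF that, of b] by (simp add: local_endo_def)
  fix P v assume P: "P \<in> points (CB)" and v: "v \<in> tangent_space (CB) P"
  obtain \<kappa> where k: "\<kappa> \<in> M" and c: "tchart \<kappa> \<in> charts_at (CB) P"
    by (rule point_chart[OF P])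
  let ?T = "tchart \<kappa>"
  have Jt: "J P v \<in> tangent_space (CB) P" if "v \<in> tangent_space (CB) P" for v
    using J_endo P that by (simp add: endomorphism_field_def)
  have neg: "(\<lambda>\<kappa>. - v \<kappa>) \<in> tangent_space (CB) P"
    using TM.tangent_combination[OF v v, of "- 1" 0] by simp
  show "J P (J P v) = (\<lambda>\<kappa>. - v \<kappa>)"
  proof (rule TM.tangent_eqI[OF c Jt[OF Jt[OF v]] neg])
    have T: "?T \<in> CB" "chart_map ?T P \<in> chart_img ?T"
      using c by (auto simp: charts_at_def chart_img_def)
    show "J P (J P v) ?T = - v ?T"
      unfolding TM.endomorphism_field_chart[OF J_endo c Jt[OF v]] TM.endomorphism_field_chart[OF J_endo c v]
      by (rule J_squared_chart[OF T])
  qed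
qed

lemma integrable: "integrable_acs (CB) J"
  unfolding integrable_acs_def
proof (intro conjI allI impI ballI almost_complex)
  fix X Y P
  assume X: "vector_field (CB) X" and Y: "vector_field (CB) Y"
    and P: "P \<in> points (CB)"
  have JX: "vector_field (CB) (\<lambda>z. J z (X z))" and JY: "vector_field (CB) (\<lambda>z. J z (Y z))"
    by (rule TM.vector_field_endo[OF J_endo smooth_J X], assumption)
       (rule TM.vector_field_endo[OF J_endo smooth_J Y], assumption)
  have Jt: "J P v \<in> tangent_space (CB) P" if "v \<in> tangent_space (CB) P" for v
    using J_endo P that by (simp add: endomorphism_field_def)
  show "nijenhuis (CB) J X Y P = (\<lambda>_. 0)"
  proof
    fix \<eta>
    show "nijenhuis (CB) J X Y P \<eta> = 0"
    proof (cases "\<eta> \<in> charts_at (CB) P")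
      case True
      then have "\<eta> \<in> CB" by (simp add: charts_at_def)
      then obtain \<kappa> where k: "\<kappa> \<in> M" "\<eta> = tchart \<kappa>" by (rule bundle_chart)
      interpret hermitian_chart M A c lam mu g J G \<kappa> by (rule hermitian_chart_at[OF k(1)])
      have "chart_map \<eta> P \<in> chart_img \<eta>" using True by (auto simp: charts_at_def chart_img_def)
      then have "fst (chart_map \<eta> P) \<in> chart_img \<kappa>" using T_img k(2) by (simp add: mem_Times_iff)
      from L_integrable[OF this] k(2) show ?thesis
        by (subst TM.nijenhuis_chart[OF J_endo smooth_J J_squared_chart X Y True]) auto
    next
      case False
      then show ?thesis
        using TM.tangent_outside[OF Jt[OF TM.lie_bracket_tangent[OF JX Y P]] False]
          TM.tangent_outside[OF Jt[OF TM.lie_bracket_tangent[OF X JY P]] False]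
        by (simp add: nijenhuis_def lie_bracket_def)
    qed
  qed
qed

lemma G_chart:
  assumes k: "\<kappa> \<in> M" and c: "tchart \<kappa> \<in> charts_at (CB) P"
    and u: "u \<in> tangent_space (CB) P" and v: "v \<in> tangent_space (CB) P"
  shows "G P u v = hermitian_chart.H M G \<kappa> (chart_map (tchart \<kappa>) P)
      (u (tchart \<kappa>)) (v (tchart \<kappa>))"
proof -
  interpret hermitian_chart M A c lam mu g J G \<kappa> by (rule hermitian_chart_at[OF k])
  have "pt (chart_map T P) = P"
    using TM.chart_inv_chart_map[OF T_in] c by (simp add: charts_at_def)
  then show ?thesis
    unfolding H_def by (simp add: TM.tangent_eq_coord_vec[OF c u] TM.tangent_eq_coord_vec[OF c v])
qed

lemma riemannian: "riemannian_metric (CB) G"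
  unfolding riemannian_metric_def
proof (intro conjI ballI impI allI G_sym)
  fix P u assume P: "P \<in> points (CB)" and u: "u \<in> tangent_space (CB) P"
    and nz: "u \<noteq> (\<lambda>_. 0)"
  obtain \<kappa> where k: "\<kappa> \<in> M" and c: "tchart \<kappa> \<in> charts_at (CB) P"
    by (rule point_chart[OF P])
  interpret hermitian_chart M A c lam mu g J G \<kappa> by (rule hermitian_chart_at[OF k])
  have "chart_map T P \<in> chart_img T" using c by (auto simp: charts_at_def chart_img_def)
  then have y: "fst (chart_map T P) \<in> chart_img \<kappa>" using T_img by (simp add: mem_Times_iff)
  have zero: "(\<lambda>_. 0) \<in> tangent_space (CB) P"
    using TM.tangent_combination[OF u u, of 0 0] by simp
  have "u T \<noteq> 0" using TM.tangent_eqI[OF c u zero] nz by auto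
  from H_positive[OF y this] show "G P u u > 0" by (simp add: G_chart[OF k c u u])
next
  fix \<eta> a b assume "\<eta> \<in> CB"
  then obtain \<kappa> where k: "\<kappa> \<in> M" "\<eta> = tchart \<kappa>" by (rule bundle_chart)
  interpret hermitian_chart M A c lam mu g J G \<kappa> by (rule hermitian_chart_at[OF k(1)])
  show "smooth_on (chart_img \<eta>) (\<lambda>y. G (chart_inv \<eta> y) (coord_vec (CB) \<eta> (chart_inv \<eta> y) a)
      (coord_vec (CB) \<eta> (chart_inv \<eta> y) b))"
    using smooth_H[of a b] T_img k(2) by (simp add: H_def)
qed

lemma hermitian: "hermitian_structure (CB) G J"
  unfolding hermitian_structure_def
proof (intro conjI allI impI ballI integrable riemannian)
  fix X Y P
  assume "vector_field (CB) X" and "vector_field (CB) Y"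
    and P: "P \<in> points (CB)"
  then have t: "X P \<in> tangent_space (CB) P" "Y P \<in> tangent_space (CB) P"
    by (auto simp: vector_field_def)
  then have Jt: "J P (X P) \<in> tangent_space (CB) P" "J P (Y P) \<in> tangent_space (CB) P"
    using J_endo P by (auto simp: endomorphism_field_def)
  obtain \<kappa> where k: "\<kappa> \<in> M" and c: "tchart \<kappa> \<in> charts_at (CB) P"
    by (rule point_chart[OF P])
  interpret hermitian_chart M A c lam mu g J G \<kappa> by (rule hermitian_chart_at[OF k])
  have "chart_map T P \<in> chart_img T" using c by (auto simp: charts_at_def chart_img_def)
  then have y: "fst (chart_map T P) \<in> chart_img \<kappa>" using T_img by (simp add: mem_Times_iff)
  show "G P (J P (X P)) (J P (Y P)) = G P (X P) (Y P)"
    unfolding G_chart[OF k c Jt] G_chart[OF k c t] TM.endomorphism_field_chart[OF J_endo c t(1)]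
      TM.endomorphism_field_chart[OF J_endo c t(2)]
    by (rule H_hermitian[OF y])
qed

end

theorem theorem5:
  fixes M :: "('m, real^'n::finite) chart set"
    and g :: "'m \<Rightarrow> ('m, real^'n) tvec \<Rightarrow> ('m, real^'n) tvec \<Rightarrow> real"
    and c A :: real
    and lam mu :: "real \<Rightarrow> real"
    and J :: "('m, 'n) cotangent_point \<Rightarrow> ('m, 'n) cotangent_tvec \<Rightarrow> ('m, 'n) cotangent_tvec"
    and G :: "('m, 'n) cotangent_point \<Rightarrow> ('m, 'n) cotangent_tvec \<Rightarrow> ('m, 'n) cotangent_tvec \<Rightarrow> real"
  assumes "smooth_manifold M"
    and "riemannian_metric M g"
    and "constant_sectional_curvature M g c"
    and "smooth_on {0..} lam"
    and "smooth_on {0..} mu"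
    and "\<forall>t\<ge>0. lam t > 0"
    and "\<forall>t\<ge>0. (A\<^sup>2 - 2 * c * t * (lam t)\<^sup>2) / (lam t + 2 * t * halfline_deriv lam t) > 0"
    and "\<forall>t\<ge>0. lam t + 2 * t * mu t > 0"
    and "A > 0"
    and "endomorphism_field (cotangent_bundle M) J"
    and "\<forall>\<kappa>\<in>M. \<forall>P\<in>chart_dom (cotangent_chart M \<kappa>). \<forall>i.
           J P (delta_dq M g \<kappa> P i) =
             (\<lambda>\<eta>. \<Sum>j\<in>UNIV. J1_coeff A c lam M g \<kappa> P i j *\<^sub>R d_dp M \<kappa> P j \<eta>)"
    and "\<forall>\<kappa>\<in>M. \<forall>P\<in>chart_dom (cotangent_chart M \<kappa>). \<forall>i.
           J P (d_dp M \<kappa> P i) =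
             (\<lambda>\<eta>. - (\<Sum>j\<in>UNIV. J2_coeff A c lam M g \<kappa> P i j *\<^sub>R delta_dq M g \<kappa> P j \<eta>))"
    and "symmetric_bilinear_field (cotangent_bundle M) G"
    and "\<forall>\<kappa>\<in>M. \<forall>P\<in>chart_dom (cotangent_chart M \<kappa>). \<forall>i j.
           G P (delta_dq M g \<kappa> P i) (delta_dq M g \<kappa> P j) =
             c1_coeff A (energy_density M g \<kappa> P) * g_lower M g \<kappa> P i j
             + d1_coeff A c lam mu (energy_density M g \<kappa> P) * mom M \<kappa> P $ i * mom M \<kappa> P $ j"
    and "\<forall>\<kappa>\<in>M. \<forall>P\<in>chart_dom (cotangent_chart M \<kappa>). \<forall>i j.
           G P (d_dp M \<kappa> P i) (d_dp M \<kappa> P j) =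
             c2_coeff A lam (energy_density M g \<kappa> P) * g_upper M g \<kappa> P i j
             + d2_coeff A c lam mu (energy_density M g \<kappa> P)
               * g_raised M g \<kappa> P i * g_raised M g \<kappa> P j"
    and "\<forall>\<kappa>\<in>M. \<forall>P\<in>chart_dom (cotangent_chart M \<kappa>). \<forall>i j.
           G P (d_dp M \<kappa> P i) (delta_dq M g \<kappa> P j) = 0"
  shows "hermitian_structure (cotangent_bundle M) G J"
proof -
  interpret hermitian_data M A c lam mu g J G
  proof
    show "smooth_atlas M" using assms(1) by (simp add: smooth_manifold_def)
  qed (simp_all only: assms(2-5,9,10,13) assms(6-8)[rule_format] assms(11,12)[rule_format]
      assms(14-16)[rule_format])
  show ?thesis by (rule hermitian)
qed

end
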